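(* For every $f\in\mathcal{S}_{*q,-1/2}(\mathbb{R}_q)$ the following inversion formulas for the operator $W_{\alpha,q}$ hold: $$f=W_{\alpha,q}\circ R_{\alpha,q}\circ K_{\alpha,q,1}(f),$$ $$f=W_{\alpha,q}\circ K_{\alpha,q,2}\circ R_{\alpha,q}(f).$$
   Context: Fix $q\in\,]0,1[$ with $\frac{\log(1-q)}{\log q}\in\mathbb{Z}$ and $\alpha>-\frac12$. $(a;q)_0=1$, $(a;q)_n=\prod_{k=0}^{n-1}(1-aq^k)$, $(a;q)_\infty=\prod_{k\ge0}(1-aq^k)$; $\Gamma_q(x)=\frac{(q;q)_\infty}{(q^x;q)_\infty}(1-q)^{1-x}$, and $\Gamma_{q^2}$ is the same with $q$ replaced by $q^2$. $\mathbb{R}_{q,+}=\{q^n:n\in\mathbb{Z}\}$, $\widetilde{\mathbb{R}}_{q,+}=\mathbb{R}_{q,+}\cup\{0\}$, $\mathbb{R}_q=\{\pm q^n:n\in\mathbb{Z}\}\cup\{0\}$. Jackson integrals: $\int_0^af(x)d_qx=(1-q)a\sum_{n\ge0}f(aq^n)q^n$, $\int_0^\infty f(x)d_qx=(1-q)\sum_{n\in\mathbb{Z}}f(q^n)q^n$, $\int_a^\infty=\int_0^\infty-\int_0^a$. $q$-derivative: $D_qf(x)=\frac{f(x)-f(qx)}{(1-q)x}$ for $x\ne0$, $D_qf(0)=f'(0)$. $\mathcal{S}_{*q}(\mathbb{R}_q)$: the restrictions to $\mathbb{R}_q$ of even, infinitely $q$-differentiable functions $f$ on $\mathbb{R}$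 with $P_{n,m,q}(f)=\sup_{x\in\mathbb{R},\,0\le k\le n}|(1+x^2)^mD_q^kf(x)|<\infty$ for all $n,m\in\mathbb{N}$, with the induced topology of these semi-norms. For $\beta\in\{\alpha,-\frac12\}$, $\mathcal{S}_{*q,\beta}(\mathbb{R}_q)=\{f\in\mathcal{S}_{*q}(\mathbb{R}_q):\int_0^\infty f(x)x^{2k+2\beta+1}d_qx=0,\ k=0,1,\dots\}$. For $\beta\in\{\alpha,-\frac12\}$: $j_\beta^{(3)}(z;q^2)=\sum_{n\ge0}\frac{(-1)^nq^{n(n-1)}(1-q)^{2n}z^{2n}}{(q^2;q^2)_n(q^{2\beta+2};q^2)_n}$, $c_{\beta,q}=\frac{(1+q^{-1})^{-\beta}}{\Gamma_{q^2}(\beta+1)}$. $q$-Bessel Fourier transform: $\mathcal{F}_{\alpha,q}(f)(\lambda)=c_{\alpha,q}\int_0^\infty f(x)j_\alpha^{(3)}(\lambda x;q^2)x^{2\alpha+1}d_qx$, with $\mathcal{F}_{\alpha,q}^{-1}=q^{-4\alpha-2}\mathcal{F}_{\alpha,q}$ on $\mathcal{S}_{*q}(\mathbb{R}_q)$. $q$-Fourier-cosine transform: $\mathcal{F}_q(f)(\lambda)=c_{-1/2,q}\int_0^\infty f(x)\cos(\lambda x;q^2)d_qx$ with $\cos(x;q^2)=j_{-1/2}^{(3)}(x;q^2)$; $\mathcal{F}_q^{-1}=\mathcal{F}_q$. $q$-Riemann-Liouville transform: $R_{\alpha,q}(f)(x)=\frac{(1+q)\Gamma_{q^2}(\alpha+1)}{\Gamma_{q^2}(1/2)\Gamma_{q^2}(\alpha+1/2)}\int_0^1\frac{(t^2q^2;q^2)_\infty}{(t^2q^{2\alpha+1};q^2)_\infty}f(xt)\,d_qt$.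 $q$-Weyl transform: $W_{\alpha,q}(f)(x)=\frac{q(1+q^{-1})^{-\alpha+1/2}}{\Gamma_{q^2}(\alpha+1/2)}\int_{qx}^\infty\frac{(q^2x^2/t^2;q^2)_\infty}{(q^{2\alpha+1}x^2/t^2;q^2)_\infty}f(t)t^{2\alpha}d_qt$ for $x\in\widetilde{\mathbb{R}}_{q,+}$, extended evenly to $\mathbb{R}_q$; on $\mathcal{S}_{*q}(\mathbb{R}_q)$ one has $\mathcal{F}_{\alpha,q}=\mathcal{F}_q\circ W_{\alpha,q}$. With $\kappa_\alpha=\frac{\Gamma_{q^2}(1/2)}{q^{3\alpha+3/2}(1+q)^{\alpha+1/2}\Gamma_{q^2}(\alpha+1)}$: $K_{\alpha,q,1}(f)=\kappa_\alpha\,\mathcal{F}_q^{-1}(|\lambda|^{2\alpha+1}\mathcal{F}_q(f))$ on $\mathcal{S}_{*q,-1/2}(\mathbb{R}_q)$, and $K_{\alpha,q,2}(f)=\kappa_\alpha\,\mathcal{F}_{\alpha,q}^{-1}(|\lambda|^{2\alpha+1}\mathcal{F}_{\alpha,q}(f))$ on $\mathcal{S}_{*q,\alpha}(\mathbb{R}_q)$. *)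

theory Defs
  imports "HOL-Analysis.Analysis"
begin

definition qpoch :: "real \<Rightarrow> real \<Rightarrow> nat \<Rightarrow> real" where
  "qpoch a q n = (\<Prod>k<n. 1 - a * q ^ k)"

definition qpoch_inf :: "real \<Rightarrow> real \<Rightarrow> real" where
  "qpoch_inf a q = (\<Prod>k. 1 - a * q ^ k)"

definition q_Gamma :: "real \<Rightarrow> real \<Rightarrow> real" where
  "q_Gamma q x = qpoch_inf q q / qpoch_inf (q powr x) q * (1 - q) powr (1 - x)"

definition Rq :: "real \<Rightarrow> real set" where
  "Rq q = {x. \<exists>n::int. x = q powi n \<or> x = - (q powi n)} \<union> {0}"

definition jackson :: "real \<Rightarrow> real \<Rightarrow> (real \<Rightarrow> complex) \<Rightarrow> complex" where
  "jackson q a f = of_real ((1 - q) * a) * (\<Sum>n. f (a * q ^ n) * of_real (q ^ n))"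

definition jackson_inf :: "real \<Rightarrow> (real \<Rightarrow> complex) \<Rightarrow> complex" where
  "jackson_inf q f =
     of_real (1 - q) * (\<Sum>\<^sub>\<infinity>n\<in>(UNIV :: int set). f (q powi n) * of_real (q powi n))"

definition jackson_tail :: "real \<Rightarrow> real \<Rightarrow> (real \<Rightarrow> complex) \<Rightarrow> complex" where
  "jackson_tail q a f = jackson_inf q f - jackson q a f"

definition Dq :: "real \<Rightarrow> (real \<Rightarrow> complex) \<Rightarrow> real \<Rightarrow> complex" where
  "Dq q f x = (if x = 0 then vector_derivative f (at 0)
               else (f x - f (q * x)) / of_real ((1 - q) * x))"

text \<open>Away from \<open>0\<close> the quotient in \<^const>\<open>Dq\<close> always exists, so being infinitely
  \<open>q\<close>-differentiable only constrains the iterates at \<open>0\<close>.\<close>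

definition inf_q_differentiable :: "real \<Rightarrow> (real \<Rightarrow> complex) \<Rightarrow> bool" where
  "inf_q_differentiable q f \<longleftrightarrow> (\<forall>k. ((Dq q ^^ k) f) differentiable (at 0))"

definition q_seminorm :: "real \<Rightarrow> nat \<Rightarrow> nat \<Rightarrow> (real \<Rightarrow> complex) \<Rightarrow> ereal" where
  "q_seminorm q n m f =
     (SUP (x, k) \<in> UNIV \<times> {..n}. ereal (norm (of_real ((1 + x\<^sup>2) ^ m) * (Dq q ^^ k) f x)))"

text \<open>A function on \<open>Rq q\<close> is represented by a total function that is \<^const>\<open>undefined\<close>
  outside \<open>Rq q\<close>, so equality of functions is equality on \<open>Rq q\<close>. All operators
  below evaluate their argument on \<open>Rq q\<close> only and again return such functions.\<close>

definition q_schwartz :: "real \<Rightarrow> (real \<Rightarrow> complex) set" where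
  "q_schwartz q = {restrict g (Rq q) | g.
     (\<forall>x. g (- x) = g x) \<and> inf_q_differentiable q g \<and> (\<forall>n m. q_seminorm q n m g < \<infinity>)}"

definition q_schwartz0 :: "real \<Rightarrow> real \<Rightarrow> (real \<Rightarrow> complex) set" where
  "q_schwartz0 q \<beta> = {f \<in> q_schwartz q.
     \<forall>k::nat. jackson_inf q (\<lambda>x. f x * of_real (x powr (2 * real k + 2 * \<beta> + 1))) = 0}"

definition q_bessel_j :: "real \<Rightarrow> real \<Rightarrow> real \<Rightarrow> real" where
  "q_bessel_j q \<beta> z =
     (\<Sum>n. (- 1) ^ n * q ^ (n * (n - 1)) * (1 - q) ^ (2 * n) * z ^ (2 * n)
            / (qpoch (q\<^sup>2) (q\<^sup>2) n * qpoch (q powr (2 * \<beta> + 2)) (q\<^sup>2) n))"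

definition q_cos :: "real \<Rightarrow> real \<Rightarrow> real" where
  "q_cos q z = q_bessel_j q (- 1 / 2) z"

definition q_const :: "real \<Rightarrow> real \<Rightarrow> real" where
  "q_const q \<beta> = (1 + 1 / q) powr (- \<beta>) / q_Gamma (q\<^sup>2) (\<beta> + 1)"

definition q_bessel_fourier :: "real \<Rightarrow> real \<Rightarrow> (real \<Rightarrow> complex) \<Rightarrow> real \<Rightarrow> complex" where
  "q_bessel_fourier q \<alpha> f = (\<lambda>l\<in>Rq q. of_real (q_const q \<alpha>) *
     jackson_inf q (\<lambda>x. f x * of_real (q_bessel_j q \<alpha> (l * x) * x powr (2 * \<alpha> + 1))))"

text \<open>The inverse transforms are given by their explicit formulas on \<^const>\<open>q_schwartz\<close>;
  these formulas use the arithmetic condition that \<open>1 - q\<close> is an integer power of \<open>q\<close>.\<close>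

definition q_bessel_fourier_inv :: "real \<Rightarrow> real \<Rightarrow> (real \<Rightarrow> complex) \<Rightarrow> real \<Rightarrow> complex" where
  "q_bessel_fourier_inv q \<alpha> f =
     (\<lambda>x\<in>Rq q. of_real (q powr (- 4 * \<alpha> - 2)) * q_bessel_fourier q \<alpha> f x)"

definition q_cos_fourier :: "real \<Rightarrow> (real \<Rightarrow> complex) \<Rightarrow> real \<Rightarrow> complex" where
  "q_cos_fourier q f = (\<lambda>l\<in>Rq q. of_real (q_const q (- 1 / 2)) *
     jackson_inf q (\<lambda>x. f x * of_real (q_cos q (l * x))))"

definition q_cos_fourier_inv :: "real \<Rightarrow> (real \<Rightarrow> complex) \<Rightarrow> real \<Rightarrow> complex" where
  "q_cos_fourier_inv q = q_cos_fourier q"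

definition q_riemann_liouville :: "real \<Rightarrow> real \<Rightarrow> (real \<Rightarrow> complex) \<Rightarrow> real \<Rightarrow> complex" where
  "q_riemann_liouville q \<alpha> f = (\<lambda>x\<in>Rq q.
     of_real ((1 + q) * q_Gamma (q\<^sup>2) (\<alpha> + 1)
              / (q_Gamma (q\<^sup>2) (1 / 2) * q_Gamma (q\<^sup>2) (\<alpha> + 1 / 2))) *
     jackson q 1 (\<lambda>t. of_real (qpoch_inf (t\<^sup>2 * q\<^sup>2) (q\<^sup>2)
                             / qpoch_inf (t\<^sup>2 * q powr (2 * \<alpha> + 1)) (q\<^sup>2)) * f (x * t)))"

text \<open>The even extension is expressed through \<open>\<bar>x\<bar>\<close>. At the nodes \<open>t \<le> q \<bar>x\<bar>\<close>, whose
  contributions cancel in \<^const>\<open>jackson_tail\<close>, the numerator of the kernel vanishes; should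
  its denominator vanish as well, the convention \<open>0 / 0 = 0\<close> leaves the integral unaffected.\<close>

definition q_weyl :: "real \<Rightarrow> real \<Rightarrow> (real \<Rightarrow> complex) \<Rightarrow> real \<Rightarrow> complex" where
  "q_weyl q \<alpha> f = (\<lambda>x\<in>Rq q.
     of_real (q * (1 + 1 / q) powr (- \<alpha> + 1 / 2) / q_Gamma (q\<^sup>2) (\<alpha> + 1 / 2)) *
     jackson_tail q (q * \<bar>x\<bar>)
       (\<lambda>t. of_real (qpoch_inf (q\<^sup>2 * \<bar>x\<bar>\<^sup>2 / t\<^sup>2) (q\<^sup>2)
                   / qpoch_inf (q powr (2 * \<alpha> + 1) * \<bar>x\<bar>\<^sup>2 / t\<^sup>2) (q\<^sup>2))
            * f t * of_real (t powr (2 * \<alpha>))))"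

definition q_kappa :: "real \<Rightarrow> real \<Rightarrow> real" where
  "q_kappa q \<alpha> = q_Gamma (q\<^sup>2) (1 / 2)
     / (q powr (3 * \<alpha> + 3 / 2) * (1 + q) powr (\<alpha> + 1 / 2) * q_Gamma (q\<^sup>2) (\<alpha> + 1))"

definition K1 :: "real \<Rightarrow> real \<Rightarrow> (real \<Rightarrow> complex) \<Rightarrow> real \<Rightarrow> complex" where
  "K1 q \<alpha> f = (\<lambda>x\<in>Rq q. of_real (q_kappa q \<alpha>) *
     q_cos_fourier_inv q
       (\<lambda>l\<in>Rq q. of_real (\<bar>l\<bar> powr (2 * \<alpha> + 1)) * q_cos_fourier q f l) x)"

definition K2 :: "real \<Rightarrow> real \<Rightarrow> (real \<Rightarrow> complex) \<Rightarrow> real \<Rightarrow> complex" where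
  "K2 q \<alpha> f = (\<lambda>x\<in>Rq q. of_real (q_kappa q \<alpha>) *
     q_bessel_fourier_inv q \<alpha>
       (\<lambda>l\<in>Rq q. of_real (\<bar>l\<bar> powr (2 * \<alpha> + 1)) * q_bessel_fourier q \<alpha> f l) x)"

end

theory Submission
  imports Defs
begin

text \<open>
  Write \<open>p = q\<^sup>2\<close> and \<open>1 - q = q powi N\<close>. On the lattice \<open>{q powi m}\<close> every operator is a sum over
  integer exponents, and because \<open>1 - q\<close> lies on the lattice, the value of the third Jackson Bessel
  function at \<open>q powi m\<close> is a constant times the entry \<open>s\<^sub>b (m + N - 1)\<close>, \<open>b = q powr (2 * \<beta> + 2)\<close>, of a
  two-sided sequence with generating function
  \<open>(\<Sum>m. s\<^sub>b m * t powi m) = (b / t; p)\<^sub>\<infinity> / (t; p)\<^sub>\<infinity>\<close>.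
  Everything algebraic can be read off from this product. Let \<open>a = q powr (2 * \<alpha> + 1)\<close>, so that the cosine has
  \<open>b = q\<close> and \<open>j\<^sub>\<alpha>\<close> has \<open>b = a * q\<close>.

  \<^item> Multiplication by \<open>(a * q / t; p)\<^sub>\<infinity> / (q / t; p)\<^sub>\<infinity>\<close> turns \<open>s\<^sub>q\<close> into \<open>s\<^sub>a\<^sub>q\<close>; its coefficients are the
    kernel of the Riemann-Liouville transform (\<open>hahn_exton_mult\<close>).
  \<^item> Multiplication by \<open>(t; p)\<^sub>\<infinity> / (t / a; p)\<^sub>\<infinity>\<close> leads from \<open>s\<^sub>a\<^sub>q\<close> back to the rescaled sequence
    \<open>s\<^sub>q m / a powi m\<close>; its coefficients are the kernel of the Weyl transform (\<open>hahn_exton_divide\<close>).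
  \<^item> The substitution \<open>t \<mapsto> b / t\<close> inverts the product, which is the orthogonality relation
    \<open>(\<Sum>k. b powi k * s\<^sub>b (k + m) * s\<^sub>b (k + n)) = 0\<close> for \<open>m \<noteq> n\<close> (\<open>hahn_exton_orthogonality\<close>); it gives
    the inversion of both Fourier transforms (\<open>hahn_exton_inversion\<close>).

  These identities are proved on coefficients: with \<open>e\<^sub>j\<close> the coefficients of \<open>(t; p)\<^sub>\<infinity>\<close> and \<open>h\<^sub>m\<close> those of
  \<open>1 / (t; p)\<^sub>\<infinity>\<close>, the sequence \<open>s\<^sub>b\<close> is the convolution \<open>\<Sum>j. e\<^sub>j * b ^ j * h\<^sub>m\<^sub>+\<^sub>j\<close>, and two finite convolution
  identities suffice.

  For the theorem let \<open>g\<close> be the cosine transform of \<open>f\<close>. Cosine inversion writes \<open>f\<close> as a superposition of the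
  cosines with weights \<open>g l * q powi l\<close>. Both \<open>R (K\<^sub>1 f)\<close> and \<open>K\<^sub>2 (R f)\<close> are the same constant times the
  superposition of the functions \<open>j\<^sub>\<alpha>\<close> with weights \<open>g l * (a * q) powi l\<close>: in the first case the factor
  \<open>\<lambda> powr (2 * \<alpha> + 1)\<close> in \<open>K\<^sub>1\<close> produces the power of \<open>a\<close> and \<open>R\<close> replaces the cosine by \<open>j\<^sub>\<alpha>\<close>; in the
  second, \<open>R f\<close> is the superposition of the \<open>j\<^sub>\<alpha>\<close> with the weights of \<open>f\<close>, and Bessel inversion makes \<open>K\<^sub>2\<close>
  multiply these by \<open>a powi l\<close>. The Weyl transform undoes this factor and replaces \<open>j\<^sub>\<alpha>\<close> by the cosine,
  so that the cosine expansion of \<open>f\<close> returns; the \<open>q\<close>-Gamma factors cancel (\<open>constants_cancel\<close>). At the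
  origin both sides are limits along the lattice.

  The analysis consists in interchanging sums. The sequences \<open>s\<^sub>b\<close> are bounded, and at negative indices they are
  smaller than any power (\<open>hahn_exton_bound\<close>); the function \<open>g\<close> decays faster than any power at infinity, because
  two summations by parts move the square of the frequency onto the second \<open>q\<close>-derivative of \<open>f\<close>
  (\<open>hahn_exton_series_rapid_decay\<close>). With suitable choices of these bounds each double sum is dominated by a product
  of two convergent series, or becomes so after a shift of one index.
\<close>

section \<open>Dominated rearrangement of infinite sums\<close>

lemma summable_on_Times_dominated:
  fixes F :: "'a \<Rightarrow> 'b \<Rightarrow> 'c :: banach" and C :: "'a \<Rightarrow> real" and D :: "'b \<Rightarrow> real"
  assumes F: "\<And>x y. norm (F x y) \<le> C x * D y"
    and C: "C summable_on UNIV" and D: "D summable_on UNIV"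
  shows "(\<lambda>(x, y). F x y) summable_on UNIV \<times> UNIV"
proof -
  have C': "(\<lambda>x. \<bar>C x\<bar>) summable_on UNIV" and D': "(\<lambda>y. \<bar>D y\<bar>) summable_on UNIV"
    using C D summable_on_iff_abs_summable_on_real[of C] summable_on_iff_abs_summable_on_real[of D]
    by simp_all
  have "(\<lambda>(x, y). \<bar>C x\<bar> * \<bar>D y\<bar>) summable_on (UNIV \<times> UNIV)"
    by (rule summable_on_SigmaI[where g = "\<lambda>x. \<bar>C x\<bar> * (\<Sum>\<^sub>\<infinity>y. \<bar>D y\<bar>)"])
      (auto intro!: has_sum_cmult_right summable_on_cmult_left C' has_sum_infsum[OF D'])
  moreover have "norm (case z of (x, y) \<Rightarrow> F x y) \<le> (case z of (x, y) \<Rightarrow> \<bar>C x\<bar> * \<bar>D y\<bar>)" for z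
    using F by (auto split: prod.splits simp flip: abs_mult intro: order_trans[OF _ abs_ge_self])
  ultimately have "(\<lambda>z. norm (case z of (x, y) \<Rightarrow> F x y)) summable_on (UNIV \<times> UNIV)"
    by (rule Infinite_Sum.abs_summable_on_comparison_test')
  then show ?thesis
    by (rule abs_summable_summable)
qed

text \<open>
  The form of Fubini's theorem behind the interchanges below: a product majorant makes the double family absolutely
  summable.
\<close>

lemma infsum_swap_dominated:
  fixes F :: "'a \<Rightarrow> 'b \<Rightarrow> 'c :: banach" and C :: "'a \<Rightarrow> real" and D :: "'b \<Rightarrow> real"
  assumes "\<And>x y. norm (F x y) \<le> C x * D y" "C summable_on UNIV" "D summable_on UNIV"
  shows "(\<Sum>\<^sub>\<infinity>x. \<Sum>\<^sub>\<infinity>y. F x y) = (\<Sum>\<^sub>\<infinity>y. \<Sum>\<^sub>\<infinity>x. F x y)"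
  by (rule infsum_swap_banach) (rule summable_on_Times_dominated[OF assms])

text \<open>
  The Cauchy product for families that need not factor: summation along the antidiagonals \<open>n + j = m\<close>.
\<close>

lemma infsum_triangle_dominated:
  fixes G :: "nat \<Rightarrow> nat \<Rightarrow> 'c :: banach" and C D :: "nat \<Rightarrow> real"
  assumes "\<And>x y. norm (G x y) \<le> C x * D y" "C summable_on UNIV" "D summable_on UNIV"
  shows "(\<Sum>\<^sub>\<infinity>n. \<Sum>\<^sub>\<infinity>j. G n j) = (\<Sum>\<^sub>\<infinity>m. \<Sum>n\<le>m. G n (m - n))"
proof -
  define K where "K = (\<lambda>(m, n). G n (m - n))"
  have sm: "(\<lambda>(x, y). G x y) summable_on UNIV \<times> UNIV"
    by (rule summable_on_Times_dominated[OF assms])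
  have bij: "bij_betw (\<lambda>(n, j). (n + j, n)) (UNIV \<times> UNIV) (Sigma (UNIV :: nat set) (\<lambda>m. {..m}))"
    by (rule bij_betwI[where g = "\<lambda>(m, n). (n, m - n)"]) auto
  have K: "(\<lambda>z. K (case z of (n, j) \<Rightarrow> (n + j, n))) = (\<lambda>(x, y). G x y)"
    by (auto simp: K_def fun_eq_iff)
  have "K summable_on (Sigma UNIV (\<lambda>m. {..m}))"
    using sm summable_on_reindex_bij_betw[OF bij, of K] unfolding K by simp
  then have "(\<Sum>\<^sub>\<infinity>m. \<Sum>\<^sub>\<infinity>n\<in>{..m}. K (m, n)) = infsum K (Sigma UNIV (\<lambda>m. {..m}))"
    by (rule infsum_Sigma_banach)
  also have "\<dots> = infsum (\<lambda>(x, y). G x y) (UNIV \<times> UNIV)"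
    using infsum_reindex_bij_betw[OF bij, of K] unfolding K by simp
  also have "\<dots> = (\<Sum>\<^sub>\<infinity>n. \<Sum>\<^sub>\<infinity>j. G n j)"
    using infsum_Sigma_banach[OF sm] by simp
  finally show ?thesis
    by (simp add: K_def)
qed

lemma summable_on_nat_geometric:
  fixes f :: "nat \<Rightarrow> 'c :: banach"
  assumes "0 \<le> x" "x < 1" "\<And>n. norm (f n) \<le> C * x ^ n"
  shows "(\<lambda>n. norm (f n)) summable_on UNIV"
proof (rule Infinite_Sum.abs_summable_on_comparison_test')
  have "summable (\<lambda>n. norm (C * x ^ n))"
    using assms by (simp add: abs_mult summable_mult summable_geometric)
  then show "(\<lambda>n. C * x ^ n) summable_on UNIV"
    by (rule norm_summable_imp_summable_on)
qed (use assms in auto)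

lemma int_sum_split:
  fixes f :: "int \<Rightarrow> real"
  assumes "(\<lambda>n. f (int n)) summable_on UNIV" "(\<lambda>n. f (- int n)) summable_on UNIV"
  shows "f summable_on UNIV"
proof -
  have "f summable_on (range int)"
    using assms(1) by (subst summable_on_reindex) (auto simp: o_def)
  moreover have "f summable_on (range (\<lambda>n. - int n))"
    using assms(2) by (subst summable_on_reindex) (auto simp: o_def inj_on_def)
  moreover have "(UNIV :: int set) = range int \<union> range (\<lambda>n. - int n)"
    by (auto simp: image_iff) (metis int_cases2)
  ultimately show ?thesis
    by (metis summable_on_union)
qed

text \<open>
  A two-sided sequence is summable as soon as one geometric bound with ratio below \<open>1\<close> controls it at \<open>+\<infinity>\<close> and one
  with ratio above \<open>1\<close> controls it at \<open>-\<infinity>\<close>.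
\<close>

lemma summable_on_int_geometric:
  fixes f :: "int \<Rightarrow> 'c :: banach"
  assumes x: "0 < x" "x < 1" and y: "1 < y"
    and pos: "\<And>k. norm (f k) \<le> C * x powi k" and neg: "\<And>k. norm (f k) \<le> D * y powi k"
  shows "(\<lambda>k. norm (f k)) summable_on UNIV"
proof (rule int_sum_split)
  show "(\<lambda>n. norm (f (int n))) summable_on UNIV"
    using pos[of "int _"] x by (intro summable_on_nat_geometric[of x _ C]) auto
  have "norm (f (- int n)) \<le> D * (1 / y) ^ n" for n
    using neg[of "- int n"] y by (simp add: power_int_minus power_divide field_simps)
  then show "(\<lambda>n. norm (f (- int n))) summable_on UNIV"
    using y by (intro summable_on_nat_geometric[of "1 / y" _ D]) auto
qed

lemma infsum_nat_eq_suminf: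
  fixes f :: "nat \<Rightarrow> 'c :: banach"
  assumes "(\<lambda>n. norm (f n)) summable_on UNIV"
  shows "infsum f UNIV = suminf f"
  using has_sum_imp_sums[OF has_sum_infsum[OF abs_summable_summable[OF assms]]] sums_unique by blast

lemma power_int_minus_add_nat:
  fixes r :: "'a :: field"
  assumes "r \<noteq> 0"
  shows "r powi (- (m + int j)) = r powi (- m) * (1 / r) ^ j"
  using power_int_diff[of r "- m" "int j"] assms by (simp add: divide_inverse power_inverse)

lemma bij_int_shift: "bij_betw (\<lambda>k::int. k + c) UNIV UNIV"
  by (rule bij_betwI[where g = "\<lambda>k. k - c"]) auto

lemma infsum_int_shift: "(\<Sum>\<^sub>\<infinity>k::int. f (k + c)) = (\<Sum>\<^sub>\<infinity>k. f k)"
  by (rule infsum_reindex_bij_betw[OF bij_int_shift])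

lemma summable_on_int_shift:
  "(\<lambda>k::int. f (k + c)) summable_on UNIV \<longleftrightarrow> f summable_on UNIV"
  by (rule summable_on_reindex_bij_betw[OF bij_int_shift])

lemma infsum_of_real:
  "f summable_on A \<Longrightarrow> (\<Sum>\<^sub>\<infinity>x\<in>A. of_real (f x) :: complex) = of_real (infsum f A)"
  by (rule infsumI) (rule has_sum_of_real[OF has_sum_infsum])

lemma infsum_diff:
  fixes f g :: "'a \<Rightarrow> complex"
  assumes "f summable_on A" "g summable_on A"
  shows "(\<Sum>\<^sub>\<infinity>x\<in>A. f x - g x) = infsum f A - infsum g A"
  using has_sum_add[OF has_sum_infsum[OF assms(1)] has_sum_uminusI[OF has_sum_infsum[OF assms(2)]]]
  by (simp add: infsumI)

section \<open>Coefficient sequences and their finite convolutions\<close>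

text \<open>
  The coefficient of \<open>t ^ j\<close> in \<open>(t; p)\<^sub>\<infinity>\<close>, by Euler's identity.
\<close>

definition euler_coeff :: "real \<Rightarrow> nat \<Rightarrow> real" where
  "euler_coeff p j = (- 1) ^ j * p ^ (j choose 2) / qpoch p p j"

text \<open>
  The coefficient of \<open>t powi m\<close> in \<open>1 / (t; p)\<^sub>\<infinity>\<close>, on all integers so that convolutions with it need no range
  restriction.
\<close>

definition inv_qfact :: "real \<Rightarrow> int \<Rightarrow> real" where
  "inv_qfact p m = (if m < 0 then 0 else 1 / qpoch p p (nat m))"

text \<open>
  The coefficient of \<open>t ^ n\<close> in \<open>(a * t; p)\<^sub>\<infinity> / (t; p)\<^sub>\<infinity>\<close>, by the \<open>q\<close>-binomial theorem. It is the kernel of the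
  Riemann-Liouville and Weyl transforms on the lattice.
\<close>

definition qbinom_coeff :: "real \<Rightarrow> real \<Rightarrow> nat \<Rightarrow> real" where
  "qbinom_coeff p a n = qpoch a p n / qpoch p p n"

text \<open>
  The coefficient of \<open>t powi m\<close> in \<open>(b / t; p)\<^sub>\<infinity> / (t; p)\<^sub>\<infinity>\<close>, that is, up to a constant factor, the Hahn-Exton
  function \<open>\<^sub>1\<phi>\<^sub>1(0; b; p, p powi (m + 1))\<close>; see \<open>q_bessel_j_eq_hahn_exton\<close>.
\<close>

definition hahn_exton :: "real \<Rightarrow> real \<Rightarrow> int \<Rightarrow> real" where
  "hahn_exton p b m = (\<Sum>\<^sub>\<infinity>j. euler_coeff p j * b ^ j * inv_qfact p (m + int j))"

lemma qpoch_0 [simp]: "qpoch a p 0 = 1"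
  by (simp add: qpoch_def)

lemma qpoch_Suc: "qpoch a p (Suc n) = qpoch a p n * (1 - a * p ^ n)"
  by (simp add: qpoch_def)

text \<open>
  A superposition of dilates: on the lattice, dilation by \<open>q powi l\<close> is a shift of the index by \<open>l\<close>.
\<close>

definition hahn_exton_series :: "real \<Rightarrow> real \<Rightarrow> (int \<Rightarrow> complex) \<Rightarrow> int \<Rightarrow> complex" where
  "hahn_exton_series p b G m = (\<Sum>\<^sub>\<infinity>l. G l * of_real (hahn_exton p b (l + m)))"

lemma hahn_exton_series_cmult:
  "hahn_exton_series p b (\<lambda>k. c * G k) m = c * hahn_exton_series p b G m"
  unfolding hahn_exton_series_def by (simp add: infsum_cmult_right' mult.assoc)

context
  fixes p :: real
  assumes p: "0 < p" "p < 1"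
begin

lemma one_minus_power_pos: "0 < 1 - p * p ^ n"
  using p power_Suc_less_one[of p n] by simp

lemma qfact_pos: "0 < qpoch p p n"
  unfolding qpoch_def by (rule prod_pos) (use one_minus_power_pos in auto)

lemma euler_coeff_0 [simp]: "euler_coeff p 0 = 1"
  by (simp add: euler_coeff_def numeral_2_eq_2)

lemma euler_coeff_Suc: "euler_coeff p (Suc j) * (1 - p ^ Suc j) = - (p ^ j * euler_coeff p j)"
  using qfact_pos[of j] one_minus_power_pos[of j]
  by (simp add: euler_coeff_def qpoch_Suc numeral_2_eq_2 power_add)

lemma qbinom_coeff_0 [simp]: "qbinom_coeff p a 0 = 1"
  by (simp add: qbinom_coeff_def)

lemma qbinom_coeff_Suc:
  "qbinom_coeff p a (Suc n) * (1 - p ^ Suc n) = (1 - a * p ^ n) * qbinom_coeff p a n"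
  using qfact_pos[of n] one_minus_power_pos[of n]
  by (simp add: qbinom_coeff_def qpoch_Suc)

lemma inv_qfact_nat: "inv_qfact p (int n) = 1 / qpoch p p n"
  by (simp add: inv_qfact_def)

lemma inv_qfact_neg: "m < 0 \<Longrightarrow> inv_qfact p m = 0"
  by (simp add: inv_qfact_def)

lemma inv_qfact_eq_qbinom_coeff: "inv_qfact p (int n) = qbinom_coeff p 0 n"
  by (simp add: inv_qfact_nat qbinom_coeff_def qpoch_def)

text \<open>
  Comparison of coefficients in \<open>(a * t)\<^sub>\<infinity> / (t)\<^sub>\<infinity> * (t)\<^sub>\<infinity> = (a * t)\<^sub>\<infinity>\<close>. The proof multiplies by
  \<open>1 - p ^ M\<close> and splits this factor over the two indices, which turns the convolution into a first-order
  recurrence in \<open>M\<close>. For \<open>a = 0\<close> it says that the sequences \<open>euler_coeff\<close> and \<open>inv_qfact\<close> are inverse to each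
  other under convolution.
\<close>

lemma sum_qbinom_euler:
  "(\<Sum>n\<le>M. qbinom_coeff p a n * euler_coeff p (M - n)) = euler_coeff p M * a ^ M"
proof (induction M)
  case (Suc M)
  let ?T = "\<lambda>n. qbinom_coeff p a n * euler_coeff p (M - n)"
  have 1: "(\<Sum>n\<le>Suc M. qbinom_coeff p a n * euler_coeff p (Suc M - n) * (1 - p ^ (Suc M - n)))
      = (\<Sum>n\<le>M. - (p ^ (M - n) * ?T n))"
  proof -
    have "qbinom_coeff p a n * euler_coeff p (Suc M - n) * (1 - p ^ (Suc M - n)) = - (p ^ (M - n) * ?T n)"
      if "n \<le> M" for n
      using euler_coeff_Suc[of "M - n"] that
      by (simp only: mult.assoc Suc_diff_le) simp
    then show ?thesis
      unfolding sum.atMost_Suc[of _ M] by simp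
  qed
  have 2: "(\<Sum>n\<le>Suc M. qbinom_coeff p a n * euler_coeff p (Suc M - n) * (p ^ (Suc M - n) * (1 - p ^ n)))
      = (\<Sum>n\<le>M. p ^ (M - n) * (1 - a * p ^ n) * ?T n)"
  proof -
    have "qbinom_coeff p a (Suc n) * euler_coeff p (Suc M - Suc n) * (p ^ (Suc M - Suc n) * (1 - p ^ Suc n))
        = (qbinom_coeff p a (Suc n) * (1 - p ^ Suc n)) * (p ^ (M - n) * euler_coeff p (M - n))" for n
      by (simp only: diff_Suc_Suc mult_ac)
    then have "qbinom_coeff p a (Suc n) * euler_coeff p (Suc M - Suc n) * (p ^ (Suc M - Suc n) * (1 - p ^ Suc n))
        = p ^ (M - n) * (1 - a * p ^ n) * ?T n" for n
      unfolding qbinom_coeff_Suc by (simp only: mult_ac)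
    then show ?thesis
      unfolding sum.atMost_Suc_shift[of _ M] by (simp only:) simp
  qed
  have "(1 - p ^ Suc M) * (\<Sum>n\<le>Suc M. qbinom_coeff p a n * euler_coeff p (Suc M - n)) =
      (\<Sum>n\<le>Suc M. qbinom_coeff p a n * euler_coeff p (Suc M - n) * (1 - p ^ (Suc M - n))) +
      (\<Sum>n\<le>Suc M. qbinom_coeff p a n * euler_coeff p (Suc M - n) * (p ^ (Suc M - n) * (1 - p ^ n)))"
    unfolding sum_distrib_left sum.distrib[symmetric]
  proof (rule sum.cong)
    fix n assume "n \<in> {..Suc M}"
    then have "p ^ Suc M = p ^ (Suc M - n) * p ^ n"
      by (simp flip: power_add)
    then show "(1 - p ^ Suc M) * (qbinom_coeff p a n * euler_coeff p (Suc M - n)) =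
      qbinom_coeff p a n * euler_coeff p (Suc M - n) * (1 - p ^ (Suc M - n)) +
      qbinom_coeff p a n * euler_coeff p (Suc M - n) * (p ^ (Suc M - n) * (1 - p ^ n))"
      by (simp only:) (simp add: algebra_simps)
  qed simp
  also have "\<dots> = - (a * p ^ M) * (\<Sum>n\<le>M. ?T n)"
    unfolding 1 2 sum_distrib_left sum.distrib[symmetric]
  proof (rule sum.cong)
    fix n assume "n \<in> {..M}"
    then have "p ^ M = p ^ (M - n) * p ^ n"
      by (simp flip: power_add)
    then show "- (p ^ (M - n) * ?T n) + p ^ (M - n) * (1 - a * p ^ n) * ?T n = - (a * p ^ M) * ?T n"
      by (simp only:) (simp add: algebra_simps)
  qed simp
  also have "\<dots> = a ^ Suc M * (- (p ^ M * euler_coeff p M))"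
    unfolding Suc.IH by simp
  also have "\<dots> = (1 - p ^ Suc M) * (euler_coeff p (Suc M) * a ^ Suc M)"
    unfolding euler_coeff_Suc[symmetric] by simp
  finally show ?case
    using one_minus_power_pos[of M] by simp
qed simp

text \<open>
  Comparison of coefficients in \<open>(a * t)\<^sub>\<infinity> / (t)\<^sub>\<infinity> * (1 / (a * t)\<^sub>\<infinity>) = 1 / (t)\<^sub>\<infinity>\<close>, by the same method.
\<close>

lemma sum_qbinom_inv_qfact:
  "(\<Sum>n\<le>N. qbinom_coeff p a n * a ^ (N - n) * inv_qfact p (int (N - n))) = inv_qfact p (int N)"
proof (induction N)
  case (Suc N)
  let ?h = "\<lambda>c. a ^ c * qbinom_coeff p 0 c"
  let ?T = "\<lambda>n. qbinom_coeff p a n * ?h (N - n)"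
  have h: "?h (Suc c) * (1 - p ^ Suc c) = a * ?h c" for c
    using qbinom_coeff_Suc[of 0 c] by simp
  have 1: "(\<Sum>n\<le>Suc N. qbinom_coeff p a n * ?h (Suc N - n) * (1 - p ^ n))
      = (\<Sum>n\<le>N. (1 - a * p ^ n) * ?T n)"
  proof -
    have "qbinom_coeff p a (Suc n) * ?h (Suc N - Suc n) * (1 - p ^ Suc n)
        = (qbinom_coeff p a (Suc n) * (1 - p ^ Suc n)) * ?h (N - n)" for n
      by (simp only: diff_Suc_Suc mult_ac)
    then have "qbinom_coeff p a (Suc n) * ?h (Suc N - Suc n) * (1 - p ^ Suc n)
        = (1 - a * p ^ n) * ?T n" for n
      unfolding qbinom_coeff_Suc by (simp only: mult_ac)
    then show ?thesis
      unfolding sum.atMost_Suc_shift[of _ N] by (simp only:) simp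
  qed
  have 2: "(\<Sum>n\<le>Suc N. qbinom_coeff p a n * ?h (Suc N - n) * (p ^ n * (1 - p ^ (Suc N - n))))
      = (\<Sum>n\<le>N. a * p ^ n * ?T n)"
  proof -
    have "qbinom_coeff p a n * ?h (Suc N - n) * (p ^ n * (1 - p ^ (Suc N - n)))
        = qbinom_coeff p a n * p ^ n * (?h (Suc (N - n)) * (1 - p ^ Suc (N - n)))" if "n \<le> N" for n
      using that by (simp only: Suc_diff_le mult_ac)
    then have "qbinom_coeff p a n * ?h (Suc N - n) * (p ^ n * (1 - p ^ (Suc N - n)))
        = a * p ^ n * ?T n" if "n \<le> N" for n
      using that unfolding h by (simp only: mult_ac)
    then have "(\<Sum>n\<le>N. qbinom_coeff p a n * ?h (Suc N - n) * (p ^ n * (1 - p ^ (Suc N - n))))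
        = (\<Sum>n\<le>N. a * p ^ n * ?T n)"
      by (intro sum.cong) (auto simp only: atMost_iff)
    then show ?thesis
      unfolding sum.atMost_Suc[of _ N] by (simp only: diff_self_eq_0) simp
  qed
  have "(1 - p ^ Suc N) * (\<Sum>n\<le>Suc N. qbinom_coeff p a n * ?h (Suc N - n)) =
      (\<Sum>n\<le>Suc N. qbinom_coeff p a n * ?h (Suc N - n) * (1 - p ^ n)) +
      (\<Sum>n\<le>Suc N. qbinom_coeff p a n * ?h (Suc N - n) * (p ^ n * (1 - p ^ (Suc N - n))))"
    unfolding sum_distrib_left sum.distrib[symmetric]
  proof (rule sum.cong)
    fix n assume "n \<in> {..Suc N}"
    then have "p ^ Suc N = p ^ (Suc N - n) * p ^ n"
      by (simp flip: power_add)
    then show "(1 - p ^ Suc N) * (qbinom_coeff p a n * ?h (Suc N - n)) =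
      qbinom_coeff p a n * ?h (Suc N - n) * (1 - p ^ n) +
      qbinom_coeff p a n * ?h (Suc N - n) * (p ^ n * (1 - p ^ (Suc N - n)))"
      by (simp only:) (simp add: algebra_simps)
  qed simp
  also have "\<dots> = (\<Sum>n\<le>N. ?T n)"
    unfolding 1 2 sum.distrib[symmetric] by (simp add: algebra_simps)
  also have "\<dots> = qbinom_coeff p 0 N"
    using Suc.IH unfolding inv_qfact_eq_qbinom_coeff by (simp add: mult.assoc)
  also have "\<dots> = (1 - p ^ Suc N) * qbinom_coeff p 0 (Suc N)"
    using qbinom_coeff_Suc[of 0 N] by (simp add: mult.commute)
  finally show ?case
    unfolding inv_qfact_eq_qbinom_coeff mult.assoc using one_minus_power_pos[of N] by simp
qed (simp add: inv_qfact_def)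

section \<open>Infinite products\<close>

lemma convergent_prod_qpoch: "convergent_prod (\<lambda>k. 1 - a * p ^ k)"
proof (rule abs_convergent_prod_imp_convergent_prod, rule summable_imp_abs_convergent_prod)
  show "summable (\<lambda>k. norm (1 - a * p ^ k - 1))"
    using p by (simp add: abs_mult summable_mult summable_geometric)
qed

lemma qpoch_tendsto: "qpoch a p \<longlonglongrightarrow> qpoch_inf a p"
  using convergent_prod_LIMSEQ[OF convergent_prod_qpoch[of a]]
  unfolding qpoch_def qpoch_inf_def LIMSEQ_lessThan_iff_atMost .

lemma qpoch_pos: assumes "a < 1" shows "0 < qpoch a p n"
  unfolding qpoch_def
proof (rule prod_pos)
  fix i
  have "p ^ i \<le> 1"
    using p by (simp add: power_le_one)
  then have "a * p ^ i < 1"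
    using assms p by (cases "a \<le> 0")
      (auto intro: le_less_trans[OF mult_nonpos_nonneg] le_less_trans[OF mult_left_le])
  then show "0 < 1 - a * p ^ i"
    by simp
qed

lemma qpoch_inf_pos: assumes "a < 1" shows "0 < qpoch_inf a p"
proof -
  have "qpoch_inf a p \<noteq> 0"
    unfolding qpoch_inf_def
  proof (rule prodinf_nonzero[OF convergent_prod_qpoch])
    show "1 - a * p ^ i \<noteq> 0" for i
      using qpoch_pos[OF assms, of "Suc i"] by (auto simp: qpoch_Suc)
  qed
  moreover have "0 \<le> qpoch_inf a p"
    using qpoch_tendsto by (rule LIMSEQ_le_const) (auto intro: less_imp_le qpoch_pos[OF assms])
  ultimately show ?thesis
    by simp
qed

lemma qpoch_inf_le_qpoch:
  assumes "0 \<le> a" "a < 1"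
  shows "qpoch_inf a p \<le> qpoch a p n"
proof (rule decseq_ge[OF _ qpoch_tendsto])
  show "decseq (qpoch a p)"
    using p assms qpoch_pos[OF assms(2)]
    by (intro decseq_SucI) (simp add: qpoch_Suc mult_left_le less_imp_le)
qed

lemma qfact_ge: "qpoch_inf p p \<le> qpoch p p n"
  using p by (intro qpoch_inf_le_qpoch) auto

text \<open>
  The bound by \<open>r powi (- m)\<close> is trivial where the left-hand side vanishes and weak elsewhere; its use is that it
  factors over sums of indices, so that it provides product majorants.
\<close>

lemma inv_qfact_bound:
  "0 < r \<Longrightarrow> r \<le> 1 \<Longrightarrow> \<bar>inv_qfact p m\<bar> \<le> 1 / qpoch_inf p p * r powi (- m)"
proof (cases "m < 0")
  case True
  then show "0 < r \<Longrightarrow> \<bar>inv_qfact p m\<bar> \<le> 1 / qpoch_inf p p * r powi (- m)"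
    using qpoch_inf_pos[of p] p by (simp add: inv_qfact_neg)
next
  case False
  then obtain n where m: "m = int n"
    by (metis int_nat_eq not_less)
  assume r: "0 < r" "r \<le> 1"
  have "\<bar>inv_qfact p m\<bar> \<le> 1 / qpoch_inf p p * 1"
    using qfact_ge[of n] qpoch_inf_pos[of p] p qfact_pos[of n]
    by (simp add: m inv_qfact_nat frac_le)
  also have "\<dots> \<le> 1 / qpoch_inf p p * r powi (- m)"
    using r qpoch_inf_pos[of p] p
    by (intro mult_left_mono) (auto simp: m power_int_minus one_le_inverse_iff power_le_one)
  finally show "\<bar>inv_qfact p m\<bar> \<le> 1 / qpoch_inf p p * r powi (- m)" .
qed

lemma inv_qfact_bounded: "\<bar>inv_qfact p m\<bar> \<le> 1 / qpoch_inf p p"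
  using inv_qfact_bound[of 1 m] by simp

lemma qbinom_coeff_bounded: "\<exists>B. \<forall>n. \<bar>qbinom_coeff p a n\<bar> \<le> B"
proof -
  have "Bseq (qpoch a p)"
    using qpoch_tendsto by (auto intro: convergent_imp_Bseq convergentI)
  then obtain K where K: "\<And>n. norm (qpoch a p n) \<le> K" "0 < K"
    unfolding Bseq_def by auto
  have "\<bar>qbinom_coeff p a n\<bar> \<le> K / qpoch_inf p p" for n
    using K(1)[of n] K(2) qfact_ge[of n] qpoch_inf_pos[of p] p qfact_pos[of n]
    by (simp add: qbinom_coeff_def abs_divide frac_le)
  then show ?thesis by blast
qed

lemma summable_euler: "(\<lambda>j. norm (euler_coeff p j * x ^ j)) summable_on UNIV"
proof (rule norm_summable_imp_summable_on)
  have "(\<lambda>n. \<bar>x\<bar> * p ^ n / (1 - p)) \<longlonglongrightarrow> \<bar>x\<bar> * 0 / (1 - p)"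
    using p by (intro tendsto_intros LIMSEQ_power_zero) auto
  then have "eventually (\<lambda>n. \<bar>x\<bar> * p ^ n / (1 - p) < 1 / 2) sequentially"
    by (rule order_tendstoD) simp
  then obtain N where N: "\<And>n. n \<ge> N \<Longrightarrow> \<bar>x\<bar> * p ^ n / (1 - p) < 1 / 2"
    by (auto simp: eventually_sequentially)
  show "summable (\<lambda>j. norm (norm (euler_coeff p j * x ^ j)))"
  proof (rule summable_ratio_test[of "1/2" N])
    fix n assume n: "N \<le> n"
    have pos: "0 < 1 - p * p ^ n" "1 - p \<le> 1 - p * p ^ n"
      using p one_minus_power_pos by (auto simp: mult_left_le power_le_one)
    have eq: "euler_coeff p (Suc n) = - (p ^ n * euler_coeff p n) / (1 - p * p ^ n)"
      using euler_coeff_Suc[of n] pos by (simp add: field_simps)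
    have "norm (euler_coeff p (Suc n) * x ^ Suc n) =
        (\<bar>x\<bar> * p ^ n / (1 - p * p ^ n)) * norm (euler_coeff p n * x ^ n)"
      unfolding eq using pos p by (simp add: abs_mult abs_divide power_abs abs_of_pos[OF pos(1)] mult_ac)
    also have "\<dots> \<le> (\<bar>x\<bar> * p ^ n / (1 - p)) * norm (euler_coeff p n * x ^ n)"
      by (intro mult_right_mono divide_left_mono mult_pos_pos pos) (use p in auto)
    also have "\<dots> \<le> 1 / 2 * norm (euler_coeff p n * x ^ n)"
      using N[OF n] by (intro mult_right_mono) auto
    finally show "norm (norm (norm (euler_coeff p (Suc n) * x ^ Suc n))) \<le>
        1 / 2 * norm (norm (norm (euler_coeff p n * x ^ n)))"
      by simp
  qed simp
qed

lemma summable_euler': "(\<lambda>j. euler_coeff p j * x ^ j) summable_on UNIV"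
  by (rule abs_summable_summable[OF summable_euler])

text \<open>
  The series satisfies the functional equation \<open>e x = (1 - x) * e (x * p)\<close> of the product; iterating it and letting
  the argument tend to \<open>0\<close> identifies the two.
\<close>

lemma euler_identity: "qpoch_inf a p = (\<Sum>\<^sub>\<infinity>j. euler_coeff p j * a ^ j)"
proof -
  define e where "e x = (\<Sum>j. euler_coeff p j * x ^ j)" for x
  have sm: "summable (\<lambda>j. euler_coeff p j * x ^ j)" for x
    using summable_on_imp_summable[OF summable_euler'] .
  have step: "e x = (1 - x) * e (x * p)" for x
  proof -
    have "e x - e (x * p) = (\<Sum>j. euler_coeff p j * (1 - p ^ j) * x ^ j)"
      unfolding e_def suminf_diff[OF sm sm] by (simp add: algebra_simps power_mult_distrib)
    also have "\<dots> = (\<Sum>j. euler_coeff p (Suc j) * (1 - p ^ Suc j) * x ^ Suc j)"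
    proof -
      have "summable (\<lambda>j. euler_coeff p j * x ^ j - euler_coeff p j * (x * p) ^ j)"
        by (rule summable_diff[OF sm sm])
      then have "summable (\<lambda>j. euler_coeff p j * (1 - p ^ j) * x ^ j)"
        by (simp add: algebra_simps power_mult_distrib)
      from suminf_split_head[OF this] show ?thesis
        by simp
    qed
    also have "\<dots> = (\<Sum>j. - x * (euler_coeff p j * (x * p) ^ j))"
      unfolding euler_coeff_Suc by (simp add: algebra_simps power_mult_distrib)
    also have "\<dots> = - x * e (x * p)"
      unfolding e_def by (rule suminf_mult[OF sm])
    finally show ?thesis
      by (simp add: algebra_simps)
  qed
  have iter: "e a = qpoch a p n * e (a * p ^ n)" for n
  proof (induction n)
    case (Suc n)
    then show ?case
      using step[of "a * p ^ n"] by (simp add: qpoch_Suc mult.assoc mult.left_commute mult.commute)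
  qed simp
  have "isCont e 0"
    unfolding e_def by (rule isCont_powser[where K = 1, OF sm]) simp
  moreover have "(\<lambda>n. a * p ^ n) \<longlonglongrightarrow> 0"
    using p by (intro tendsto_mult_right_zero LIMSEQ_power_zero) auto
  ultimately have "(\<lambda>n. e (a * p ^ n)) \<longlonglongrightarrow> e 0"
    by (rule isCont_tendsto_compose)
  moreover have "e 0 = 1"
    unfolding e_def using powser_zero[of "euler_coeff p"] by (simp add: euler_coeff_0)
  ultimately have "(\<lambda>n. qpoch a p n * e (a * p ^ n)) \<longlonglongrightarrow> qpoch_inf a p * 1"
    by (intro tendsto_mult qpoch_tendsto) simp
  then have "qpoch_inf a p = e a"
    unfolding iter[symmetric] by (metis LIMSEQ_const_iff mult.right_neutral)
  then show ?thesis
    by (simp add: e_def infsum_nat_eq_suminf[OF summable_euler])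
qed

lemma qpoch_inf_split: "qpoch_inf a p = qpoch a p n * qpoch_inf (a * p ^ n) p"
proof -
  have "(\<lambda>k. 1 - a * p ^ k) has_prod ((\<Prod>k<n. 1 - a * p ^ k) * (\<Prod>k. 1 - a * p ^ (k + n)))"
    by (rule has_prod_ignore_initial_segment'[OF convergent_prod_qpoch])
  then have "qpoch_inf a p = (\<Prod>k<n. 1 - a * p ^ k) * (\<Prod>k. 1 - a * p ^ (k + n))"
    unfolding qpoch_inf_def by (rule has_prod_unique[symmetric])
  then show ?thesis
    by (simp add: qpoch_def qpoch_inf_def power_add mult_ac)
qed

text \<open>
  For negative \<open>m\<close> the product contains the factor \<open>1 - p powi 0\<close> and vanishes, in accordance with the extension of
  \<open>inv_qfact\<close> by zero.
\<close>

lemma qpoch_inf_power_int: "qpoch_inf (p powi (m + 1)) p = qpoch_inf p p * inv_qfact p m"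
proof (cases "m < 0")
  case True
  then obtain n where m: "m = - int (Suc n)"
    by (metis negD)
  have "p powi (m + 1) * p ^ n = 1"
    using p by (simp add: m power_int_minus field_simps)
  then have "qpoch (p powi (m + 1)) p (Suc n) = 0"
    by (simp add: qpoch_Suc)
  then show ?thesis
    using True qpoch_inf_split[of "p powi (m + 1)" "Suc n"] by (simp add: inv_qfact_neg)
next
  case False
  then obtain n where m: "m = int n"
    by (metis int_nat_eq not_less)
  then have "p powi (m + 1) = p * p ^ n"
    using p by (simp add: power_int_add)
  then show ?thesis
    using qpoch_inf_split[of p n] qfact_pos[of n] by (simp add: m inv_qfact_nat)
qed

section \<open>Hahn-Exton functions\<close>

lemma summable_hahn_exton:
  "(\<lambda>j. norm (euler_coeff p j * b ^ j * inv_qfact p (m + int j))) summable_on UNIV"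
proof (rule Infinite_Sum.abs_summable_on_comparison_test')
  show "(\<lambda>j. norm (euler_coeff p j * b ^ j) * (1 / qpoch_inf p p)) summable_on UNIV"
    by (rule summable_on_cmult_left[OF summable_euler])
  show "norm (euler_coeff p j * b ^ j * inv_qfact p (m + int j)) \<le>
      norm (euler_coeff p j * b ^ j) * (1 / qpoch_inf p p)" for j
    unfolding norm_mult[of _ "inv_qfact p _"] using inv_qfact_bounded[of "m + int j"]
    by (intro mult_left_mono) auto
qed

text \<open>
  For \<open>r = 1\<close> this is boundedness; for small \<open>r\<close> it is decay at \<open>m \<rightarrow> -\<infinity>\<close> at any prescribed
  geometric rate. The rate is chosen below according to the weights that have to be compensated.
\<close>

lemma hahn_exton_bound:
  assumes "0 < b" "0 < r" "r \<le> 1"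
  shows "\<exists>C. \<forall>m. \<bar>hahn_exton p b m\<bar> \<le> C * r powi (- m)"
proof (rule exI, rule allI)
  fix m
  let ?H = "1 / qpoch_inf p p"
  have sm: "(\<lambda>j. norm (euler_coeff p j * (b / r) ^ j)) summable_on UNIV"
    by (rule summable_euler)
  have "\<bar>hahn_exton p b m\<bar> \<le> (\<Sum>\<^sub>\<infinity>j. norm (euler_coeff p j * b ^ j * inv_qfact p (m + int j)))"
    using norm_infsum_bound[OF summable_hahn_exton] by (simp add: hahn_exton_def)
  also have "\<dots> \<le> (\<Sum>\<^sub>\<infinity>j. norm (euler_coeff p j * (b / r) ^ j) * (?H * r powi (- m)))"
  proof (rule infsum_mono[OF summable_hahn_exton summable_on_cmult_left[OF sm]])
    fix j
    have "r powi (- (m + int j)) = r powi (- m) * (1 / r) ^ j"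
      using assms by (intro power_int_minus_add_nat) auto
    then have "norm (euler_coeff p j * b ^ j * inv_qfact p (m + int j)) \<le>
        norm (euler_coeff p j * b ^ j) * (?H * (r powi (- m) * (1 / r) ^ j))"
      unfolding norm_mult[of _ "inv_qfact p _"]
      using inv_qfact_bound[OF assms(2,3), of "m + int j"] by (intro mult_left_mono) auto
    also have "\<dots> = norm (euler_coeff p j * (b / r) ^ j) * (?H * r powi (- m))"
      using assms by (simp add: abs_mult power_divide)
    finally show "norm (euler_coeff p j * b ^ j * inv_qfact p (m + int j)) \<le>
        norm (euler_coeff p j * (b / r) ^ j) * (?H * r powi (- m))" .
  qed
  also have "\<dots> = (\<Sum>\<^sub>\<infinity>j. norm (euler_coeff p j * (b / r) ^ j)) * ?H * r powi (- m)"
    unfolding infsum_cmult_left' by simp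
  finally show "\<bar>hahn_exton p b m\<bar> \<le>
      (\<Sum>\<^sub>\<infinity>j. norm (euler_coeff p j * (b / r) ^ j)) * ?H * r powi (- m)" .
qed

lemma summable_hahn_exton_weighted:
  assumes "0 < b" "0 < c" "c < 1"
  shows "(\<lambda>k. norm (c powi k * hahn_exton p b (k + l))) summable_on UNIV"
proof -
  obtain C where C: "\<And>m. \<bar>hahn_exton p b m\<bar> \<le> C * 1 powi (- m)"
    using hahn_exton_bound[of b 1] assms by auto
  obtain D where D: "\<And>m. \<bar>hahn_exton p b m\<bar> \<le> D * (c / 2) powi (- m)"
    using hahn_exton_bound[of b "c / 2"] assms by auto
  show ?thesis
  \<comment> \<open>The choice \<open>r = c / 2\<close> leaves the ratio \<open>c / r = 2\<close> at negative indices.\<close>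
  proof (rule summable_on_int_geometric[of c 2 _ C "D * (c / 2) powi (- l)"])
    fix k
    show "norm (c powi k * hahn_exton p b (k + l)) \<le> C * c powi k"
      using mult_left_mono[OF C[of "k + l"], of "c powi k"] assms
      by (simp add: abs_mult power_int_abs mult.commute)
    have "norm (c powi k * hahn_exton p b (k + l)) \<le> c powi k * (D * (c / 2) powi (- (k + l)))"
      using mult_left_mono[OF D[of "k + l"], of "c powi k"] assms
      by (simp add: abs_mult power_int_abs)
    also have "\<dots> = D * (c / 2) powi (- l) * 2 powi k"
    proof -
      have "(c / 2) powi (- (k + l)) = (c / 2) powi (- l) / (c / 2) powi k"
      proof -
        have "- (k + l) = - l - k"
          by simp
        then show ?thesis
          using assms by (simp only:) (simp add: power_int_diff)
      qed
      then have "c powi k * (c / 2) powi (- (k + l)) = (c / (c / 2)) powi k * (c / 2) powi (- l)"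
        by (simp only: power_int_divide_distrib[of c "c / 2"]) simp
      then show ?thesis
        using assms by simp
    qed
    finally show "norm (c powi k * hahn_exton p b (k + l)) \<le> D * (c / 2) powi (- l) * 2 powi k" .
  qed (use assms in auto)
qed

text \<open>
  The factor \<open>(a * b / t)\<^sub>\<infinity> / (b / t)\<^sub>\<infinity>\<close> of the generating function, expanded in powers of \<open>b / t\<close>. Analytically
  this is the integral of Sonine type which expresses \<open>j\<^sub>\<alpha>\<close> through the cosine.
\<close>

lemma hahn_exton_mult:
  assumes "0 < b" "b < 1"
  shows "hahn_exton p (a * b) m = (\<Sum>\<^sub>\<infinity>n. qbinom_coeff p a n * b ^ n * hahn_exton p b (m + int n))"
proof -
  obtain B where B: "\<And>n. \<bar>qbinom_coeff p a n\<bar> \<le> B"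
    using qbinom_coeff_bounded by blast
  define G where "G n j = qbinom_coeff p a n * b ^ n *
    (euler_coeff p j * b ^ j * inv_qfact p (m + int n + int j))" for n j
  have "norm (G n j) \<le> (B * b ^ n) * (norm (euler_coeff p j * b ^ j) * (1 / qpoch_inf p p))" for n j
    unfolding G_def norm_mult using B[of n] inv_qfact_bounded[of "m + int n + int j"] assms
    by (intro mult_mono) auto
  moreover have "(\<lambda>n. B * b ^ n) summable_on UNIV"
    using assms by (intro summable_on_cmult_right norm_summable_imp_summable_on)
      (auto simp: summable_geometric)
  moreover have "(\<lambda>j. norm (euler_coeff p j * b ^ j) * (1 / qpoch_inf p p)) summable_on UNIV"
    by (rule summable_on_cmult_left[OF summable_euler])
  ultimately have "(\<Sum>\<^sub>\<infinity>n. \<Sum>\<^sub>\<infinity>j. G n j) = (\<Sum>\<^sub>\<infinity>M. \<Sum>n\<le>M. G n (M - n))"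
    by (rule infsum_triangle_dominated)
  also have "\<dots> = (\<Sum>\<^sub>\<infinity>M. euler_coeff p M * (a * b) ^ M * inv_qfact p (m + int M))"
  proof (rule infsum_cong)
    fix M
    have "(\<Sum>n\<le>M. G n (M - n)) =
        (\<Sum>n\<le>M. qbinom_coeff p a n * euler_coeff p (M - n)) * (b ^ M * inv_qfact p (m + int M))"
      unfolding sum_distrib_right
      by (rule sum.cong) (auto simp: G_def of_nat_diff simp flip: power_add)
    then show "(\<Sum>n\<le>M. G n (M - n)) = euler_coeff p M * (a * b) ^ M * inv_qfact p (m + int M)"
      by (simp add: sum_qbinom_euler power_mult_distrib)
  qed
  finally show ?thesis
    by (simp add: G_def hahn_exton_def infsum_cmult_right')
qed

lemma infsum_qbinom_inv_qfact:
  assumes "0 < a"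
  shows "(\<Sum>\<^sub>\<infinity>n. qbinom_coeff p a n * (1 / a) ^ n * inv_qfact p (m - int n)) =
    a powi (- m) * inv_qfact p m"
proof (cases "m < 0")
  case True
  then show ?thesis
    by (simp add: inv_qfact_neg)
next
  case False
  then obtain N where m: "m = int N"
    by (metis int_nat_eq not_less)
  have "(\<Sum>\<^sub>\<infinity>n. qbinom_coeff p a n * (1 / a) ^ n * inv_qfact p (m - int n)) =
      (\<Sum>\<^sub>\<infinity>n\<in>{..N}. qbinom_coeff p a n * (1 / a) ^ n * inv_qfact p (m - int n))"
    by (rule infsum_cong_neutral) (auto simp: m inv_qfact_neg)
  also have "\<dots> = (\<Sum>n\<le>N. a powi (- m) *
      (qbinom_coeff p a n * a ^ (N - n) * inv_qfact p (int (N - n))))"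
    unfolding infsum_finite[OF finite_atMost]
  proof (rule sum.cong)
    fix n assume "n \<in> {..N}"
    then have n: "n \<le> N"
      by simp
    then have "a ^ N = a ^ (N - n) * a ^ n"
      by (simp flip: power_add)
    then have "(1 / a) ^ n = a ^ (N - n) / a ^ N"
      using assms by (simp only:) (simp add: power_one_over)
    then have "(1 / a) ^ n = a powi (- m) * a ^ (N - n)"
      by (simp add: m power_int_minus inverse_eq_divide)
    then show "qbinom_coeff p a n * (1 / a) ^ n * inv_qfact p (m - int n) = a powi (- m) *
      (qbinom_coeff p a n * a ^ (N - n) * inv_qfact p (int (N - n)))"
      using n by (simp add: m of_nat_diff)
  qed simp
  also have "\<dots> = a powi (- m) * inv_qfact p m"
    unfolding sum_distrib_left[symmetric] sum_qbinom_inv_qfact by (simp add: m)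
  finally show ?thesis .
qed

text \<open>
  The factor \<open>(t)\<^sub>\<infinity> / (t / a)\<^sub>\<infinity>\<close>, expanded in powers of \<open>t / a\<close>, cancels the denominator of the generating
  function of \<open>hahn_exton p (a * b)\<close> and leaves \<open>(a * b / t)\<^sub>\<infinity> / (t / a)\<^sub>\<infinity>\<close>, which is the generating
  function for \<open>b\<close> at \<open>t / a\<close>. The growing weights \<open>(1 / a) ^ n\<close> are compensated by the decay of the
  Hahn-Exton sequence at negative indices.
\<close>

lemma hahn_exton_divide:
  assumes "0 < a" "0 < b"
  shows "(\<Sum>\<^sub>\<infinity>n. qbinom_coeff p a n * (1 / a) ^ n * hahn_exton p (a * b) (m - int n)) =
    a powi (- m) * hahn_exton p b m"
proof -
  obtain B where B: "\<And>n. \<bar>qbinom_coeff p a n\<bar> \<le> B"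
    using qbinom_coeff_bounded by blast
  \<comment> \<open>\<open>r < a\<close> compensates the weights \<open>(1 / a) ^ n\<close>, and \<open>r \<le> 1\<close> is needed for the bound on \<open>inv_qfact\<close>.\<close>
  define r where "r = min a 1 / 2"
  have r: "0 < r" "r \<le> 1" "r / a < 1"
    using assms by (auto simp: r_def min_def field_simps)
  define F where "F n j = qbinom_coeff p a n * (1 / a) ^ n *
    (euler_coeff p j * (a * b) ^ j * inv_qfact p (m - int n + int j))" for n j
  let ?C = "\<lambda>n. B * (r / a) ^ n"
  let ?D = "\<lambda>j. norm (euler_coeff p j * (a * b / r) ^ j) * (1 / qpoch_inf p p * r powi (- m))"
  have "norm (F n j) \<le> ?C n * ?D j" for n j
  proof -
    have "r powi (- (m - int n + int j)) = r powi (- m) * (r ^ n * (1 / r) ^ j)"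
      using r power_int_minus_add_nat[of r "m - int n" j] power_int_add[of r "- m" "int n"]
      by (simp add: algebra_simps)
    then have "norm (F n j) \<le> (B * (1 / a) ^ n) * (norm (euler_coeff p j * (a * b) ^ j) *
        (1 / qpoch_inf p p * (r powi (- m) * (r ^ n * (1 / r) ^ j))))"
      unfolding F_def norm_mult[of "qbinom_coeff p a n * _"] norm_mult[of _ "inv_qfact p _"]
        norm_mult[of "qbinom_coeff p a n"]
      using B[of n] inv_qfact_bound[OF r(1,2), of "m - int n + int j"] assms
      by (intro mult_mono mult_nonneg_nonneg) auto
    also have "\<dots> = ?C n * ?D j"
      using r assms by (simp add: power_divide abs_mult mult_ac)
    finally show ?thesis .
  qed
  moreover have "?C summable_on UNIV"
    using assms r by (intro summable_on_cmult_right norm_summable_imp_summable_on)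
      (auto simp: summable_geometric)
  moreover have "?D summable_on UNIV"
    by (rule summable_on_cmult_left[OF summable_euler])
  ultimately have "(\<Sum>\<^sub>\<infinity>n. \<Sum>\<^sub>\<infinity>j. F n j) = (\<Sum>\<^sub>\<infinity>j. \<Sum>\<^sub>\<infinity>n. F n j)"
    by (rule infsum_swap_dominated)
  also have "\<dots> = (\<Sum>\<^sub>\<infinity>j. a powi (- m) * (euler_coeff p j * b ^ j * inv_qfact p (m + int j)))"
  proof (rule infsum_cong)
    fix j
    have "(\<Sum>\<^sub>\<infinity>n. F n j) = (\<Sum>\<^sub>\<infinity>n. (euler_coeff p j * (a * b) ^ j) *
        (qbinom_coeff p a n * (1 / a) ^ n * inv_qfact p ((m + int j) - int n)))"
      by (rule infsum_cong) (simp add: F_def algebra_simps)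
    also have "\<dots> = euler_coeff p j * (a * b) ^ j * (a powi (- (m + int j)) * inv_qfact p (m + int j))"
      unfolding infsum_cmult_right' infsum_qbinom_inv_qfact[OF assms(1)] ..
    also have "\<dots> = a powi (- m) * (euler_coeff p j * b ^ j * inv_qfact p (m + int j))"
      using assms by (simp add: power_int_minus_add_nat[of a m j, simplified] power_mult_distrib power_one_over)
    finally show "(\<Sum>\<^sub>\<infinity>n. F n j) = a powi (- m) * (euler_coeff p j * b ^ j * inv_qfact p (m + int j))" .
  qed
  finally show ?thesis
    by (simp add: F_def hahn_exton_def infsum_cmult_right')
qed

text \<open>
  The infinite form of the inverse relation between the coefficients of \<open>(t)\<^sub>\<infinity>\<close> and \<open>1 / (t)\<^sub>\<infinity>\<close>.
\<close>

lemma infsum_euler_inv_qfact: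
  "(\<Sum>\<^sub>\<infinity>i. euler_coeff p i * inv_qfact p (m - int i)) = (if m = 0 then 1 else 0)"
proof (cases "m < 0")
  case True
  then show ?thesis
    by (simp add: inv_qfact_neg)
next
  case False
  then obtain N where m: "m = int N"
    by (metis int_nat_eq not_less)
  have "(\<Sum>\<^sub>\<infinity>i. euler_coeff p i * inv_qfact p (m - int i)) =
      (\<Sum>\<^sub>\<infinity>i\<in>{..N}. euler_coeff p i * inv_qfact p (m - int i))"
    by (rule infsum_cong_neutral) (auto simp: m inv_qfact_neg)
  also have "\<dots> = (\<Sum>n\<le>N. qbinom_coeff p 0 n * euler_coeff p (N - n))"
    unfolding infsum_finite[OF finite_atMost]
    by (rule sum.reindex_bij_witness[of _ "\<lambda>n. N - n" "\<lambda>n. N - n"])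
      (auto simp: m of_nat_diff simp flip: inv_qfact_eq_qbinom_coeff)
  also have "\<dots> = (if m = 0 then 1 else 0)"
    unfolding sum_qbinom_euler by (simp add: m euler_coeff_0 power_0_left)
  finally show ?thesis .
qed

text \<open>
  Multiplication of the generating function by its denominator leaves \<open>(b / t)\<^sub>\<infinity>\<close>.
\<close>

lemma infsum_euler_hahn_exton:
  assumes "0 < b"
  shows "(\<Sum>\<^sub>\<infinity>i. euler_coeff p i * hahn_exton p b (m - int i)) =
    (if m \<le> 0 then euler_coeff p (nat (- m)) * b ^ nat (- m) else 0)"
proof -
  define F where "F i j = euler_coeff p i *
    (euler_coeff p j * b ^ j * inv_qfact p (m - int i + int j))" for i j
  have "norm (F i j) \<le> norm (euler_coeff p i * 1 ^ i) *
      (norm (euler_coeff p j * b ^ j) * (1 / qpoch_inf p p))" for i j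
    unfolding F_def norm_mult using inv_qfact_bounded[of "m - int i + int j"] assms
    by (intro mult_mono) auto
  then have "(\<Sum>\<^sub>\<infinity>i. \<Sum>\<^sub>\<infinity>j. F i j) = (\<Sum>\<^sub>\<infinity>j. \<Sum>\<^sub>\<infinity>i. F i j)"
    using summable_euler[of 1] summable_on_cmult_left[OF summable_euler[of b]]
    by (rule infsum_swap_dominated)
  also have "\<dots> = (\<Sum>\<^sub>\<infinity>j. if int j = - m then euler_coeff p j * b ^ j else 0)"
  proof (rule infsum_cong)
    fix j
    have "(\<Sum>\<^sub>\<infinity>i. F i j) = (\<Sum>\<^sub>\<infinity>i. (euler_coeff p j * b ^ j) *
        (euler_coeff p i * inv_qfact p ((m + int j) - int i)))"
      by (rule infsum_cong) (simp add: F_def algebra_simps)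
    then show "(\<Sum>\<^sub>\<infinity>i. F i j) = (if int j = - m then euler_coeff p j * b ^ j else 0)"
      unfolding infsum_cmult_right' infsum_euler_inv_qfact by auto
  qed
  also have "\<dots> = (if m \<le> 0 then euler_coeff p (nat (- m)) * b ^ nat (- m) else 0)"
  proof (cases "m \<le> 0")
    case True
    then have "(\<Sum>\<^sub>\<infinity>j. if int j = - m then euler_coeff p j * b ^ j else 0) =
        (\<Sum>\<^sub>\<infinity>j\<in>{nat (- m)}. euler_coeff p j * b ^ j)"
      by (intro infsum_cong_neutral) auto
    then show ?thesis
      using True by simp
  next
    case False
    then have "(\<Sum>\<^sub>\<infinity>j. if int j = - m then euler_coeff p j * b ^ j else 0) = (\<Sum>\<^sub>\<infinity>j::nat. 0)"
      by (intro infsum_cong) auto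
    then show ?thesis
      using False by simp
  qed
  finally show ?thesis
    by (simp add: F_def hahn_exton_def infsum_cmult_right')
qed

section \<open>Orthogonality\<close>

lemma hahn_exton_bounded:
  assumes "0 < b"
  shows "\<exists>C. \<forall>m. \<bar>hahn_exton p b m\<bar> \<le> C"
  using hahn_exton_bound[OF assms, of 1] by simp

lemma summable_inv_qfact_weighted:
  assumes "0 < b" "b < 1"
  shows "(\<lambda>k. norm (b powi k * inv_qfact p k)) summable_on UNIV"
proof (rule summable_on_int_geometric[of b 2 _ "1 / qpoch_inf p p" "1 / qpoch_inf p p"])
  fix k
  have H: "0 < 1 / qpoch_inf p p"
    using qpoch_inf_pos[of p] p by simp
  have le: "\<bar>inv_qfact p k\<bar> \<le> 1 / qpoch_inf p p"
    by (rule inv_qfact_bounded)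
  show "norm (b powi k * inv_qfact p k) \<le> 1 / qpoch_inf p p * b powi k"
    using mult_left_mono[OF le, of "b powi k"] assms by (simp add: abs_mult power_int_abs)
  show "norm (b powi k * inv_qfact p k) \<le> 1 / qpoch_inf p p * 2 powi k"
  proof (cases "k < 0")
    case True
    then show ?thesis
      using H by (simp add: inv_qfact_neg)
  next
    case False
    then have "b powi k \<le> 1" "1 \<le> (2 :: real) powi k"
      using assms by (auto simp: power_int_le_one intro: one_le_power_int)
    then have "b powi k * \<bar>inv_qfact p k\<bar> \<le> 2 powi k * (1 / qpoch_inf p p)"
      using le assms by (intro mult_mono) auto
    then show ?thesis
      using assms by (simp add: abs_mult power_int_abs mult.commute)
  qed
qed (use assms in auto)

text \<open>
  This is \<open>G t * G (b / t) = 1\<close> for the generating function \<open>G\<close>. One of the two sequences is expanded by its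
  definition; the Euler coefficients set free in this way annihilate the denominator of the other one, and what
  remains is a finite convolution of \<open>inv_qfact\<close> with \<open>euler_coeff\<close>.
\<close>

lemma hahn_exton_orthogonality_0:
  assumes b: "0 < b" "b < 1"
  shows "(\<Sum>\<^sub>\<infinity>k. b powi k * hahn_exton p b (k + n) * hahn_exton p b k) = (if n = 0 then 1 else 0)"
proof -
  let ?H = "1 / qpoch_inf p p"
  let ?s = "hahn_exton p b"
  obtain C where C: "\<And>m. \<bar>?s m\<bar> \<le> C"
    using hahn_exton_bounded b by blast
  define F where "F k i = ?s (k + n) * (euler_coeff p i * (b powi (k + int i) * inv_qfact p (k + int i)))"
    for k i
  have "(\<Sum>\<^sub>\<infinity>k. b powi k * ?s (k + n) * ?s k) = (\<Sum>\<^sub>\<infinity>k. \<Sum>\<^sub>\<infinity>i. F k i)"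
  proof (rule infsum_cong)
    fix k
    have "b powi k * ?s (k + n) * ?s k = (\<Sum>\<^sub>\<infinity>i. (b powi k * ?s (k + n)) *
        (euler_coeff p i * b ^ i * inv_qfact p (k + int i)))"
      by (simp add: hahn_exton_def infsum_cmult_right')
    also have "\<dots> = (\<Sum>\<^sub>\<infinity>i. F k i)"
      using b by (intro infsum_cong) (simp add: F_def power_int_add mult_ac)
    finally show "b powi k * ?s (k + n) * ?s k = (\<Sum>\<^sub>\<infinity>i. F k i)" .
  qed
  also have "\<dots> = (\<Sum>\<^sub>\<infinity>i. \<Sum>\<^sub>\<infinity>k. F k i)"
  proof (rule infsum_swap_dominated)
    fix k i
    have "norm (F k i) = norm (b powi k * ?s (k + n)) * (norm (euler_coeff p i * b ^ i) *
        norm (inv_qfact p (k + int i)))"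
      using b by (simp add: F_def abs_mult power_int_add)
    also have "\<dots> \<le> norm (b powi k * ?s (k + n)) * (norm (euler_coeff p i * b ^ i) * ?H)"
      using inv_qfact_bounded[of "k + int i"] by (intro mult_left_mono) auto
    finally show "norm (F k i) \<le> \<dots>" .
    show "(\<lambda>k. norm (b powi k * ?s (k + n))) summable_on UNIV"
      using summable_hahn_exton_weighted b by blast
    show "(\<lambda>i. norm (euler_coeff p i * b ^ i) * ?H) summable_on UNIV"
      by (rule summable_on_cmult_left[OF summable_euler])
  qed
  also have "\<dots> = (\<Sum>\<^sub>\<infinity>i. \<Sum>\<^sub>\<infinity>k. F (k - int i) i)"
  proof (rule infsum_cong)
    fix i show "(\<Sum>\<^sub>\<infinity>k. F k i) = (\<Sum>\<^sub>\<infinity>k. F (k - int i) i)"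
      using infsum_int_shift[of "\<lambda>k. F k i" "- int i"] by simp
  qed
  also have "\<dots> = (\<Sum>\<^sub>\<infinity>k. \<Sum>\<^sub>\<infinity>i. F (k - int i) i)"
  proof (rule infsum_swap_dominated)
    fix i k
    have "norm (F (k - int i) i) = norm (?s (k - int i + n)) *
        (norm (euler_coeff p i * 1 ^ i) * norm (b powi k * inv_qfact p k))"
      by (simp add: F_def abs_mult)
    also have "\<dots> \<le> C * (norm (euler_coeff p i * 1 ^ i) * norm (b powi k * inv_qfact p k))"
      using C[of "k - int i + n"] by (intro mult_right_mono) auto
    finally show "norm (F (k - int i) i) \<le>
        (C * norm (euler_coeff p i * 1 ^ i)) * norm (b powi k * inv_qfact p k)"
      by (simp add: mult.assoc)
    show "(\<lambda>i. C * norm (euler_coeff p i * 1 ^ i)) summable_on UNIV"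
      by (rule summable_on_cmult_right[OF summable_euler])
    show "(\<lambda>k. norm (b powi k * inv_qfact p k)) summable_on UNIV"
      by (rule summable_inv_qfact_weighted[OF b])
  qed
  also have "\<dots> = (\<Sum>\<^sub>\<infinity>k. b powi k * inv_qfact p k * (if n + k \<le> 0
      then euler_coeff p (nat (- (n + k))) * b ^ nat (- (n + k)) else 0))"
  proof (rule infsum_cong)
    fix k
    have "(\<Sum>\<^sub>\<infinity>i. F (k - int i) i) =
        (\<Sum>\<^sub>\<infinity>i. (b powi k * inv_qfact p k) * (euler_coeff p i * ?s ((n + k) - int i)))"
      by (rule infsum_cong) (simp add: F_def algebra_simps)
    then show "(\<Sum>\<^sub>\<infinity>i. F (k - int i) i) = b powi k * inv_qfact p k * (if n + k \<le> 0
      then euler_coeff p (nat (- (n + k))) * b ^ nat (- (n + k)) else 0)"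
      unfolding infsum_cmult_right' infsum_euler_hahn_exton[OF b(1)] .
  qed
  also have "\<dots> = (if n = 0 then 1 else 0)"
  proof (cases "n > 0")
    case True
    then have "(\<Sum>\<^sub>\<infinity>k. b powi k * inv_qfact p k * (if n + k \<le> 0
      then euler_coeff p (nat (- (n + k))) * b ^ nat (- (n + k)) else 0)) = (\<Sum>\<^sub>\<infinity>k::int. 0)"
      by (intro infsum_cong) (auto simp: inv_qfact_neg)
    then show ?thesis
      using True by simp
  next
    case False
    then obtain N where n: "n = - int N"
      by (metis int_nat_eq minus_equation_iff neg_0_le_iff_le not_less)
    have "(\<Sum>\<^sub>\<infinity>k. b powi k * inv_qfact p k * (if n + k \<le> 0
        then euler_coeff p (nat (- (n + k))) * b ^ nat (- (n + k)) else 0)) =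
        (\<Sum>\<^sub>\<infinity>k\<in>int ` {..N}. b powi k * inv_qfact p k * (if n + k \<le> 0
        then euler_coeff p (nat (- (n + k))) * b ^ nat (- (n + k)) else 0))"
    proof (rule infsum_cong_neutral)
      fix k assume "k \<in> UNIV - int ` {..N}"
      then have "k < 0 \<or> int N < k"
        by (metis DiffD2 atMost_iff imageI int_nat_eq not_le of_nat_le_iff)
      then show "b powi k * inv_qfact p k * (if n + k \<le> 0
        then euler_coeff p (nat (- (n + k))) * b ^ nat (- (n + k)) else 0) = 0"
        by (auto simp: inv_qfact_neg n)
    qed auto
    also have "\<dots> = (\<Sum>k\<le>N. b ^ N * (qbinom_coeff p 0 k * euler_coeff p (N - k)))"
    proof -
      have "b ^ k * b ^ (N - k) = b ^ N" "nat (int N - int k) = N - k" if "k \<le> N" for k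
        using that by (simp_all flip: power_add of_nat_diff)
      then show ?thesis
        by (simp add: sum.reindex n mult_ac inv_qfact_eq_qbinom_coeff cong: sum.cong_simp)
           (intro sum.cong, auto)
    qed
    also have "\<dots> = (if n = 0 then 1 else 0)"
      unfolding sum_distrib_left[symmetric] sum_qbinom_euler
      by (simp add: n euler_coeff_0 power_0_left)
    finally show ?thesis .
  qed
  finally show ?thesis .
qed

lemma hahn_exton_orthogonality:
  assumes b: "0 < b" "b < 1"
  shows "(\<Sum>\<^sub>\<infinity>k. b powi k * hahn_exton p b (k + m) * hahn_exton p b (k + n)) =
    (if m = n then b powi (- n) else 0)"
proof -
  let ?s = "hahn_exton p b"
  have "(\<Sum>\<^sub>\<infinity>k. b powi k * ?s (k + m) * ?s (k + n)) =
      (\<Sum>\<^sub>\<infinity>k. b powi (- n) * (b powi (k + n) * ?s ((k + n) + (m - n)) * ?s (k + n)))"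
    using b by (intro infsum_cong) (simp add: power_int_add power_int_minus)
  also have "\<dots> = b powi (- n) * (\<Sum>\<^sub>\<infinity>k. b powi k * ?s (k + (m - n)) * ?s k)"
    unfolding infsum_cmult_right' by (subst infsum_int_shift) simp
  also have "\<dots> = (if m = n then b powi (- n) else 0)"
    unfolding hahn_exton_orthogonality_0[OF b] by auto
  finally show ?thesis .
qed

section \<open>Superpositions of Hahn-Exton functions\<close>

lemma summable_hahn_exton_series:
  assumes "0 < b" "(\<lambda>l. norm (G l)) summable_on UNIV"
  shows "(\<lambda>l. norm (G l * of_real (hahn_exton p b (l + m)) :: complex)) summable_on UNIV"
proof -
  obtain C where C: "\<And>m. \<bar>hahn_exton p b m\<bar> \<le> C"
    using hahn_exton_bounded assms by blast
  show ?thesis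
  proof (rule Infinite_Sum.abs_summable_on_comparison_test')
    show "(\<lambda>l. norm (G l) * C) summable_on UNIV"
      by (rule summable_on_cmult_left[OF assms(2)])
    show "norm (G l * of_real (hahn_exton p b (l + m))) \<le> norm (G l) * C" for l
      using C[of "l + m"] by (auto simp: norm_mult intro!: mult_left_mono)
  qed
qed

lemma hahn_exton_series_bounded:
  assumes "0 < b" "(\<lambda>l. norm (G l)) summable_on UNIV"
  shows "\<exists>C. \<forall>m. norm (hahn_exton_series p b G m) \<le> C"
proof -
  obtain C where C: "\<And>m. \<bar>hahn_exton p b m\<bar> \<le> C"
    using hahn_exton_bounded assms by blast
  have "norm (hahn_exton_series p b G m) \<le> (\<Sum>\<^sub>\<infinity>l. norm (G l) * C)" for m
    unfolding hahn_exton_series_def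
  proof (rule norm_infsum_le[OF has_sum_infsum has_sum_infsum])
    show "(\<lambda>l. G l * of_real (hahn_exton p b (l + m))) summable_on UNIV"
      by (rule abs_summable_summable[OF summable_hahn_exton_series[OF assms]])
    show "(\<lambda>l. norm (G l) * C) summable_on UNIV"
      by (rule summable_on_cmult_left[OF assms(2)])
    show "norm (G l * of_real (hahn_exton p b (l + m))) \<le> norm (G l) * C" for l
      using C[of "l + m"] by (auto simp: norm_mult intro!: mult_left_mono)
  qed
  then show ?thesis by blast
qed

text \<open>
  The Hankel type transform with kernel \<open>hahn_exton p b (k + l + u)\<close> and weight \<open>b powi k\<close> is an involution up
  to a constant: after the interchange of sums this is the orthogonality relation. Boundedness of the kernel makes
  summability of the weights the only requirement.
\<close>

lemma hahn_exton_inversion: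
  assumes b: "0 < b" "b < 1" and G: "(\<lambda>l. norm (G l)) summable_on UNIV"
  shows "hahn_exton_series p b (\<lambda>k. of_real (b powi k) * hahn_exton_series p b G (k + u)) (l + u) =
    of_real (b powi (- l - u)) * G l"
proof -
  let ?s = "hahn_exton p b"
  obtain C where C: "\<And>m. \<bar>?s m\<bar> \<le> C"
    using hahn_exton_bounded b by blast
  define F :: "int \<Rightarrow> int \<Rightarrow> complex" where
    "F k i = of_real (b powi k * ?s (k + (l + u))) * (G i * of_real (?s (i + (k + u))))" for k i
  have "hahn_exton_series p b (\<lambda>k. of_real (b powi k) * hahn_exton_series p b G (k + u)) (l + u) =
      (\<Sum>\<^sub>\<infinity>k. \<Sum>\<^sub>\<infinity>i. F k i)"
    unfolding hahn_exton_series_def F_def infsum_cmult_right' by (simp add: mult_ac)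
  also have "\<dots> = (\<Sum>\<^sub>\<infinity>i. \<Sum>\<^sub>\<infinity>k. F k i)"
  proof (rule infsum_swap_dominated)
    show "norm (F k i) \<le> norm (b powi k * ?s (k + (l + u))) * (norm (G i) * C)" for k i
      unfolding F_def norm_mult[of "of_real _"] norm_mult[of "G i"] norm_of_real real_norm_def
      using C[of "i + (k + u)"] by (intro mult_left_mono) auto
    show "(\<lambda>k. norm (b powi k * ?s (k + (l + u)))) summable_on UNIV"
      using summable_hahn_exton_weighted b by blast
    show "(\<lambda>i. norm (G i) * C) summable_on UNIV"
      by (rule summable_on_cmult_left[OF G])
  qed
  also have "\<dots> = (\<Sum>\<^sub>\<infinity>i. G i * of_real (if l = i then b powi (- i - u) else 0))"
  proof (rule infsum_cong)
    fix i
    have "(\<lambda>k. norm (b powi k * ?s (k + (l + u)) * ?s (k + (i + u)))) summable_on UNIV"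
    proof (rule Infinite_Sum.abs_summable_on_comparison_test')
      show "(\<lambda>k. norm (b powi k * ?s (k + (l + u))) * C) summable_on UNIV"
        by (intro summable_on_cmult_left summable_hahn_exton_weighted) (use b in auto)
      show "norm (b powi k * ?s (k + (l + u)) * ?s (k + (i + u))) \<le> norm (b powi k * ?s (k + (l + u))) * C"
        for k
        unfolding norm_mult[of _ "?s (k + (i + u))"] using C[of "k + (i + u)"]
        by (intro mult_left_mono) auto
    qed
    from infsum_of_real[OF abs_summable_summable[OF this]] hahn_exton_orthogonality[OF b, of "l + u" "i + u"]
    have *: "(\<Sum>\<^sub>\<infinity>k. of_real (b powi k * ?s (k + (l + u)) * ?s (k + (i + u)))) =
        (of_real (if l = i then b powi (- i - u) else 0) :: complex)"
      by simp
    have "(\<Sum>\<^sub>\<infinity>k. F k i) = (\<Sum>\<^sub>\<infinity>k. G i * of_real (b powi k * ?s (k + (l + u)) * ?s (k + (i + u))))"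
      by (rule infsum_cong) (simp add: F_def algebra_simps)
    then show "(\<Sum>\<^sub>\<infinity>k. F k i) = G i * of_real (if l = i then b powi (- i - u) else 0)"
      unfolding infsum_cmult_right' * .
  qed
  also have "\<dots> = (\<Sum>\<^sub>\<infinity>i\<in>{l}. G i * of_real (b powi (- i - u)))"
    by (rule infsum_cong_neutral) auto
  finally show ?thesis
    by simp
qed

lemma hahn_exton_series_mult:
  assumes b: "0 < b" "b < 1" and G: "(\<lambda>l. norm (G l)) summable_on UNIV"
  shows "(\<Sum>\<^sub>\<infinity>n. of_real (qbinom_coeff p a n * b ^ n) * hahn_exton_series p b G (m + int n)) =
    hahn_exton_series p (a * b) G m"
proof -
  let ?s = "hahn_exton p b"
  obtain C where C: "\<And>m. \<bar>?s m\<bar> \<le> C"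
    using hahn_exton_bounded b by blast
  obtain B where B: "\<And>n. \<bar>qbinom_coeff p a n\<bar> \<le> B"
    using qbinom_coeff_bounded by blast
  have sB: "(\<lambda>n. B * b ^ n) summable_on UNIV"
    using b by (intro summable_on_cmult_right norm_summable_imp_summable_on)
      (auto simp: summable_geometric)
  define F :: "nat \<Rightarrow> int \<Rightarrow> complex" where
    "F n l = of_real (qbinom_coeff p a n * b ^ n) * (G l * of_real (?s (l + (m + int n))))" for n l
  have "(\<Sum>\<^sub>\<infinity>n. of_real (qbinom_coeff p a n * b ^ n) * hahn_exton_series p b G (m + int n)) =
      (\<Sum>\<^sub>\<infinity>n. \<Sum>\<^sub>\<infinity>l. F n l)"
    unfolding hahn_exton_series_def F_def infsum_cmult_right' ..
  also have "\<dots> = (\<Sum>\<^sub>\<infinity>l. \<Sum>\<^sub>\<infinity>n. F n l)"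
  proof (rule infsum_swap_dominated[OF _ sB summable_on_cmult_left[OF G]])
    show "norm (F n l) \<le> (B * b ^ n) * (norm (G l) * C)" for n l
      unfolding F_def norm_mult of_real_mult norm_of_real using B[of n] C[of "l + (m + int n)"] b
      by (intro mult_mono mult_nonneg_nonneg) auto
  qed
  also have "\<dots> = (\<Sum>\<^sub>\<infinity>l. G l * of_real (hahn_exton p (a * b) (l + m)))"
  proof (rule infsum_cong)
    fix l
    have "(\<lambda>n. norm (qbinom_coeff p a n * b ^ n * ?s (l + m + int n))) summable_on UNIV"
    proof (rule Infinite_Sum.abs_summable_on_comparison_test'[OF summable_on_cmult_left[OF sB]])
      show "norm (qbinom_coeff p a n * b ^ n * ?s (l + m + int n)) \<le> (B * b ^ n) * C" for n
        unfolding norm_mult using B[of n] C[of "l + m + int n"] b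
        by (intro mult_mono mult_nonneg_nonneg) auto
    qed
    from infsum_of_real[OF abs_summable_summable[OF this]] hahn_exton_mult[OF b, of a "l + m"]
    have *: "(\<Sum>\<^sub>\<infinity>n. of_real (qbinom_coeff p a n * b ^ n * ?s (l + m + int n))) =
        (of_real (hahn_exton p (a * b) (l + m)) :: complex)"
      by simp
    have "(\<Sum>\<^sub>\<infinity>n. F n l) = (\<Sum>\<^sub>\<infinity>n. G l * of_real (qbinom_coeff p a n * b ^ n * ?s (l + m + int n)))"
      by (rule infsum_cong) (simp add: F_def algebra_simps)
    then show "(\<Sum>\<^sub>\<infinity>n. F n l) = G l * of_real (hahn_exton p (a * b) (l + m))"
      unfolding infsum_cmult_right' * .
  qed
  finally show ?thesis
    by (simp add: hahn_exton_series_def)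
qed

text \<open>
  The interchange needs a majorant for the growing weights \<open>(1 / a) ^ n\<close>, hence a bound of the Hahn-Exton sequence
  by \<open>r powi (- m)\<close> with \<open>r < a\<close>; the price is the weight \<open>r powi (- l)\<close> in the assumption on \<open>G\<close>.
\<close>

lemma hahn_exton_series_divide:
  assumes a: "0 < a" and b: "0 < b" and r: "0 < r" "r \<le> 1" "r < a"
    and G: "(\<lambda>l. norm (G l) * r powi (- l)) summable_on UNIV"
  shows "(\<Sum>\<^sub>\<infinity>n. of_real (qbinom_coeff p a n * (1 / a) ^ n) *
      hahn_exton_series p (a * b) G (m - int n)) =
    of_real (a powi (- m)) * hahn_exton_series p b (\<lambda>l. of_real (a powi (- l)) * G l) m"
proof -
  let ?s = "hahn_exton p (a * b)"
  obtain C where C: "\<And>m. \<bar>?s m\<bar> \<le> C * r powi (- m)"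
    using hahn_exton_bound[OF _ r(1,2), of "a * b"] a b by auto
  obtain B where B: "\<And>n. \<bar>qbinom_coeff p a n\<bar> \<le> B"
    using qbinom_coeff_bounded by blast
  have sB: "(\<lambda>n. B * (r / a) ^ n) summable_on UNIV"
    using a r by (intro summable_on_cmult_right norm_summable_imp_summable_on)
      (auto simp: summable_geometric)
  have rn: "r powi (- (l + (m - int n))) = r powi (- l) * (r powi (- m) * r ^ n)" for l n
    using r power_int_add[of r "- l" "- m + int n"] power_int_add[of r "- m" "int n"]
    by (simp add: algebra_simps)
  define F :: "nat \<Rightarrow> int \<Rightarrow> complex" where
    "F n l = of_real (qbinom_coeff p a n * (1 / a) ^ n) * (G l * of_real (?s (l + (m - int n))))" for n l
  have "(\<Sum>\<^sub>\<infinity>n. of_real (qbinom_coeff p a n * (1 / a) ^ n) *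
      hahn_exton_series p (a * b) G (m - int n)) = (\<Sum>\<^sub>\<infinity>n. \<Sum>\<^sub>\<infinity>l. F n l)"
    unfolding hahn_exton_series_def F_def infsum_cmult_right' ..
  also have "\<dots> = (\<Sum>\<^sub>\<infinity>l. \<Sum>\<^sub>\<infinity>n. F n l)"
  proof (rule infsum_swap_dominated[OF _ sB summable_on_cmult_left[OF G]])
    fix n l
    have "norm (F n l) \<le> (B * (1 / a) ^ n) * (norm (G l) * (C * r powi (- (l + (m - int n)))))"
      unfolding F_def norm_mult of_real_mult norm_of_real using B[of n] C[of "l + (m - int n)"] a
      by (intro mult_mono mult_nonneg_nonneg) auto
    also have "\<dots> = (B * (r / a) ^ n) * (norm (G l) * r powi (- l) * (C * r powi (- m)))"
      unfolding rn by (simp add: power_divide mult_ac)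
    finally show "norm (F n l) \<le> (B * (r / a) ^ n) * (norm (G l) * r powi (- l) * (C * r powi (- m)))" .
  qed
  also have "\<dots> = (\<Sum>\<^sub>\<infinity>l. of_real (a powi (- m)) *
      (of_real (a powi (- l)) * G l * of_real (hahn_exton p b (l + m))))"
  proof (rule infsum_cong)
    fix l
    have "(\<lambda>n. norm (qbinom_coeff p a n * (1 / a) ^ n * ?s (l + m - int n))) summable_on UNIV"
    proof (rule Infinite_Sum.abs_summable_on_comparison_test'[OF summable_on_cmult_left[OF sB]])
      fix n
      have "norm (qbinom_coeff p a n * (1 / a) ^ n * ?s (l + (m - int n))) \<le>
          (B * (1 / a) ^ n) * (C * r powi (- (l + (m - int n))))"
        unfolding norm_mult using B[of n] C[of "l + (m - int n)"] a
        by (intro mult_mono mult_nonneg_nonneg) auto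
      also have "\<dots> = (B * (r / a) ^ n) * (C * (r powi (- l) * r powi (- m)))"
        unfolding rn by (simp add: power_divide mult_ac)
      finally show "norm (qbinom_coeff p a n * (1 / a) ^ n * ?s (l + m - int n)) \<le>
          (B * (r / a) ^ n) * (C * (r powi (- l) * r powi (- m)))"
        by (simp add: algebra_simps)
    qed
    from infsum_of_real[OF abs_summable_summable[OF this]] hahn_exton_divide[OF a b, of "l + m"]
    have *: "(\<Sum>\<^sub>\<infinity>n. of_real (qbinom_coeff p a n * (1 / a) ^ n * ?s (l + m - int n))) =
        (of_real (a powi (- (l + m)) * hahn_exton p b (l + m)) :: complex)"
      by simp
    have "(\<Sum>\<^sub>\<infinity>n. F n l) = (\<Sum>\<^sub>\<infinity>n. G l * of_real (qbinom_coeff p a n * (1 / a) ^ n * ?s (l + m - int n)))"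
      by (rule infsum_cong) (simp add: F_def algebra_simps)
    also have "\<dots> = G l * of_real (a powi (- (l + m)) * hahn_exton p b (l + m))"
      unfolding infsum_cmult_right' * ..
    also have "a powi (- (l + m)) = a powi (- l) * a powi (- m)"
      using a power_int_add[of a "- l" "- m"] by simp
    finally show "(\<Sum>\<^sub>\<infinity>n. F n l) = of_real (a powi (- m)) *
      (of_real (a powi (- l)) * G l * of_real (hahn_exton p b (l + m)))"
      by (simp add: mult_ac)
  qed
  finally show ?thesis
    by (simp add: hahn_exton_series_def infsum_cmult_right')
qed

section \<open>Difference equations and the limit at the origin\<close>

lemma inv_qfact_diff: "inv_qfact p m = inv_qfact p (m - 1) + p powi m * inv_qfact p m"
proof (cases "m \<le> 0")
  case True
  then show ?thesis
    by (cases "m = 0") (auto simp: inv_qfact_neg)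
next
  case False
  then obtain n where m: "m = int (Suc n)"
    by (metis not_le pos_int_cases gr0_implies_Suc of_nat_0_less_iff)
  have "m - 1 = int n" "p powi m = p ^ Suc n"
    unfolding m by (simp, rule power_int_of_nat)
  moreover have "inv_qfact p m = qbinom_coeff p 0 (Suc n)"
    unfolding m by (rule inv_qfact_eq_qbinom_coeff)
  ultimately show ?thesis
    using qbinom_coeff_Suc[of 0 n]
    by (simp add: inv_qfact_eq_qbinom_coeff algebra_simps)
qed

lemma summable_hahn_exton': "(\<lambda>j. euler_coeff p j * b ^ j * inv_qfact p (m + int j)) summable_on UNIV"
  by (rule abs_summable_summable[OF summable_hahn_exton])

text \<open>
  The analogue of differentiation: a difference of the sequence for \<open>b\<close> is the sequence for \<open>b * p\<close>, multiplied by
  a power of \<open>p\<close>. In the case of the cosine the sequence for \<open>b * p\<close> plays the part of the sine.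
\<close>

lemma hahn_exton_diff:
  "hahn_exton p b n = hahn_exton p b (n - 1) + p powi n * hahn_exton p (b * p) n"
proof -
  have "hahn_exton p b n = (\<Sum>\<^sub>\<infinity>j. euler_coeff p j * b ^ j * inv_qfact p ((n - 1) + int j) +
      p powi n * (euler_coeff p j * (b * p) ^ j * inv_qfact p (n + int j)))"
    unfolding hahn_exton_def
  proof (rule infsum_cong)
    fix j
    have "p powi (n + int j) = p powi n * p ^ j"
      using p by (simp add: power_int_add)
    then show "euler_coeff p j * b ^ j * inv_qfact p (n + int j) =
        euler_coeff p j * b ^ j * inv_qfact p ((n - 1) + int j) +
        p powi n * (euler_coeff p j * (b * p) ^ j * inv_qfact p (n + int j))"
      using arg_cong[OF inv_qfact_diff[of "n + int j"], of "\<lambda>x. euler_coeff p j * b ^ j * x"]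
      by (simp add: algebra_simps power_mult_distrib)
  qed
  also have "\<dots> = hahn_exton p b (n - 1) + p powi n * hahn_exton p (b * p) n"
    unfolding hahn_exton_def infsum_cmult_right'[symmetric]
    by (intro infsum_add summable_on_cmult_right summable_hahn_exton')
  finally show ?thesis .
qed

text \<open>
  The companion of \<open>hahn_exton_diff\<close>. Together they form a first-order system whose elimination is the
  second-order difference equation of the Hahn-Exton function.
\<close>

lemma hahn_exton_scale:
  "hahn_exton p (b * p) n = hahn_exton p b n + b * hahn_exton p (b * p) (n + 1)"
proof -
  let ?f = "\<lambda>j. euler_coeff p j * b ^ j * inv_qfact p (n + int j)"
  let ?g = "\<lambda>j. euler_coeff p j * (b * p) ^ j * inv_qfact p (n + int j)"
  let ?h = "\<lambda>j. euler_coeff p j * (b * p) ^ j * inv_qfact p (n + 1 + int j)"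
  have sf: "summable ?f" and sg: "summable ?g" and sh: "summable ?h"
    by (intro summable_on_imp_summable summable_hahn_exton')+
  have "hahn_exton p (b * p) n - hahn_exton p b n = (\<Sum>j. ?g j - ?f j)"
    unfolding hahn_exton_def infsum_nat_eq_suminf[OF summable_hahn_exton]
    by (rule suminf_diff[OF sg sf])
  also have "\<dots> = (\<Sum>j. ?g (Suc j) - ?f (Suc j))"
    using suminf_split_head[OF summable_diff[OF sg sf]] by simp
  also have "\<dots> = (\<Sum>j. b * ?h j)"
  proof (rule suminf_cong)
    fix j
    have "?g (Suc j) - ?f (Suc j) =
        - (euler_coeff p (Suc j) * (1 - p ^ Suc j)) * b ^ Suc j * inv_qfact p (n + 1 + int j)"
      unfolding power_mult_distrib by (simp add: algebra_simps)
    also have "\<dots> = b * ?h j"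
      unfolding euler_coeff_Suc by (simp add: power_mult_distrib)
    finally show "?g (Suc j) - ?f (Suc j) = b * ?h j" .
  qed
  also have "\<dots> = b * hahn_exton p (b * p) (n + 1)"
    unfolding hahn_exton_def infsum_nat_eq_suminf[OF summable_hahn_exton]
    by (rule suminf_mult[OF sh])
  finally show ?thesis
    by simp
qed

text \<open>
  The distance to the limit is \<open>O(p powi m)\<close> also for negative \<open>m\<close>, where the majorant is at least a constant; the
  uniform statement lets the estimate pass through sums over all integers.
\<close>

lemma inv_qfact_limit:
  "\<exists>C. \<forall>m. \<bar>inv_qfact p m - 1 / qpoch_inf p p\<bar> \<le> C * p powi m"
proof (rule exI, rule allI)
  fix m
  define K where "K = (\<Sum>j. norm (euler_coeff p (Suc j)))"
  let ?H = "1 / qpoch_inf p p"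
  have H: "0 < qpoch_inf p p"
    using qpoch_inf_pos[of p] p by simp
  have sK: "summable (\<lambda>j. norm (euler_coeff p (Suc j)))"
    using summable_on_imp_summable[OF summable_euler[of 1]]
    by (subst summable_Suc_iff) simp
  have K: "0 \<le> K"
    unfolding K_def by (rule suminf_nonneg[OF sK]) simp
  have near: "\<bar>qpoch_inf x p - 1\<bar> \<le> K * x" if x: "0 \<le> x" "x \<le> 1" for x
  proof -
    have sx: "summable (\<lambda>j. norm (euler_coeff p (Suc j) * x ^ Suc j))"
      using summable_on_imp_summable[OF summable_euler[of x]] by (subst summable_Suc_iff)
    have "qpoch_inf x p = (\<Sum>j. euler_coeff p j * x ^ j)"
      by (simp add: euler_identity infsum_nat_eq_suminf[OF summable_euler])
    then have "qpoch_inf x p - 1 = (\<Sum>j. euler_coeff p (Suc j) * x ^ Suc j)"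
      using suminf_split_head[OF summable_on_imp_summable[OF summable_euler'[of x]]]
      by (simp add: euler_coeff_0)
    also have "\<bar>\<dots>\<bar> \<le> (\<Sum>j. norm (euler_coeff p (Suc j) * x ^ Suc j))"
      using summable_norm[OF sx] by (simp only: real_norm_def)
    also have "\<dots> \<le> (\<Sum>j. norm (euler_coeff p (Suc j)) * x)"
    proof (rule suminf_le[OF _ sx summable_mult2[OF sK]])
      fix j
      have "x ^ Suc j \<le> x"
        using x by (simp add: mult_left_le power_le_one)
      then show "norm (euler_coeff p (Suc j) * x ^ Suc j) \<le> norm (euler_coeff p (Suc j)) * x"
        unfolding norm_mult using x by (intro mult_left_mono) auto
    qed
    also have "\<dots> = K * x"
      unfolding K_def by (rule suminf_mult2[OF sK, symmetric])
    finally show ?thesis .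
  qed
  show "\<bar>inv_qfact p m - ?H\<bar> \<le> (?H * (K + 1)) * p powi m"
  proof (cases "m < 0")
    case True
    then have "1 \<le> p powi m"
      using p power_int_decreasing[of m 0 p] by simp
    then have "1 * 1 \<le> (K + 1) * p powi m"
      using K by (intro mult_mono) auto
    then have "?H * 1 \<le> ?H * ((K + 1) * p powi m)"
      using H by (intro mult_left_mono) auto
    then show ?thesis
      using True H by (simp add: inv_qfact_neg)
  next
    case False
    then have x: "0 \<le> p powi (m + 1)" "p powi (m + 1) \<le> p powi m" "p powi (m + 1) \<le> 1"
      using p by (auto intro: power_int_decreasing power_int_le_one)
    have "inv_qfact p m - ?H = ?H * (qpoch_inf (p powi (m + 1)) p - 1)"
      unfolding qpoch_inf_power_int using H by (simp add: field_simps)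
    then have "\<bar>inv_qfact p m - ?H\<bar> = ?H * \<bar>qpoch_inf (p powi (m + 1)) p - 1\<bar>"
      using H by (simp add: abs_mult)
    also have "\<dots> \<le> ?H * (K * p powi (m + 1))"
      using near[OF x(1,3)] H by (intro mult_left_mono) auto
    also have "\<dots> \<le> ?H * ((K + 1) * p powi m)"
      using x K H by (intro mult_left_mono mult_mono) auto
    finally show ?thesis
      by (simp add: mult.assoc)
  qed
qed

lemma hahn_exton_limit:
  assumes "0 < b"
  shows "\<exists>C. \<forall>m. \<bar>hahn_exton p b m - qpoch_inf b p / qpoch_inf p p\<bar> \<le> C * p powi m"
proof -
  obtain C where C: "\<And>m. \<bar>inv_qfact p m - 1 / qpoch_inf p p\<bar> \<le> C * p powi m"
    using inv_qfact_limit by blast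
  have C0: "0 \<le> C"
    using order_trans[OF abs_ge_zero C[of 0]] by simp
  define K where "K = (\<Sum>j. norm (euler_coeff p j * b ^ j))"
  have sK: "summable (\<lambda>j. norm (euler_coeff p j * b ^ j))"
    by (rule summable_on_imp_summable[OF summable_euler])
  have "\<bar>hahn_exton p b m - qpoch_inf b p / qpoch_inf p p\<bar> \<le> (K * C) * p powi m" for m
  proof -
    let ?f = "\<lambda>j. euler_coeff p j * b ^ j * inv_qfact p (m + int j)"
    let ?g = "\<lambda>j. euler_coeff p j * b ^ j * (1 / qpoch_inf p p)"
    have sf: "summable ?f"
      by (intro summable_on_imp_summable summable_hahn_exton')
    have sg0: "summable (\<lambda>j. euler_coeff p j * b ^ j)"
      by (rule summable_on_imp_summable[OF summable_euler'])
    have sg: "summable ?g"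
      by (rule summable_mult2[OF sg0])
    have "qpoch_inf b p / qpoch_inf p p = (\<Sum>j. euler_coeff p j * b ^ j) * (1 / qpoch_inf p p)"
      by (simp add: euler_identity[of b] infsum_nat_eq_suminf[OF summable_euler])
    also have "\<dots> = suminf ?g"
      by (rule suminf_mult2[OF sg0])
    finally have "hahn_exton p b m - qpoch_inf b p / qpoch_inf p p = (\<Sum>j. ?f j - ?g j)"
      unfolding hahn_exton_def infsum_nat_eq_suminf[OF summable_hahn_exton]
      by (simp only: suminf_diff[OF sf sg])
    moreover have "norm (\<Sum>j. ?f j - ?g j) \<le> (\<Sum>j. norm (euler_coeff p j * b ^ j) * (C * p powi m))"
    proof (rule norm_suminf_le[OF _ summable_mult2[OF sK]])
      fix j
      have "?f j - ?g j = euler_coeff p j * b ^ j * (inv_qfact p (m + int j) - 1 / qpoch_inf p p)"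
        by (simp only: right_diff_distrib)
      then have "norm (?f j - ?g j) = norm (euler_coeff p j * b ^ j) *
          \<bar>inv_qfact p (m + int j) - 1 / qpoch_inf p p\<bar>"
        by (simp only: real_norm_def abs_mult)
      also have "\<dots> \<le> norm (euler_coeff p j * b ^ j) * (C * p powi (m + int j))"
        using C by (intro mult_left_mono) auto
      also have "\<dots> \<le> norm (euler_coeff p j * b ^ j) * (C * p powi m)"
        using C0 p by (intro mult_left_mono power_int_decreasing) auto
      finally show "norm (?f j - ?g j) \<le> norm (euler_coeff p j * b ^ j) * (C * p powi m)" .
    qed
    ultimately show ?thesis
      using suminf_mult2[OF sK, of "C * p powi m"] unfolding K_def by (simp add: mult.assoc)
  qed
  then show ?thesis
    by blast
qed

lemma hahn_exton_series_limit:
  assumes b: "0 < b" and G: "(\<lambda>l. norm (G l)) summable_on UNIV"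
    and Gp: "(\<lambda>l. norm (G l) * p powi l) summable_on UNIV"
  shows "(\<lambda>n. hahn_exton_series p b G (int n)) \<longlonglongrightarrow>
    of_real (qpoch_inf b p / qpoch_inf p p) * (\<Sum>\<^sub>\<infinity>l. G l)"
proof -
  let ?L = "qpoch_inf b p / qpoch_inf p p"
  obtain C where C: "\<And>m. \<bar>hahn_exton p b m - ?L\<bar> \<le> C * p powi m"
    using hahn_exton_limit[OF b] by blast
  have sG: "G summable_on UNIV"
    by (rule abs_summable_summable[OF G])
  define K where "K = (\<Sum>\<^sub>\<infinity>l. norm (G l) * p powi l)"
  have bound: "norm (hahn_exton_series p b G (int n) - of_real ?L * (\<Sum>\<^sub>\<infinity>l. G l)) \<le> K * C * p ^ n" for n
  proof -
    let ?f = "\<lambda>l. G l * of_real (hahn_exton p b (l + int n))"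
    have "(?f has_sum hahn_exton_series p b G (int n)) UNIV"
      unfolding hahn_exton_series_def
      by (rule has_sum_infsum[OF abs_summable_summable[OF summable_hahn_exton_series[OF b G]]])
    moreover have "((\<lambda>l. - (of_real ?L * G l)) has_sum - (of_real ?L * (\<Sum>\<^sub>\<infinity>l. G l))) UNIV"
      by (intro has_sum_uminusI has_sum_cmult_right has_sum_infsum sG)
    ultimately have "((\<lambda>l. ?f l + - (of_real ?L * G l)) has_sum
        (hahn_exton_series p b G (int n) + - (of_real ?L * (\<Sum>\<^sub>\<infinity>l. G l)))) UNIV"
      by (rule has_sum_add)
    moreover have "((\<lambda>l. norm (G l) * p powi l * (C * p ^ n)) has_sum K * (C * p ^ n)) UNIV"
      unfolding K_def by (intro has_sum_cmult_left has_sum_infsum Gp)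
    moreover have "norm (?f l + - (of_real ?L * G l)) \<le> norm (G l) * p powi l * (C * p ^ n)" for l
    proof -
      have "?f l + - (of_real ?L * G l) = G l * of_real (hahn_exton p b (l + int n) - ?L)"
        by (simp add: algebra_simps)
      also have "norm \<dots> \<le> norm (G l) * (C * p powi (l + int n))"
        unfolding norm_mult norm_of_real using C by (intro mult_left_mono) auto
      also have "\<dots> = norm (G l) * p powi l * (C * p ^ n)"
        using p by (simp add: power_int_add)
      finally show ?thesis .
    qed
    ultimately show ?thesis
      using norm_infsum_le by fastforce
  qed
  show ?thesis
  proof (rule LIM_zero_cancel, rule Lim_null_comparison)
    show "eventually (\<lambda>n. norm (hahn_exton_series p b G (int n) - of_real ?L * (\<Sum>\<^sub>\<infinity>l. G l))
        \<le> K * C * p ^ n) sequentially"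
      using bound by simp
    show "(\<lambda>n. K * C * p ^ n) \<longlonglongrightarrow> 0"
      using p by (intro tendsto_mult_right_zero LIMSEQ_power_zero) auto
  qed
qed

text \<open>
  A bound that factors over \<open>n\<close> and \<open>m\<close> and decays in \<open>n\<close> at both ends: the minimum combines the estimates of
  \<open>inv_qfact_bound\<close> for \<open>r = 1\<close> and for \<open>r = a / 2\<close>.
\<close>

lemma inv_qfact_int_bound:
  assumes "0 < a" "a < 1"
  shows "a powi n * \<bar>inv_qfact p (n + m)\<bar> \<le>
    1 / qpoch_inf p p * (min (a powi n) (2 powi n) * (if m \<ge> 0 then (2 / a) ^ nat m else 1))"
proof -
  let ?H = "1 / qpoch_inf p p"
  define W where "W = (if m \<ge> 0 then (2 / a) ^ nat m else 1)"
  have H: "0 < ?H"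
    using qpoch_inf_pos[of p] p by simp
  have W: "1 \<le> W"
    using assms by (simp add: W_def one_le_power)
  have "a powi n * \<bar>inv_qfact p (n + m)\<bar> \<le> a powi n * ?H"
    using inv_qfact_bounded[of "n + m"] assms by (intro mult_left_mono) auto
  also have "\<dots> \<le> ?H * (a powi n * W)"
    using H W mult_left_mono[OF W, of "a powi n"] assms by (simp add: divide_right_mono)
  finally have 1: "a powi n * \<bar>inv_qfact p (n + m)\<bar> \<le> ?H * (a powi n * W)" .
  have "a powi n * \<bar>inv_qfact p (n + m)\<bar> \<le> a powi n * (?H * (a / 2) powi (- (n + m)))"
    using inv_qfact_bound[of "a / 2" "n + m"] assms by (intro mult_left_mono) auto
  also have "\<dots> = ?H * (2 powi n * (a / 2) powi (- m))"
  proof -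
    have "a powi n * (a / 2) powi (- (n + m)) = (a / (a / 2)) powi n * (a / 2) powi (- m)"
      using assms power_int_diff[of "a / 2" "- m" n]
      by (simp only: power_int_divide_distrib[of a "a / 2"]) (simp add: algebra_simps)
    then show ?thesis
      using assms by simp
  qed
  finally have 3: "a powi n * \<bar>inv_qfact p (n + m)\<bar> \<le> ?H * (2 powi n * (a / 2) powi (- m))" .
  have "(a / 2) powi (- m) \<le> W"
  proof (cases "m \<ge> 0")
    case True
    then show ?thesis
      using assms by (simp add: W_def power_int_minus power_int_def power_divide)
  next
    case False
    then show ?thesis
      using assms by (simp add: W_def power_int_le_one)
  qed
  then have "?H * (2 powi n * (a / 2) powi (- m)) \<le> ?H * (2 powi n * W)"
    using H by (intro mult_left_mono) auto
  with 3 have 2: "a powi n * \<bar>inv_qfact p (n + m)\<bar> \<le> ?H * (2 powi n * W)"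
    by (rule order_trans)
  show ?thesis
    using 1 2 unfolding W_def[symmetric] by (simp add: min_def)
qed

lemma summable_min_powers:
  assumes "0 < a" "a < 1"
  shows "(\<lambda>n. C * min (a powi n) (2 powi n) :: real) summable_on UNIV"
proof (rule summable_on_cmult_right)
  have "(\<lambda>n. norm (min (a powi n) (2 powi n) :: real)) summable_on UNIV"
    by (rule summable_on_int_geometric[of a 2 _ 1 1]) (use assms in auto)
  then show "(\<lambda>n. min (a powi n) (2 powi n) :: real) summable_on UNIV"
    by (rule abs_summable_summable)
qed

lemma infsum_inv_qfact_power:
  assumes a: "0 < a" "a < 1"
  shows "qpoch_inf a p * (\<Sum>\<^sub>\<infinity>n. a powi n * inv_qfact p n) = 1"
proof -
  let ?H = "1 / qpoch_inf p p"
  define F where "F i n = euler_coeff p i * (a powi n * inv_qfact p (n - int i))" for i n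
  have "qpoch_inf a p * (\<Sum>\<^sub>\<infinity>n. a powi n * inv_qfact p n) =
      (\<Sum>\<^sub>\<infinity>i. euler_coeff p i * a ^ i * (\<Sum>\<^sub>\<infinity>n. a powi n * inv_qfact p n))"
    unfolding euler_identity infsum_cmult_left' ..
  also have "\<dots> = (\<Sum>\<^sub>\<infinity>i. \<Sum>\<^sub>\<infinity>n. F i n)"
  proof (rule infsum_cong)
    fix i
    have "(\<Sum>\<^sub>\<infinity>n. F i n) = (\<Sum>\<^sub>\<infinity>n. F i (n + int i))"
      by (rule infsum_int_shift[symmetric])
    also have "\<dots> = (\<Sum>\<^sub>\<infinity>n. (euler_coeff p i * a ^ i) * (a powi n * inv_qfact p n))"
      using a by (intro infsum_cong) (simp add: F_def power_int_add)
    finally show "euler_coeff p i * a ^ i * (\<Sum>\<^sub>\<infinity>n. a powi n * inv_qfact p n) = (\<Sum>\<^sub>\<infinity>n. F i n)"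
      unfolding infsum_cmult_right' ..
  qed
  also have "\<dots> = (\<Sum>\<^sub>\<infinity>n. \<Sum>\<^sub>\<infinity>i. F i n)"
  proof (rule infsum_swap_dominated[OF _ summable_euler[of 1] summable_min_powers[OF a]])
    fix i n
    have "norm (F i n) = norm (euler_coeff p i * 1 ^ i) * (a powi n * \<bar>inv_qfact p (n + (- int i))\<bar>)"
      using a by (simp add: F_def abs_mult power_int_abs)
    also have "\<dots> \<le> norm (euler_coeff p i * 1 ^ i) * (?H * min (a powi n) (2 powi n))"
      using inv_qfact_int_bound[OF a, of n "- int i"]
      by (intro mult_left_mono) (auto split: if_splits)
    finally show "norm (F i n) \<le> \<dots>" .
  qed
  also have "\<dots> = (\<Sum>\<^sub>\<infinity>n::int. if n = 0 then 1 else 0)"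
  proof (rule infsum_cong)
    fix n
    have "(\<Sum>\<^sub>\<infinity>i. F i n) = (\<Sum>\<^sub>\<infinity>i. a powi n * (euler_coeff p i * inv_qfact p (n - int i)))"
      by (rule infsum_cong) (simp add: F_def)
    then show "(\<Sum>\<^sub>\<infinity>i. F i n) = (if n = 0 then 1 else 0)"
      unfolding infsum_cmult_right' infsum_euler_inv_qfact by simp
  qed
  also have "\<dots> = (\<Sum>\<^sub>\<infinity>n\<in>{0::int}. 1)"
    by (rule infsum_cong_neutral) auto
  finally show ?thesis
    by simp
qed

text \<open>
  The generating function itself, evaluated at \<open>t = a\<close>.
\<close>

lemma infsum_hahn_exton_power:
  assumes a: "0 < a" "a < 1" and b: "0 < b"
  shows "(\<Sum>\<^sub>\<infinity>n. a powi n * hahn_exton p (a * b) n) = qpoch_inf b p / qpoch_inf a p"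
proof -
  let ?H = "1 / qpoch_inf p p"
  define F where "F n j = euler_coeff p j * (a * b) ^ j * (a powi n * inv_qfact p (n + int j))" for n j
  have "(\<Sum>\<^sub>\<infinity>n. a powi n * hahn_exton p (a * b) n) = (\<Sum>\<^sub>\<infinity>n. \<Sum>\<^sub>\<infinity>j. F n j)"
    unfolding hahn_exton_def infsum_cmult_right'[symmetric] F_def by (simp add: mult_ac)
  also have "\<dots> = (\<Sum>\<^sub>\<infinity>j. \<Sum>\<^sub>\<infinity>n. F n j)"
  proof (rule infsum_swap_dominated[OF _ summable_min_powers[OF a] summable_euler[of "2 * b"]])
    fix n j
    have "norm (F n j) = norm (euler_coeff p j * (a * b) ^ j) * (a powi n * \<bar>inv_qfact p (n + int j)\<bar>)"
      using a by (simp add: F_def abs_mult power_int_abs)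
    also have "\<dots> \<le> norm (euler_coeff p j * (a * b) ^ j) * (?H * (min (a powi n) (2 powi n) * (2 / a) ^ j))"
      using inv_qfact_int_bound[OF a, of n "int j"] by (intro mult_left_mono) auto
    also have "\<dots> = ?H * min (a powi n) (2 powi n) * norm (euler_coeff p j * (2 * b) ^ j)"
      using a b by (simp add: abs_mult power_mult_distrib power_divide)
    finally show "norm (F n j) \<le> \<dots>" .
  qed
  also have "\<dots> = (\<Sum>\<^sub>\<infinity>j. (euler_coeff p j * b ^ j) * (\<Sum>\<^sub>\<infinity>n. a powi n * inv_qfact p n))"
  proof (rule infsum_cong)
    fix j
    have "(\<Sum>\<^sub>\<infinity>n. F n j) = (\<Sum>\<^sub>\<infinity>n. F (n + (- int j)) j)"
      by (rule infsum_int_shift[symmetric])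
    also have "\<dots> = (\<Sum>\<^sub>\<infinity>n. (euler_coeff p j * b ^ j) * (a powi n * inv_qfact p n))"
      using a by (intro infsum_cong) (simp add: F_def power_int_diff power_mult_distrib)
    finally show "(\<Sum>\<^sub>\<infinity>n. F n j) = (euler_coeff p j * b ^ j) * (\<Sum>\<^sub>\<infinity>n. a powi n * inv_qfact p n)"
      unfolding infsum_cmult_right' .
  qed
  also have "\<dots> = qpoch_inf b p * (\<Sum>\<^sub>\<infinity>n. a powi n * inv_qfact p n)"
    unfolding infsum_cmult_left' euler_identity[of b] ..
  also have "(\<Sum>\<^sub>\<infinity>n. a powi n * inv_qfact p n) = 1 / qpoch_inf a p"
    using infsum_inv_qfact_power[OF a] qpoch_inf_pos[OF a(2)] by (simp add: field_simps)
  finally show ?thesis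
    by simp
qed

text \<open>
  The Weyl integral at the origin, where the kernel is constant. Once \<open>n\<close> is shifted by \<open>l\<close>, the double sum has a
  product majorant.
\<close>

lemma infsum_hahn_exton_series_power:
  assumes a: "0 < a" "a < 1" and b: "0 < b"
    and G: "(\<lambda>l. norm (of_real (a powi (- l)) * G l)) summable_on UNIV"
  shows "(\<Sum>\<^sub>\<infinity>n. of_real (a powi n) * hahn_exton_series p (a * b) G (n + u)) =
    of_real (a powi (- u) * (qpoch_inf b p / qpoch_inf a p)) * (\<Sum>\<^sub>\<infinity>l. of_real (a powi (- l)) * G l)"
proof -
  let ?s = "hahn_exton p (a * b)"
  define F :: "int \<Rightarrow> int \<Rightarrow> complex" where "F l n = of_real (a powi (n - l) * ?s (n + u)) * G l" for l n
  have w: "a powi (n - l) = a powi n * a powi (- l)" for n l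
    using a by (simp add: power_int_diff power_int_minus divide_inverse)
  have sm: "(\<lambda>n. norm (a powi n * ?s (n + u))) summable_on UNIV"
    by (rule summable_hahn_exton_weighted) (use a b in auto)
  have *: "(\<Sum>\<^sub>\<infinity>n. of_real (a powi n * ?s (n + u))) =
      (of_real (a powi (- u) * (qpoch_inf b p / qpoch_inf a p)) :: complex)"
  proof -
    have "(\<Sum>\<^sub>\<infinity>n. a powi n * ?s (n + u)) = (\<Sum>\<^sub>\<infinity>n. a powi (- u) * (a powi (n + u) * ?s (n + u)))"
      using a by (intro infsum_cong) (simp add: power_int_add power_int_minus)
    also have "\<dots> = a powi (- u) * (\<Sum>\<^sub>\<infinity>n. a powi n * ?s n)"
      unfolding infsum_cmult_right' by (subst infsum_int_shift) simp
    finally have E: "(\<Sum>\<^sub>\<infinity>n. a powi n * ?s (n + u)) =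
        a powi (- u) * (qpoch_inf b p / qpoch_inf a p)"
      unfolding infsum_hahn_exton_power[OF a b] .
    show ?thesis
      by (simp only: infsum_of_real[OF abs_summable_summable[OF sm]] E)
  qed
  have "(\<Sum>\<^sub>\<infinity>n. of_real (a powi n) * hahn_exton_series p (a * b) G (n + u)) = (\<Sum>\<^sub>\<infinity>n. \<Sum>\<^sub>\<infinity>l. F l (l + n))"
    unfolding hahn_exton_series_def infsum_cmult_right'[symmetric] F_def
    by (intro infsum_cong) (simp add: mult_ac add_ac)
  also have "\<dots> = (\<Sum>\<^sub>\<infinity>l. \<Sum>\<^sub>\<infinity>n. F l (l + n))"
  proof (rule infsum_swap_banach)
    have "(\<lambda>(l, n). F l n) summable_on UNIV \<times> UNIV"
    proof (rule summable_on_Times_dominated[OF _ G sm])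
      show "norm (F l n) \<le> norm (of_real (a powi (- l)) * G l) * norm (a powi n * ?s (n + u))" for l n
        unfolding F_def w using a by (simp add: norm_mult abs_mult norm_power_int mult_ac)
    qed
    moreover have bij: "bij_betw (\<lambda>(n, l). (l, l + n)) (UNIV \<times> UNIV) (UNIV \<times> (UNIV :: int set))"
      by (rule bij_betwI[where g = "\<lambda>(l, n). (n - l, l)"]) auto
    ultimately show "(\<lambda>(n, l). F l (l + n)) summable_on UNIV \<times> UNIV"
      using summable_on_reindex_bij_betw[OF bij, of "\<lambda>(l, n). F l n"]
      by (simp add: case_prod_unfold)
  qed
  also have "\<dots> = (\<Sum>\<^sub>\<infinity>l. of_real (a powi (- u) * (qpoch_inf b p / qpoch_inf a p)) *
      (of_real (a powi (- l)) * G l))"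
  proof (rule infsum_cong)
    fix l
    have "(\<Sum>\<^sub>\<infinity>n. F l (l + n)) = (\<Sum>\<^sub>\<infinity>n. F l n)"
      using infsum_int_shift[of "F l" l] by (simp add: add.commute)
    also have "\<dots> = (\<Sum>\<^sub>\<infinity>n. (of_real (a powi n * ?s (n + u))) * (of_real (a powi (- l)) * G l))"
      by (rule infsum_cong) (simp add: F_def w)
    finally show "(\<Sum>\<^sub>\<infinity>n. F l (l + n)) = of_real (a powi (- u) * (qpoch_inf b p / qpoch_inf a p)) *
      (of_real (a powi (- l)) * G l)"
      unfolding infsum_cmult_left' * .
  qed
  finally show ?thesis
    unfolding infsum_cmult_right' .
qed

end

section \<open>Decay of the cosine transform of a Schwartz function\<close>

text \<open>
  The functions whose restrictions to \<open>Rq q\<close> form the Schwartz space. The class is stated for functions on the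
  whole line because \<open>Dq\<close> at the origin refers to an ordinary derivative.
\<close>

definition even_q_schwartz :: "real \<Rightarrow> (real \<Rightarrow> complex) \<Rightarrow> bool" where
  "even_q_schwartz q h \<longleftrightarrow> (\<forall>x. h (- x) = h x) \<and> inf_q_differentiable q h \<and>
     (\<forall>n m. q_seminorm q n m h < \<infinity>)"

context
  fixes q :: real
  assumes q: "0 < q" "q < 1"
begin

lemma q_square: "0 < q\<^sup>2" "q\<^sup>2 < 1"
  using q by (simp_all add: power_less_one_iff)

lemma even_q_schwartz_bound:
  assumes "even_q_schwartz q h"
  shows "\<exists>C. \<forall>x. (1 + x\<^sup>2) ^ m * norm ((Dq q ^^ k) h x) \<le> C"
proof -
  have fin: "q_seminorm q k m h < \<infinity>"
    using assms by (simp add: even_q_schwartz_def)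
  have le: "ereal (norm (of_real ((1 + x\<^sup>2) ^ m) * (Dq q ^^ k) h x)) \<le> q_seminorm q k m h" for x
    unfolding q_seminorm_def by (rule SUP_upper2[of "(x, k)"]) auto
  have nonneg: "0 \<le> q_seminorm q k m h"
    by (rule order_trans[OF _ le[of 0]]) simp
  obtain C where C: "q_seminorm q k m h = ereal C"
    using fin nonneg by (cases "q_seminorm q k m h") auto
  have "(1 + x\<^sup>2) ^ m * norm ((Dq q ^^ k) h x) \<le> C" for x
  proof -
    have "norm (of_real ((1 + x\<^sup>2) ^ m) :: complex) = (1 + x\<^sup>2) ^ m"
      unfolding norm_of_real by (rule abs_of_nonneg) simp
    then show ?thesis
      using le[of x] unfolding C norm_mult by simp
  qed
  then show ?thesis by blast
qed

lemma Dq_minus_even: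
  assumes "\<And>x. h (- x) = h x" "x \<noteq> 0"
  shows "Dq q h (- x) = - Dq q h x"
  using assms(1)[of x] assms(1)[of "q * x"] assms(2) q by (simp add: Dq_def field_simps)

lemma Dq_minus_odd:
  assumes "\<And>x. x \<noteq> 0 \<Longrightarrow> h (- x) = - h x"
  shows "Dq q h (- x) = Dq q h x"
proof (cases "x = 0")
  case False
  then show ?thesis
    using assms[of x] assms[of "q * x"] q by (simp add: Dq_def field_simps)
qed simp

text \<open>
  The second \<open>q\<close>-derivative restores evenness and only shifts the index of the iterates, so that the class is
  stable under the step used to gain decay.
\<close>

lemma even_q_schwartz_Dq2:
  assumes "even_q_schwartz q h"
  shows "even_q_schwartz q (Dq q (Dq q h))"
proof -
  have iter: "(Dq q ^^ k) (Dq q (Dq q h)) = (Dq q ^^ (k + 2)) h" for k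
    by (simp add: funpow_swap1)
  have "Dq q (Dq q h) (- x) = Dq q (Dq q h) x" for x
    using assms by (intro Dq_minus_odd Dq_minus_even) (auto simp: even_q_schwartz_def)
  moreover have "inf_q_differentiable q (Dq q (Dq q h))"
    using assms unfolding even_q_schwartz_def inf_q_differentiable_def iter by blast
  moreover have "q_seminorm q n m (Dq q (Dq q h)) < \<infinity>" for n m
  proof -
    have "q_seminorm q n m (Dq q (Dq q h)) \<le> q_seminorm q (n + 2) m h"
      unfolding q_seminorm_def
    proof (rule SUP_least)
      fix z :: "real \<times> nat"
      obtain x k where z: "z = (x, k)"
        by fastforce
      assume "z \<in> UNIV \<times> {..n}"
      then show "(case z of (x, k) \<Rightarrow>
          ereal (norm (of_real ((1 + x\<^sup>2) ^ m) * (Dq q ^^ k) (Dq q (Dq q h)) x)))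
          \<le> (SUP (x, k) \<in> UNIV \<times> {..n + 2}. ereal (norm (of_real ((1 + x\<^sup>2) ^ m) * (Dq q ^^ k) h x)))"
        unfolding iter z by (intro SUP_upper2[of "(x, k + 2)"]) auto
    qed
    also have "\<dots> < \<infinity>"
      using assms by (simp add: even_q_schwartz_def)
    finally show ?thesis .
  qed
  ultimately show ?thesis
    by (simp add: even_q_schwartz_def)
qed

lemma even_q_schwartz_bounded:
  assumes "even_q_schwartz q h"
  shows "\<exists>C. \<forall>x. norm ((Dq q ^^ k) h x) \<le> C"
  using even_q_schwartz_bound[OF assms, of 0 k] by simp

lemma even_q_schwartz_summable:
  assumes "even_q_schwartz q h"
  shows "(\<lambda>k. norm (h (q powi k) * of_real (q powi k))) summable_on UNIV"
proof -
  obtain C where C: "\<And>x. (1 + x\<^sup>2) ^ 1 * norm ((Dq q ^^ 0) h x) \<le> C"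
    using even_q_schwartz_bound[OF assms] by blast
  have bound: "norm (h x) \<le> C" "norm (h x) * x\<^sup>2 \<le> C" for x
    using C[of x] norm_ge_zero[of "h x"] mult_nonneg_nonneg[OF zero_le_power2[of x] norm_ge_zero[of "h x"]]
    by (auto simp: algebra_simps intro: order_trans[rotated])
  show ?thesis
  proof (rule summable_on_int_geometric[of q "1 / q" _ C C])
    fix k
    have pos: "0 < q powi k"
      using q by simp
    show "norm (h (q powi k) * of_real (q powi k)) \<le> C * q powi k"
      using bound(1)[of "q powi k"] pos q
      by (simp add: norm_mult norm_power_int mult_right_mono)
    have "norm (h (q powi k) * of_real (q powi k)) = norm (h (q powi k)) * (q powi k)\<^sup>2 * (1 / q) powi k"
      using pos q by (simp add: norm_mult norm_power_int power2_eq_square power_int_divide_distrib)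
    also have "\<dots> \<le> C * (1 / q) powi k"
      using bound(2)[of "q powi k"] q by (intro mult_right_mono) auto
    finally show "norm (h (q powi k) * of_real (q powi k)) \<le> C * (1 / q) powi k" .
  qed (use q in auto)
qed

lemma Dq_even_0:
  assumes even: "\<And>x. h (- x) = h x" and diff: "h differentiable (at 0)"
  shows "Dq q h 0 = 0"
proof -
  let ?d = "vector_derivative h (at 0)"
  have d: "(h has_vector_derivative ?d) (at 0)"
    using diff by (simp add: vector_derivative_works)
  have "((h \<circ> uminus) has_vector_derivative (- 1) *\<^sub>R ?d) (at 0)"
    by (rule vector_diff_chain_at) (auto intro!: derivative_eq_intros d)
  moreover have "h \<circ> uminus = h"
    using even by (auto simp: fun_eq_iff)
  ultimately have "(h has_vector_derivative (- 1) *\<^sub>R ?d) (at 0)"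
    by (simp only:)
  from vector_derivative_unique_at[OF this d] have "?d + ?d = 0"
    by (metis add.right_inverse scaleR_minus1_left)
  then have "?d = 0"
    by (simp flip: mult_2)
  then show ?thesis
    by (simp add: Dq_def)
qed

lemma powers_at_0: "filterlim (\<lambda>n. q ^ n) (at 0) sequentially"
  using q by (intro filterlim_atI LIMSEQ_power_zero) auto

text \<open>
  An odd function that is differentiable at the origin is \<open>O(x)\<close> there. This is the boundary condition that
  makes the second summation by parts absolutely convergent.
\<close>

lemma even_q_schwartz_Dq_small:
  assumes h: "even_q_schwartz q h"
  shows "\<exists>C. \<forall>k. norm (Dq q h (q powi k)) \<le> C * q powi k"
proof -
  have D: "(Dq q ^^ k) h differentiable (at 0)" for k
    using h by (simp add: even_q_schwartz_def inf_q_differentiable_def)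
  have 0: "Dq q h 0 = 0"
    using D[of 0] h by (intro Dq_even_0) (auto simp: even_q_schwartz_def)
  let ?d = "vector_derivative (Dq q h) (at 0)"
  have "(Dq q h has_vector_derivative ?d) (at 0)"
    using D[of 1] by (simp add: vector_derivative_works)
  then have "((\<lambda>x. norm (Dq q h x - x *\<^sub>R ?d) / norm x) \<longlongrightarrow> 0) (at 0)"
    by (simp add: has_vector_derivative_def has_derivative_at 0)
  from filterlim_compose[OF this powers_at_0]
  have "Bseq (\<lambda>n. norm (Dq q h (q ^ n) - q ^ n *\<^sub>R ?d) / norm (q ^ n))"
    by (intro convergent_imp_Bseq convergentI)
  then obtain C0 where C0: "\<And>n. norm (norm (Dq q h (q ^ n) - q ^ n *\<^sub>R ?d) / norm (q ^ n)) \<le> C0"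
    unfolding Bseq_def by auto
  define C where "C = C0 + norm ?d"
  have C: "norm (Dq q h (q ^ n)) \<le> C * q ^ n" for n
  proof -
    have "norm (Dq q h (q ^ n) - q ^ n *\<^sub>R ?d) \<le> C0 * q ^ n"
      using C0[of n] q by (simp add: field_simps)
    moreover have "norm (Dq q h (q ^ n)) \<le> norm (Dq q h (q ^ n) - q ^ n *\<^sub>R ?d) + norm (q ^ n *\<^sub>R ?d)"
      by (metis diff_add_cancel norm_triangle_ineq)
    ultimately show ?thesis
      using q by (simp add: C_def algebra_simps)
  qed
  obtain B where B: "\<And>x. norm ((Dq q ^^ 1) h x) \<le> B"
    using even_q_schwartz_bounded[OF h] by blast
  have "norm (Dq q h (q powi k)) \<le> max B C * q powi k" for k
  proof (cases "k < 0")
    case True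
    then have "1 \<le> q powi k"
      using q power_int_decreasing[of k 0 q] by simp
    moreover have "0 \<le> B"
      using order_trans[OF norm_ge_zero B] .
    ultimately have "B * 1 \<le> max B C * q powi k"
      by (intro mult_mono) auto
    then show ?thesis
      using B[of "q powi k"] by simp
  next
    case False
    then obtain n where k: "k = int n"
      by (metis int_nat_eq not_less)
    have "norm (Dq q h (q ^ n)) \<le> C * q ^ n"
      by (rule C)
    also have "\<dots> \<le> max B C * q ^ n"
      using q by (intro mult_right_mono) auto
    finally show ?thesis
      by (simp add: k)
  qed
  then show ?thesis
    by blast
qed

lemma even_q_schwartz_tendsto_0:
  assumes h: "even_q_schwartz q h"
  shows "(\<lambda>n. h (q ^ n)) \<longlonglongrightarrow> h 0"
proof -
  have "(Dq q ^^ 0) h differentiable (at 0)"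
    using h by (simp only: even_q_schwartz_def inf_q_differentiable_def)
  then have "isCont h 0"
    by (simp add: differentiable_imp_continuous_within)
  then show ?thesis
    using q by (intro isCont_tendsto_compose[of 0 h] LIMSEQ_power_zero) auto
qed

text \<open>
  Here \<open>d\<close> and \<open>c\<close> are the first and second difference quotients of \<open>f\<close> on the lattice. The first summation by
  parts writes the cosine as a difference of sines (\<open>hahn_exton_scale\<close>), the second one the sine as a difference
  of cosines (\<open>hahn_exton_diff\<close>). No boundary terms arise since every sum converges absolutely over all integers:
  the bound \<open>C * q powi k\<close> on \<open>d\<close> replaces the weight \<open>q powi k\<close> that has been used up.
\<close>

lemma q_summation_by_parts:
  assumes f: "\<And>k. norm (f k) \<le> B" and d: "\<And>k. norm (d k) \<le> C * q powi k"
    and fd: "\<And>k. f (k - 1) - f k = of_real (q powi k) * d k"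
    and dc: "\<And>k. d k - d (k + 1) = of_real (q powi k) * c k"
  shows "hahn_exton_series (q\<^sup>2) q (\<lambda>k. f k * of_real (q powi k)) l =
    - of_real (q\<^sup>2 powi (- l)) * hahn_exton_series (q\<^sup>2) q (\<lambda>k. c k * of_real (q powi k)) l"
proof -
  note p = q_square
  let ?s = "hahn_exton (q\<^sup>2) q" and ?t = "hahn_exton (q\<^sup>2) (q * q\<^sup>2)"
  have sm_t: "(\<lambda>k. of_real (q powi k * ?t (k + m)) * f k) summable_on UNIV" for m
  proof (rule abs_summable_summable, rule Infinite_Sum.abs_summable_on_comparison_test')
    show "(\<lambda>k. norm (q powi k * ?t (k + m)) * B) summable_on UNIV"
      by (intro summable_on_cmult_left summable_hahn_exton_weighted[OF p]) (use q in auto)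
    show "norm (of_real (q powi k * ?t (k + m)) * f k) \<le> norm (q powi k * ?t (k + m)) * B" for k
      unfolding norm_mult[of "of_real _"] norm_of_real real_norm_def
      using f by (intro mult_left_mono) auto
  qed
  have sm_d: "(\<lambda>k. of_real (?s (k + m)) * d k) summable_on UNIV" for m
  proof (rule abs_summable_summable, rule Infinite_Sum.abs_summable_on_comparison_test')
    show "(\<lambda>k. norm (q powi k * ?s (k + m)) * C) summable_on UNIV"
      by (intro summable_on_cmult_left summable_hahn_exton_weighted[OF p]) (use q in auto)
    fix k
    have "norm (of_real (?s (k + m)) * d k) \<le> \<bar>?s (k + m)\<bar> * (C * q powi k)"
      unfolding norm_mult norm_of_real using d by (intro mult_left_mono) auto
    also have "\<dots> = norm (q powi k * ?s (k + m)) * C"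
      using q by (simp add: abs_mult power_int_abs)
    finally show "norm (of_real (?s (k + m)) * d k) \<le> norm (q powi k * ?s (k + m)) * C" .
  qed
  have qq: "q powi (k + 1) = q powi k * q" for k
    using q by (simp add: power_int_add)
  have "hahn_exton_series (q\<^sup>2) q (\<lambda>k. f k * of_real (q powi k)) l =
      (\<Sum>\<^sub>\<infinity>k. of_real (q powi k * ?t (k + l)) * f k - of_real (q powi (k + 1) * ?t (k + 1 + l)) * f ((k + 1) - 1))"
    unfolding hahn_exton_series_def
  proof (rule infsum_cong)
    fix k
    have S: "?s (k + l) = ?t (k + l) - q * ?t (k + 1 + l)"
      using hahn_exton_scale[OF p, of q "k + l"] by (simp add: algebra_simps)
    show "f k * of_real (q powi k) * of_real (?s (k + l)) =
      of_real (q powi k * ?t (k + l)) * f k - of_real (q powi (k + 1) * ?t (k + 1 + l)) * f ((k + 1) - 1)"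
      unfolding qq S by (simp add: algebra_simps)
  qed
  also have "\<dots> = (\<Sum>\<^sub>\<infinity>k. of_real (q powi k * ?t (k + l)) * f k) -
      (\<Sum>\<^sub>\<infinity>k. of_real (q powi (k + 1) * ?t (k + 1 + l)) * f ((k + 1) - 1))"
  proof (rule infsum_diff[OF sm_t])
    have "(\<lambda>k. of_real q * (of_real (q powi k * ?t (k + (1 + l))) * f k)) summable_on UNIV"
      by (rule summable_on_cmult_right[OF sm_t])
    then show "(\<lambda>k. of_real (q powi (k + 1) * ?t (k + 1 + l)) * f ((k + 1) - 1)) summable_on UNIV"
      unfolding qq by (simp add: mult_ac add_ac)
  qed
  also have "\<dots> = (\<Sum>\<^sub>\<infinity>k. of_real (q powi k * ?t (k + l)) * f k) -
      (\<Sum>\<^sub>\<infinity>k. of_real (q powi k * ?t (k + l)) * f (k - 1))"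
    by (simp only: infsum_int_shift[of "\<lambda>k. of_real (q powi k * ?t (k + l)) * f (k - 1)" 1])
  also have "\<dots> = (\<Sum>\<^sub>\<infinity>k. of_real (q powi k * ?t (k + l)) * f k - of_real (q powi k * ?t (k + l)) * f (k - 1))"
  proof (rule infsum_diff[OF sm_t, symmetric])
    have "(\<lambda>k. of_real q * (of_real (q powi k * ?t (k + (1 + l))) * f k)) summable_on UNIV"
      by (rule summable_on_cmult_right[OF sm_t])
    then have "(\<lambda>k. of_real (q powi (k + 1) * ?t (k + 1 + l)) * f ((k + 1) - 1)) summable_on UNIV"
      unfolding qq by (simp add: mult_ac add_ac)
    then show "(\<lambda>k. of_real (q powi k * ?t (k + l)) * f (k - 1)) summable_on UNIV"
      by (simp only: summable_on_int_shift[of "\<lambda>k. of_real (q powi k * ?t (k + l)) * f (k - 1)" 1])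
  qed
  also have "\<dots> = (\<Sum>\<^sub>\<infinity>k. - of_real (q\<^sup>2 powi (- l)) *
      (of_real (?s (k + l)) * d k - of_real (?s ((k - 1) + l)) * d ((k - 1) + 1)))"
  proof (rule infsum_cong)
    fix k
    have "of_real (q powi k * ?t (k + l)) * f k - of_real (q powi k * ?t (k + l)) * f (k - 1) =
        - of_real (q powi k * q powi k * ?t (k + l)) * d k"
      using fd[of k] by (simp add: algebra_simps)
    also have "q powi k * q powi k = q\<^sup>2 powi (- l) * q\<^sup>2 powi (k + l)"
      using q by (simp add: power_int_add power_int_minus power2_eq_square power_int_mult_distrib field_simps)
    also have "q\<^sup>2 powi (- l) * q\<^sup>2 powi (k + l) * ?t (k + l) = q\<^sup>2 powi (- l) * (?s (k + l) - ?s ((k - 1) + l))"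
      using hahn_exton_diff[OF p, of q "k + l"] by (simp add: algebra_simps)
    finally show "of_real (q powi k * ?t (k + l)) * f k - of_real (q powi k * ?t (k + l)) * f (k - 1) =
        - of_real (q\<^sup>2 powi (- l)) *
      (of_real (?s (k + l)) * d k - of_real (?s ((k - 1) + l)) * d ((k - 1) + 1))"
      by (simp add: algebra_simps)
  qed
  also have "\<dots> = - of_real (q\<^sup>2 powi (- l)) * ((\<Sum>\<^sub>\<infinity>k. of_real (?s (k + l)) * d k) -
      (\<Sum>\<^sub>\<infinity>k. of_real (?s (k + (- 1) + l)) * d (k + (- 1) + 1)))"
    unfolding infsum_cmult_right'
  proof (subst infsum_diff[OF sm_d])
    have "(\<lambda>k. of_real (?s (k + (l - 1))) * d k) summable_on UNIV"
      by (rule sm_d)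
    then show "(\<lambda>k. of_real (?s ((k - 1) + l)) * d ((k - 1) + 1)) summable_on UNIV"
      by (simp add: algebra_simps)
  qed simp
  also have "(\<Sum>\<^sub>\<infinity>k. of_real (?s (k + (- 1) + l)) * d (k + (- 1) + 1)) =
      (\<Sum>\<^sub>\<infinity>k. of_real (?s (k + l)) * d (k + 1))"
    by (rule infsum_int_shift[of "\<lambda>k. of_real (?s (k + l)) * d (k + 1)"])
  also have "(\<Sum>\<^sub>\<infinity>k. of_real (?s (k + l)) * d k) - (\<Sum>\<^sub>\<infinity>k. of_real (?s (k + l)) * d (k + 1)) =
      (\<Sum>\<^sub>\<infinity>k. of_real (?s (k + l)) * d k - of_real (?s (k + l)) * d (k + 1))"
  proof (rule infsum_diff[OF sm_d, symmetric])
    have "(\<lambda>k. of_real (?s (k + (l - 1))) * d k) summable_on UNIV"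
      by (rule sm_d)
    then have "(\<lambda>k. of_real (?s ((k + 1) + (l - 1))) * d (k + 1)) summable_on UNIV"
      by (subst summable_on_int_shift[of "\<lambda>k. of_real (?s (k + (l - 1))) * d k"])
    then show "(\<lambda>k. of_real (?s (k + l)) * d (k + 1)) summable_on UNIV"
      by simp
  qed
  also have "\<dots> = hahn_exton_series (q\<^sup>2) q (\<lambda>k. c k * of_real (q powi k)) l"
    unfolding hahn_exton_series_def right_diff_distrib[symmetric] dc by (simp add: mult_ac)
  finally show ?thesis .
qed

text \<open>
  Up to a constant and a unit shift, the transform of the second \<open>q\<close>-derivative is the transform multiplied by the
  square of the frequency.
\<close>

lemma hahn_exton_series_Dq2:
  assumes h: "even_q_schwartz q h"
  shows "hahn_exton_series (q\<^sup>2) q (\<lambda>k. h (q powi k) * of_real (q powi k)) l =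
    - of_real ((1 - q)\<^sup>2 / q * q\<^sup>2 powi (- l)) *
      hahn_exton_series (q\<^sup>2) q (\<lambda>k. Dq q (Dq q h) (q powi k) * of_real (q powi k)) (l + 1)"
proof -
  obtain B where B: "\<And>x. norm ((Dq q ^^ 0) h x) \<le> B"
    using even_q_schwartz_bounded[OF h] by blast
  obtain C where C: "\<And>k. norm (Dq q h (q powi k)) \<le> C * q powi k"
    using even_q_schwartz_Dq_small[OF h] by blast
  define d where "d k = of_real ((1 - q) / q) * Dq q h (q powi (k - 1))" for k
  define c where "c k = of_real (((1 - q) / q)\<^sup>2) * Dq q (Dq q h) (q powi (k - 1))" for k
  have pos: "q powi k \<noteq> 0" for k
    using q by simp
  have next_pow: "q powi k = q * q powi (k - 1)" "q powi (k + 1) = q * q powi k" for k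
    using q power_int_add[of q 1 "k - 1"] power_int_add[of q 1 k] by (simp_all add: add.commute)
  have Dq_eq: "F x - F (q * x) = of_real ((1 - q) * x) * Dq q F x" if "x \<noteq> 0" for F x
    using that q by (simp add: Dq_def)
  have "hahn_exton_series (q\<^sup>2) q (\<lambda>k. h (q powi k) * of_real (q powi k)) l =
    - of_real (q\<^sup>2 powi (- l)) * hahn_exton_series (q\<^sup>2) q (\<lambda>k. c k * of_real (q powi k)) l"
  proof (rule q_summation_by_parts)
    show "norm (h (q powi k)) \<le> B" for k
      using B by simp
    show "norm (d k) \<le> ((1 - q) / q * (C / q)) * q powi k" for k
    proof -
      have "norm (d k) = (1 - q) / q * norm (Dq q h (q powi (k - 1)))"
        unfolding d_def norm_mult norm_of_real using q by simp
      also have "\<dots> \<le> (1 - q) / q * (C * q powi (k - 1))"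
        using C q by (intro mult_left_mono) auto
      also have "\<dots> = ((1 - q) / q * (C / q)) * q powi k"
        unfolding next_pow(1)[of k] using q by simp
      finally show ?thesis .
    qed
    show "h (q powi (k - 1)) - h (q powi k) = of_real (q powi k) * d k" for k
      unfolding d_def next_pow(1)[of k] Dq_eq[OF pos] using q by simp
    show "d k - d (k + 1) = of_real (q powi k) * c k" for k
    proof -
      have "d k - d (k + 1) = of_real ((1 - q) / q) *
          (Dq q h (q powi (k - 1)) - Dq q h (q * q powi (k - 1)))"
        unfolding d_def by (simp add: right_diff_distrib next_pow(1)[of k])
      also have "\<dots> = of_real ((1 - q) / q * ((1 - q) * q powi (k - 1))) * Dq q (Dq q h) (q powi (k - 1))"
        unfolding Dq_eq[OF pos] of_real_mult by (simp only: mult.assoc)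
      also have "(1 - q) / q * ((1 - q) * q powi (k - 1)) = q powi k * ((1 - q) / q)\<^sup>2"
        using q unfolding next_pow(1)[of k] by (simp add: power2_eq_square field_simps)
      finally show ?thesis
        unfolding c_def of_real_mult by (simp only: mult.assoc)
    qed
  qed
  also have "hahn_exton_series (q\<^sup>2) q (\<lambda>k. c k * of_real (q powi k)) l =
      (\<Sum>\<^sub>\<infinity>k. c (k + 1) * of_real (q powi (k + 1)) * of_real (hahn_exton (q\<^sup>2) q ((k + 1) + l)))"
    unfolding hahn_exton_series_def by (rule infsum_int_shift[symmetric])
  also have "\<dots> = (\<Sum>\<^sub>\<infinity>k. of_real ((1 - q)\<^sup>2 / q) * (Dq q (Dq q h) (q powi k) * of_real (q powi k) *
      of_real (hahn_exton (q\<^sup>2) q (k + (l + 1)))))"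
  proof (rule infsum_cong)
    fix k
    have "((1 - q) / q)\<^sup>2 * q powi (k + 1) = (1 - q)\<^sup>2 / q * q powi k"
      unfolding next_pow(2) using q by (simp add: power2_eq_square field_simps)
    moreover have "c (k + 1) * of_real (q powi (k + 1)) =
        of_real (((1 - q) / q)\<^sup>2 * q powi (k + 1)) * Dq q (Dq q h) (q powi k)"
      unfolding c_def of_real_mult by (simp add: mult_ac)
    ultimately have "c (k + 1) * of_real (q powi (k + 1)) =
        of_real ((1 - q)\<^sup>2 / q * q powi k) * Dq q (Dq q h) (q powi k)"
      by (simp only:)
    then show "c (k + 1) * of_real (q powi (k + 1)) * of_real (hahn_exton (q\<^sup>2) q ((k + 1) + l)) =
      of_real ((1 - q)\<^sup>2 / q) * (Dq q (Dq q h) (q powi k) * of_real (q powi k) *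
      of_real (hahn_exton (q\<^sup>2) q (k + (l + 1))))"
      by (simp add: algebra_simps)
  qed
  finally show ?thesis
    unfolding hahn_exton_series_def infsum_cmult_right' by (simp add: mult_ac)
qed

text \<open>
  Each step of the induction divides by the square of the frequency, at the expense of two \<open>q\<close>-derivatives.
\<close>

lemma hahn_exton_series_rapid_decay:
  assumes "even_q_schwartz q h"
  shows "\<exists>C. \<forall>l. norm (hahn_exton_series (q\<^sup>2) q (\<lambda>k. h (q powi k) * of_real (q powi k)) l)
    \<le> C * (q\<^sup>2) powi (- (int K * l))"
  using assms
proof (induction K arbitrary: h)
  case 0
  then show ?case
    using hahn_exton_series_bounded[OF q_square q(1) even_q_schwartz_summable] by simp
next
  case (Suc K)
  let ?F = "\<lambda>h. hahn_exton_series (q\<^sup>2) q (\<lambda>k. h (q powi k) * of_real (q powi k))"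
  obtain C where C: "\<And>l. norm (?F (Dq q (Dq q h)) l) \<le> C * (q\<^sup>2) powi (- (int K * l))"
    using Suc.IH[OF even_q_schwartz_Dq2[OF Suc.prems]] by blast
  have "norm (?F h l) \<le> ((1 - q)\<^sup>2 / q * C * (q\<^sup>2) powi (- int K)) * (q\<^sup>2) powi (- (int (Suc K) * l))" for l
  proof -
    let ?c = "(1 - q)\<^sup>2 / q * q\<^sup>2 powi (- l)"
    have c: "0 \<le> ?c"
      using q by simp
    have "norm (?F h l) = ?c * norm (?F (Dq q (Dq q h)) (l + 1))"
      unfolding hahn_exton_series_Dq2[OF Suc.prems] norm_mult norm_minus_cancel norm_of_real
        abs_of_nonneg[OF c] ..
    also have "\<dots> \<le> ?c * (C * (q\<^sup>2) powi (- (int K * (l + 1))))"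
      by (rule mult_left_mono[OF C c])
    also have "\<dots> = (1 - q)\<^sup>2 / q * C * ((q\<^sup>2) powi (- l) * (q\<^sup>2) powi (- (int K * (l + 1))))"
      by simp
    also have "(q\<^sup>2) powi (- l) * (q\<^sup>2) powi (- (int K * (l + 1))) =
        (q\<^sup>2) powi (- int K) * (q\<^sup>2) powi (- (int (Suc K) * l))"
    proof -
      have "- l + - (int K * (l + 1)) = - int K + - (int (Suc K) * l)"
        by (simp add: algebra_simps)
      moreover have "q\<^sup>2 \<noteq> 0"
        using q by simp
      ultimately show ?thesis
        by (metis power_int_add)
    qed
    finally show ?thesis
      by (simp add: mult_ac)
  qed
  then show ?case
    by blast
qed

text \<open>
  Boundedness handles low frequencies, and decay of order \<open>K\<close> with \<open>(q\<^sup>2) ^ K < x\<close> handles high ones.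
\<close>

lemma hahn_exton_series_weighted_summable:
  assumes h: "even_q_schwartz q h" and x: "0 < x" "x < 1"
  shows "(\<lambda>l. norm (hahn_exton_series (q\<^sup>2) q (\<lambda>k. h (q powi k) * of_real (q powi k)) (l + u)) * x powi l)
    summable_on UNIV"
proof -
  let ?F = "hahn_exton_series (q\<^sup>2) q (\<lambda>k. h (q powi k) * of_real (q powi k))"
  obtain K where K: "(q\<^sup>2) ^ K < x"
    using real_arch_pow_inv[OF x(1) q_square(2)] by blast
  obtain B where B: "\<And>l. norm (?F l) \<le> B"
    using hahn_exton_series_bounded[OF q_square q(1) even_q_schwartz_summable[OF h]] by blast
  obtain C where C: "\<And>l. norm (?F l) \<le> C * (q\<^sup>2) powi (- (int K * l))"
    using hahn_exton_series_rapid_decay[OF h] by blast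
  have "(\<lambda>l. norm (norm (?F (l + u)) * x powi l)) summable_on UNIV"
  proof (rule summable_on_int_geometric[of x "x / (q\<^sup>2) ^ K" _ B "C * (q\<^sup>2) powi (- (int K * u))"])
    fix l
    have xl: "0 < x powi l"
      using x by simp
    show "norm (norm (?F (l + u)) * x powi l) \<le> B * x powi l"
      using B[of "l + u"] xl by (simp add: abs_mult mult_right_mono)
    have "norm (norm (?F (l + u)) * x powi l) \<le> C * (q\<^sup>2) powi (- (int K * (l + u))) * x powi l"
      using mult_right_mono[OF C[of "l + u"], of "x powi l"] xl by (simp add: abs_mult)
    also have "(q\<^sup>2) powi (- (int K * (l + u))) = (q\<^sup>2) powi (- (int K * u)) * (q\<^sup>2) powi (- (int K * l))"
    proof -
      have "- (int K * (l + u)) = - (int K * u) + - (int K * l)"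
        by (simp add: algebra_simps)
      moreover have "q\<^sup>2 \<noteq> 0"
        using q by simp
      ultimately show ?thesis
        by (metis power_int_add)
    qed
    also have "(q\<^sup>2) powi (- (int K * l)) = 1 / ((q\<^sup>2) ^ K) powi l"
      by (simp add: power_int_minus power_int_mult inverse_eq_divide)
    also have "C * ((q\<^sup>2) powi (- (int K * u)) * (1 / ((q\<^sup>2) ^ K) powi l)) * x powi l =
        C * (q\<^sup>2) powi (- (int K * u)) * (x / (q\<^sup>2) ^ K) powi l"
      by (simp add: power_int_divide_distrib)
    finally show "norm (norm (?F (l + u)) * x powi l) \<le> \<dots>" .
  qed (use x K q in \<open>auto simp: field_simps\<close>)
  then show ?thesis
    by (rule abs_summable_summable)
qed

end

section \<open>The transforms on the lattice of powers\<close>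

lemma Rq_powi [simp]: "q powi n \<in> Rq q"
  by (auto simp: Rq_def)

lemma powi_powr:
  fixes q :: real
  assumes "0 < q"
  shows "(q powi k) powr x = (q powr x) powi k"
proof -
  have "(q powi k) powr x = q powr (real_of_int k * x)"
    using assms by (simp add: powr_powr flip: powr_real_of_int')
  also have "\<dots> = (q powr x) powi k"
    using assms by (simp add: powr_powr mult.commute flip: powr_real_of_int')
  finally show ?thesis .
qed

lemma powr_lt_one:
  fixes q :: real
  assumes "0 < q" "q < 1" "0 < x"
  shows "q powr x < 1"
  using assms by (simp add: powr_def mult_pos_neg)

lemma q_square_powr:
  fixes q :: real
  assumes "0 < q"
  shows "(q\<^sup>2) powr x = q powr (2 * x)"
  using assms by (simp add: powr_powr flip: powr_numeral)

context
  fixes q :: real and N :: int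
  assumes q: "0 < q" "q < 1" and N: "1 - q = q powi N"
begin

text \<open>
  The arithmetic condition enters here: \<open>((1 - q) * q powi m)\<^sup>2\<close> is an integer power of \<open>q\<^sup>2\<close>. The power series
  of the Bessel function becomes a symmetric double series in \<open>b\<close> and \<open>x\<close> once
  \<open>1 / (b; p)\<^sub>n = (b * p ^ n; p)\<^sub>\<infinity> / (b; p)\<^sub>\<infinity>\<close> is expanded by Euler's identity; summing over the original index
  first yields the other representation.
\<close>

lemma q_bessel_j_eq_hahn_exton:
  assumes "\<beta> > - 1"
  shows "q_bessel_j q \<beta> (q powi m) = qpoch_inf (q\<^sup>2) (q\<^sup>2) / qpoch_inf (q powr (2 * \<beta> + 2)) (q\<^sup>2) *
    hahn_exton (q\<^sup>2) (q powr (2 * \<beta> + 2)) (m + N - 1)"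
proof -
  note p = q_square[OF q]
  define p where "p = q\<^sup>2"
  define b where "b = q powr (2 * \<beta> + 2)"
  define x where "x = p powi (N + m)"
  have p: "0 < p" "p < 1"
    using q_square[OF q] by (simp_all add: p_def)
  have b: "0 < b" "b < 1"
    using q assms powr_lt_one[of q "2 * \<beta> + 2"] by (simp_all add: b_def)
  have bpos: "0 < qpoch_inf b p"
    using qpoch_inf_pos[OF p b(2)] .
  have split: "qpoch_inf b p = qpoch b p n * qpoch_inf (b * p ^ n) p" for n
    by (rule qpoch_inf_split[OF p])
  have inv: "1 / qpoch b p n = qpoch_inf (b * p ^ n) p / qpoch_inf b p" for n
  proof -
    have "qpoch_inf (b * p ^ n) p \<noteq> 0"
      using bpos split[of n] by auto
    then show ?thesis
      using qpoch_pos[OF p b(2), of n] unfolding split[of n] by simp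
  qed
  define F where "F n j = euler_coeff p n * x ^ n * (euler_coeff p j * (b * p ^ n) ^ j)" for n j
  have "q_bessel_j q \<beta> (q powi m) = (\<Sum>n. euler_coeff p n * x ^ n * (1 / qpoch b p n))"
    unfolding q_bessel_j_def
  proof (rule suminf_cong)
    fix n :: nat
    have "even (n * (n - 1))"
      by (cases n) auto
    then have "n * (n - 1) = 2 * (n choose 2)"
      by (simp add: choose_two)
    then have 1: "q ^ (n * (n - 1)) = p ^ (n choose 2)"
      by (simp add: p_def power_mult)
    have "(1 - q) ^ (2 * n) * (q powi m) ^ (2 * n) = ((q powi (N + m))\<^sup>2) ^ n"
      using q unfolding N by (simp add: power_int_add power_mult power_mult_distrib)
    also have "(q powi (N + m))\<^sup>2 = x"
      unfolding x_def p_def power2_eq_square by (simp add: power_int_mult_distrib)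
    finally show "(- 1) ^ n * q ^ (n * (n - 1)) * (1 - q) ^ (2 * n) * (q powi m) ^ (2 * n) /
        (qpoch (q\<^sup>2) (q\<^sup>2) n * qpoch (q powr (2 * \<beta> + 2)) (q\<^sup>2) n) =
        euler_coeff p n * x ^ n * (1 / qpoch b p n)"
      unfolding 1 by (simp add: euler_coeff_def p_def b_def mult.assoc)
  qed
  also have "\<dots> = (\<Sum>\<^sub>\<infinity>n. euler_coeff p n * x ^ n * (1 / qpoch b p n))"
  proof (rule infsum_nat_eq_suminf[symmetric],
      rule Infinite_Sum.abs_summable_on_comparison_test'[OF summable_on_cmult_left[OF summable_euler[OF p]]])
    fix n
    have "\<bar>1 / qpoch b p n\<bar> \<le> 1 / qpoch_inf b p"
      using qpoch_inf_le_qpoch[OF p _ b(2), of n] b bpos qpoch_pos[OF p b(2), of n]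
      by (simp add: frac_le)
    then show "norm (euler_coeff p n * x ^ n * (1 / qpoch b p n)) \<le>
        norm (euler_coeff p n * x ^ n) * (1 / qpoch_inf b p)"
      unfolding real_norm_def abs_mult[of _ "1 / qpoch b p n"] by (intro mult_left_mono) auto
  qed
  also have "\<dots> = (\<Sum>\<^sub>\<infinity>n. \<Sum>\<^sub>\<infinity>j. F n j) / qpoch_inf b p"
  proof -
    have "(\<Sum>\<^sub>\<infinity>j. F n j) = euler_coeff p n * x ^ n * qpoch_inf (b * p ^ n) p" for n
      by (simp only: F_def infsum_cmult_right' euler_identity[OF p])
    then show ?thesis
      unfolding inv by (simp only: divide_inverse mult.assoc[symmetric] infsum_cmult_left')
  qed
  also have "(\<Sum>\<^sub>\<infinity>n. \<Sum>\<^sub>\<infinity>j. F n j) = (\<Sum>\<^sub>\<infinity>j. \<Sum>\<^sub>\<infinity>n. F n j)"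
  proof (rule infsum_swap_dominated[OF _ summable_euler[OF p] summable_euler[OF p]])
    fix n j
    have "(p ^ n) ^ j \<le> 1"
      using p by (simp add: power_le_one)
    then have "(b * p ^ n) ^ j \<le> b ^ j"
      using b by (simp add: power_mult_distrib mult_left_le)
    then have "\<bar>(b * p ^ n) ^ j\<bar> \<le> \<bar>b ^ j\<bar>"
      using b p by simp
    then show "norm (F n j) \<le> norm (euler_coeff p n * x ^ n) * norm (euler_coeff p j * b ^ j)"
      unfolding F_def real_norm_def abs_mult by (intro mult_left_mono mult_nonneg_nonneg) auto
  qed
  also have "\<dots> = (\<Sum>\<^sub>\<infinity>j. qpoch_inf p p * (euler_coeff p j * b ^ j * inv_qfact p (m + N - 1 + int j)))"
  proof (rule infsum_cong)
    fix j
    have "x * p ^ j = p powi (N + m + int j)"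
      using p by (simp add: x_def power_int_add)
    also have "N + m + int j = (m + N - 1 + int j) + 1"
      by simp
    finally have x: "x * p ^ j = p powi ((m + N - 1 + int j) + 1)" .
    have "(\<Sum>\<^sub>\<infinity>n. F n j) = (\<Sum>\<^sub>\<infinity>n. (euler_coeff p j * b ^ j) * (euler_coeff p n * (x * p ^ j) ^ n))"
      by (rule infsum_cong) (simp add: F_def power_mult_distrib mult_ac flip: power_mult)
    also have "\<dots> = (euler_coeff p j * b ^ j) * qpoch_inf (x * p ^ j) p"
      unfolding infsum_cmult_right' euler_identity[OF p, symmetric] ..
    finally show "(\<Sum>\<^sub>\<infinity>n. F n j) =
        qpoch_inf p p * (euler_coeff p j * b ^ j * inv_qfact p (m + N - 1 + int j))"
      unfolding x qpoch_inf_power_int[OF p] by simp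
  qed
  finally show ?thesis
    unfolding infsum_cmult_right' hahn_exton_def p_def b_def by simp
qed

lemma q_Gamma_square:
  "q_Gamma (q\<^sup>2) x = qpoch_inf (q\<^sup>2) (q\<^sup>2) / qpoch_inf (q powr (2 * x)) (q\<^sup>2) * (1 - q\<^sup>2) powr (1 - x)"
  by (simp add: q_Gamma_def q_square_powr[OF q(1)])

lemma qpoch_inf_powr_pos: "0 < x \<Longrightarrow> 0 < qpoch_inf (q powr x) (q\<^sup>2)"
  using q powr_lt_one[of q x] by (intro qpoch_inf_pos q_square) auto

lemma qpoch_inf_square_pos: "0 < qpoch_inf (q\<^sup>2) (q\<^sup>2)"
  using q_square[OF q] by (intro qpoch_inf_pos)

lemma one_minus_square_powr: "(1 - q\<^sup>2) powr x = (1 - q) powr x * (1 + q) powr x"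
proof -
  have "1 - q\<^sup>2 = (1 - q) * (1 + q)"
    by (simp add: power2_eq_square algebra_simps)
  then show ?thesis
    using q by (simp add: powr_mult)
qed

lemma one_plus_inverse_powr: "(1 + 1 / q) powr x = (1 + q) powr x * q powr (- x)"
proof -
  have "1 + 1 / q = (1 + q) / q"
    using q by (simp add: field_simps)
  then show ?thesis
    using q by (simp only: powr_divide powr_minus_divide) (simp add: powr_divide)
qed

lemma q_const_factor:
  assumes "\<beta> > - 1"
  shows "q_const q \<beta> * (1 - q) * (qpoch_inf (q\<^sup>2) (q\<^sup>2) / qpoch_inf (q powr (2 * \<beta> + 2)) (q\<^sup>2)) =
    (1 - q) powr (1 + \<beta>) * q powr \<beta>"
proof -
  have *: "(1 - q) powr (1 + \<beta>) = (1 - q) * (1 - q) powr \<beta>"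
    using q by (simp add: powr_add)
  have "2 * (\<beta> + 1) = 2 * \<beta> + 2"
    by simp
  then show ?thesis
    unfolding q_const_def q_Gamma_square one_plus_inverse_powr one_minus_square_powr *
    using q qpoch_inf_powr_pos[of "2 * \<beta> + 2"] qpoch_inf_square_pos assms
    by (simp add: powr_minus field_simps)
qed

lemma q_bessel_fourier_eq_series:
  assumes "\<beta> > - 1"
  shows "q_bessel_fourier q \<beta> F (q powi l) = of_real ((1 - q) powr (1 + \<beta>) * q powr \<beta>) *
    hahn_exton_series (q\<^sup>2) (q powr (2 * \<beta> + 2))
      (\<lambda>k. F (q powi k) * of_real ((q powr (2 * \<beta> + 2)) powi k)) (l + (N - 1))"
proof -
  let ?b = "q powr (2 * \<beta> + 2)" and ?c = "qpoch_inf (q\<^sup>2) (q\<^sup>2) / qpoch_inf (q powr (2 * \<beta> + 2)) (q\<^sup>2)"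
  have *: "F (q powi k) * of_real (q_bessel_j q \<beta> (q powi l * q powi k) * (q powi k) powr (2 * \<beta> + 1)) *
      of_real (q powi k) =
      of_real ?c * (F (q powi k) * of_real (?b powi k) * of_real (hahn_exton (q\<^sup>2) ?b (k + (l + (N - 1)))))" for k
  proof -
    have "q powi l * q powi k = q powi (l + k)"
      using q by (simp add: power_int_add)
    then have j: "q_bessel_j q \<beta> (q powi l * q powi k) = ?c * hahn_exton (q\<^sup>2) ?b (k + (l + (N - 1)))"
      using q_bessel_j_eq_hahn_exton[OF assms, of "l + k"] by (simp add: algebra_simps)
    have "?b = q powr (2 * \<beta> + 1) * q"
      using q powr_add[of q "2 * \<beta> + 1" 1] by (simp add: add.assoc)
    then have "(q powi k) powr (2 * \<beta> + 1) * q powi k = ?b powi k"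
      by (simp only: powi_powr[OF q(1)] power_int_mult_distrib)
    then have b: "of_real ((q powi k) powr (2 * \<beta> + 1)) * of_real (q powi k) = (of_real (?b powi k) :: complex)"
      by (simp only: flip: of_real_mult)
    show ?thesis
      unfolding j b[symmetric] of_real_mult by (simp only: mult_ac)
  qed
  have "q_bessel_fourier q \<beta> F (q powi l) = of_real (q_const q \<beta>) * (of_real (1 - q) *
      (\<Sum>\<^sub>\<infinity>k. of_real ?c * (F (q powi k) * of_real (?b powi k) * of_real (hahn_exton (q\<^sup>2) ?b (k + (l + (N - 1)))))))"
    unfolding q_bessel_fourier_def jackson_inf_def restrict_apply'[OF Rq_powi] * ..
  also have "\<dots> = of_real (q_const q \<beta> * (1 - q) * ?c) *
    hahn_exton_series (q\<^sup>2) ?b (\<lambda>k. F (q powi k) * of_real (?b powi k)) (l + (N - 1))"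
    unfolding infsum_cmult_right' hahn_exton_series_def of_real_mult by (simp only: mult_ac)
  finally show ?thesis
    unfolding q_const_factor[OF assms] .
qed

lemma q_cos_fourier_eq_series:
  "q_cos_fourier q F (q powi l) = of_real ((1 - q) powr (1 / 2) * q powr (- 1 / 2)) *
    hahn_exton_series (q\<^sup>2) q (\<lambda>k. F (q powi k) * of_real (q powi k)) (l + (N - 1))"
proof -
  have "q_cos_fourier q F (q powi l) = q_bessel_fourier q (- 1 / 2) F (q powi l)"
    using q by (simp add: q_cos_fourier_def q_bessel_fourier_def q_cos_def jackson_inf_def)
  then show ?thesis
    using q_bessel_fourier_eq_series[of "- 1 / 2" F l] q by simp
qed

lemma kernel_ratio:
  assumes "0 < a" "a < 1"
  shows "qpoch_inf (q\<^sup>2 * (q\<^sup>2) ^ n) (q\<^sup>2) / qpoch_inf (a * (q\<^sup>2) ^ n) (q\<^sup>2) =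
    qpoch_inf (q\<^sup>2) (q\<^sup>2) / qpoch_inf a (q\<^sup>2) * qbinom_coeff (q\<^sup>2) a n"
proof -
  note p = q_square[OF q]
  have "qpoch_inf (a * (q\<^sup>2) ^ n) (q\<^sup>2) \<noteq> 0"
    using qpoch_inf_split[OF p, of a n] qpoch_inf_pos[OF p assms(2)] by auto
  then show ?thesis
    unfolding qpoch_inf_split[OF p, of a n] qpoch_inf_split[OF p, of "q\<^sup>2" n] qbinom_coeff_def
    using qpoch_pos[OF p assms(2), of n] qfact_pos[OF p, of n] by (simp add: field_simps)
qed

end

context
  fixes q \<alpha> :: real and N :: int
  assumes q: "0 < q" "q < 1" and N: "1 - q = q powi N" and \<alpha>: "\<alpha> > - 1 / 2"
begin

text \<open>
  The Riemann-Liouville transform on the lattice is this constant times the sum with kernel \<open>qbinom_coeff\<close>: it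
  collects the normalisation, the factor \<open>1 - q\<close> of the Jackson integral and the value of the kernel at \<open>n = 0\<close>.
\<close>

definition "rl_const = (1 + q) * q_Gamma (q\<^sup>2) (\<alpha> + 1) / (q_Gamma (q\<^sup>2) (1 / 2) * q_Gamma (q\<^sup>2) (\<alpha> + 1 / 2)) *
  (1 - q) * (qpoch_inf (q\<^sup>2) (q\<^sup>2) / qpoch_inf (q powr (2 * \<alpha> + 1)) (q\<^sup>2))"

text \<open>
  Here the value of the kernel on the diagonal is left out, since it does not occur at the origin.
\<close>

definition "weyl_const = q * (1 + 1 / q) powr (- \<alpha> + 1 / 2) / q_Gamma (q\<^sup>2) (\<alpha> + 1 / 2) * (1 - q)"

lemma a_bounds: "0 < q powr (2 * \<alpha> + 1)" "q powr (2 * \<alpha> + 1) < 1"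
  using q \<alpha> powr_lt_one[of q "2 * \<alpha> + 1"] by auto

lemma q_riemann_liouville_eq:
  assumes "\<And>k. F (q powi k) = f k" and f: "\<And>k. norm (f k) \<le> C"
  shows "q_riemann_liouville q \<alpha> F (q powi m) = of_real rl_const *
    (\<Sum>\<^sub>\<infinity>n. of_real (qbinom_coeff (q\<^sup>2) (q powr (2 * \<alpha> + 1)) n * q ^ n) * f (m + int n))"
proof -
  let ?a = "q powr (2 * \<alpha> + 1)"
  let ?c = "qpoch_inf (q\<^sup>2) (q\<^sup>2) / qpoch_inf ?a (q\<^sup>2)"
  have *: "of_real (qpoch_inf ((1 * q ^ n)\<^sup>2 * q\<^sup>2) (q\<^sup>2) / qpoch_inf ((1 * q ^ n)\<^sup>2 * ?a) (q\<^sup>2)) *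
      F (q powi m * (1 * q ^ n)) * of_real (q ^ n) =
      of_real ?c * (of_real (qbinom_coeff (q\<^sup>2) ?a n * q ^ n) * f (m + int n))" for n
  proof -
    have "(1 * q ^ n)\<^sup>2 * x = x * (q\<^sup>2) ^ n" for x
      by (simp add: power_even_eq power_mult[symmetric] mult.commute)
    moreover have "q powi m * (1 * q ^ n) = q powi (m + int n)"
      using q by (simp add: power_int_add)
    ultimately show ?thesis
      by (simp only: kernel_ratio[OF q N a_bounds] assms(1)) (simp add: mult_ac)
  qed
  obtain B where B: "\<And>n. \<bar>qbinom_coeff (q\<^sup>2) ?a n\<bar> \<le> B"
    using qbinom_coeff_bounded[OF q_square[OF q]] by blast
  have sm: "(\<lambda>n. norm (of_real (qbinom_coeff (q\<^sup>2) ?a n * q ^ n) * f (m + int n))) summable_on UNIV"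
  proof (rule summable_on_nat_geometric[of q _ "B * C"])
    fix n
    have "norm (of_real (qbinom_coeff (q\<^sup>2) ?a n * q ^ n) * f (m + int n)) \<le> (B * q ^ n) * C"
      unfolding norm_mult norm_of_real abs_mult using B[of n] f[of "m + int n"] q
      by (intro mult_mono mult_nonneg_nonneg) auto
    then show "norm (of_real (qbinom_coeff (q\<^sup>2) ?a n * q ^ n) * f (m + int n)) \<le> B * C * q ^ n"
      by (simp add: mult_ac)
  qed (use q in auto)
  show ?thesis
    unfolding q_riemann_liouville_def jackson_def restrict_apply'[OF Rq_powi] *
    unfolding suminf_mult[OF summable_on_imp_summable[OF abs_summable_summable[OF sm]]]
      infsum_nat_eq_suminf[OF sm] rl_const_def
    by simp
qed

text \<open>
  The kernel vanishes at the nodes \<open>t < x\<close>, so that the Jackson integral from \<open>q * x\<close> to \<open>\<infinity>\<close> runs over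
  the nodes \<open>t \<ge> x\<close>.
\<close>

lemma weyl_kernel_below_diagonal: "k > m \<Longrightarrow>
  qpoch_inf (q\<^sup>2 * (q powi m)\<^sup>2 / (q powi k)\<^sup>2) (q\<^sup>2) = 0"
proof -
  assume k: "k > m"
  have "q\<^sup>2 * (q powi m)\<^sup>2 / (q powi k)\<^sup>2 = (q\<^sup>2) powi ((m - k) + 1)"
    using q by (simp add: power_int_add power_int_diff power2_eq_square power_int_mult_distrib)
  then show ?thesis
    using k by (simp add: qpoch_inf_power_int[OF q_square[OF q]] inv_qfact_neg[OF q_square[OF q]])
qed

lemma q_weyl_eq:
  assumes F: "\<And>k. F (q powi k) = f k" and x: "\<bar>x\<bar> = q powi m" "x \<in> Rq q"
  shows "q_weyl q \<alpha> F x = of_real (weyl_const * (qpoch_inf (q\<^sup>2) (q\<^sup>2) / qpoch_inf (q powr (2 * \<alpha> + 1)) (q\<^sup>2))) *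
    (\<Sum>\<^sub>\<infinity>n. of_real (qbinom_coeff (q\<^sup>2) (q powr (2 * \<alpha> + 1)) n * (q powr (2 * \<alpha> + 1)) powi (m - int n)) *
      f (m - int n))"
proof -
  let ?a = "q powr (2 * \<alpha> + 1)"
  let ?c = "qpoch_inf (q\<^sup>2) (q\<^sup>2) / qpoch_inf ?a (q\<^sup>2)"
  define G where "G = (\<lambda>t. of_real (qpoch_inf (q\<^sup>2 * (q powi m)\<^sup>2 / t\<^sup>2) (q\<^sup>2) /
      qpoch_inf (?a * (q powi m)\<^sup>2 / t\<^sup>2) (q\<^sup>2)) * F t * of_real (t powr (2 * \<alpha>)))"
  have G0: "G (q powi k) = 0" if "k > m" for k
    using weyl_kernel_below_diagonal[OF that] by (simp add: G_def)
  have "G (q * q powi m * q ^ n) = 0" for n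
  proof -
    have "q * q powi m * q ^ n = q powi (m + 1 + int n)"
      using q by (simp add: power_int_add)
    then show ?thesis
      using G0[of "m + 1 + int n"] by simp
  qed
  then have "jackson q (q * q powi m) G = 0"
    by (simp add: jackson_def)
  then have "jackson_tail q (q * q powi m) G = of_real (1 - q) * (\<Sum>\<^sub>\<infinity>k. G (q powi k) * of_real (q powi k))"
    by (simp add: jackson_tail_def jackson_inf_def)
  also have "(\<Sum>\<^sub>\<infinity>k. G (q powi k) * of_real (q powi k)) =
      (\<Sum>\<^sub>\<infinity>k\<in>range (\<lambda>n. m - int n). G (q powi k) * of_real (q powi k))"
  proof (rule infsum_cong_neutral)
    fix k assume "k \<in> UNIV - range (\<lambda>n. m - int n)"
    then have "k > m"
      by (auto simp: image_iff) (metis add_diff_cancel_left' diff_add_cancel int_nat_eq le_diff_eq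
        not_less add.commute add_0 diff_diff_eq2)
    then show "G (q powi k) * of_real (q powi k) = 0"
      by (simp add: G0)
  qed auto
  also have "\<dots> = (\<Sum>\<^sub>\<infinity>n. G (q powi (m - int n)) * of_real (q powi (m - int n)))"
    by (subst infsum_reindex) (auto simp: inj_on_def o_def)
  also have "\<dots> = (\<Sum>\<^sub>\<infinity>n. of_real ?c * (of_real (qbinom_coeff (q\<^sup>2) ?a n * ?a powi (m - int n)) * f (m - int n)))"
  proof (rule infsum_cong)
    fix n
    let ?t = "q powi (m - int n)"
    have *: "y * (q powi m)\<^sup>2 / ?t\<^sup>2 = y * (q\<^sup>2) ^ n" for y
    proof -
      have "q powi m = ?t * q ^ n"
        using q by (simp add: power_int_diff)
      then have "(q powi m)\<^sup>2 = ?t\<^sup>2 * (q\<^sup>2) ^ n"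
        by (simp only: power_mult_distrib) (simp flip: power_mult add: mult.commute)
      then show ?thesis
        using q by simp
    qed
    have "?a = q powr (2 * \<alpha>) * q"
      using q by (simp add: powr_add)
    then have "?t powr (2 * \<alpha>) * ?t = ?a powi (m - int n)"
      by (simp only: powi_powr[OF q(1)] power_int_mult_distrib)
    then have T: "of_real (?t powr (2 * \<alpha>)) * of_real ?t = (of_real (?a powi (m - int n)) :: complex)"
      by (simp only: flip: of_real_mult)
    show "G ?t * of_real ?t =
        of_real ?c * (of_real (qbinom_coeff (q\<^sup>2) ?a n * ?a powi (m - int n)) * f (m - int n))"
      unfolding G_def * kernel_ratio[OF q N a_bounds] F of_real_mult T[symmetric]
      by (simp only: mult_ac)
  qed
  finally show ?thesis
    unfolding q_weyl_def restrict_apply'[OF x(2)] x(1) weyl_const_def infsum_cmult_right' G_def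
    by (simp add: mult_ac)
qed

lemma q_weyl_0:
  assumes F: "\<And>k. F (q powi k) = f k"
  shows "q_weyl q \<alpha> F 0 = of_real weyl_const * (\<Sum>\<^sub>\<infinity>k. of_real ((q powr (2 * \<alpha> + 1)) powi k) * f k)"
proof -
  let ?a = "q powr (2 * \<alpha> + 1)"
  have *: "F (q powi k) * of_real ((q powi k) powr (2 * \<alpha>)) * of_real (q powi k) = of_real (?a powi k) * f k" for k
  proof -
    have "?a = q powr (2 * \<alpha>) * q"
      using q by (simp add: powr_add)
    then have "(q powi k) powr (2 * \<alpha>) * (q powi k) = ?a powi k"
      by (simp only: powi_powr[OF q(1)] power_int_mult_distrib)
    then have "of_real ((q powi k) powr (2 * \<alpha>)) * of_real (q powi k) = (of_real (?a powi k) :: complex)"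
      by (simp only: flip: of_real_mult)
    then show ?thesis
      unfolding F by (simp only: mult_ac)
  qed
  define G where "G = (\<lambda>t. F t * of_real (t powr (2 * \<alpha>)))"
  have 0: "0 \<in> Rq q"
    by (simp add: Rq_def)
  have "qpoch_inf 0 (q\<^sup>2) = 1"
    by (simp add: qpoch_inf_def)
  then have "(\<lambda>t. of_real (qpoch_inf (q\<^sup>2 * \<bar>0\<bar>\<^sup>2 / t\<^sup>2) (q\<^sup>2) / qpoch_inf (?a * \<bar>0\<bar>\<^sup>2 / t\<^sup>2) (q\<^sup>2)) *
      F t * of_real (t powr (2 * \<alpha>))) = G"
    by (simp add: G_def)
  moreover have "jackson_tail q (q * \<bar>0\<bar>) G = of_real (1 - q) * (\<Sum>\<^sub>\<infinity>k. of_real (?a powi k) * f k)"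
    by (simp only: jackson_tail_def jackson_inf_def jackson_def G_def *) simp
  ultimately show ?thesis
    unfolding q_weyl_def weyl_const_def restrict_apply'[OF 0] by (simp add: mult_ac)
qed

section \<open>Evaluation of the constants\<close>

lemma q_Gamma_pos: "0 < x \<Longrightarrow> 0 < q_Gamma (q\<^sup>2) x"
  unfolding q_Gamma_square[OF q N] using q q_square[OF q]
  by (intro mult_pos_pos divide_pos_pos qpoch_inf_powr_pos[OF q N] qpoch_inf_square_pos[OF q N]) auto

lemma qpoch_inf_ratio:
  "qpoch_inf (q\<^sup>2) (q\<^sup>2) / qpoch_inf (q powr (2 * \<alpha> + 1)) (q\<^sup>2) =
    q_Gamma (q\<^sup>2) (\<alpha> + 1 / 2) * (1 - q\<^sup>2) powr (\<alpha> - 1 / 2)"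
proof -
  have "2 * (\<alpha> + 1 / 2) = 2 * \<alpha> + 1" "1 - (\<alpha> + 1 / 2) = - (\<alpha> - 1 / 2)"
    by simp_all
  then show ?thesis
    unfolding q_Gamma_square[OF q N] using q_square[OF q] by (simp only: powr_minus) simp
qed

lemma kappa_rl_const:
  "q_kappa q \<alpha> * rl_const = (1 - q) powr (\<alpha> + 1 / 2) * q powr (- 3 * \<alpha> - 3 / 2)"
proof -
  have G: "0 < q_Gamma (q\<^sup>2) (1 / 2)" "0 < q_Gamma (q\<^sup>2) (\<alpha> + 1)" "0 < q_Gamma (q\<^sup>2) (\<alpha> + 1 / 2)"
    using \<alpha> by (intro q_Gamma_pos, simp)+
  have 1: "(1 + q) * (1 - q) * (1 - q\<^sup>2) powr (\<alpha> - 1 / 2) = (1 - q) powr (\<alpha> + 1 / 2) * (1 + q) powr (\<alpha> + 1 / 2)"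
  proof -
    have "(1 + q) * (1 - q) = 1 - q\<^sup>2"
      by (simp add: power2_eq_square algebra_simps)
    then have "(1 + q) * (1 - q) * (1 - q\<^sup>2) powr (\<alpha> - 1 / 2) = (1 - q\<^sup>2) powr (1 + (\<alpha> - 1 / 2))"
      unfolding powr_add using q_square[OF q] by simp
    also have "1 + (\<alpha> - 1 / 2) = \<alpha> + 1 / 2"
      by simp
    finally show ?thesis
      unfolding one_minus_square_powr[OF q N] .
  qed
  have rl: "rl_const = q_Gamma (q\<^sup>2) (\<alpha> + 1) / q_Gamma (q\<^sup>2) (1 / 2) * ((1 + q) * (1 - q) * (1 - q\<^sup>2) powr (\<alpha> - 1 / 2))"
    unfolding rl_const_def qpoch_inf_ratio using G by simp
  have "q_kappa q \<alpha> * rl_const = (1 - q) powr (\<alpha> + 1 / 2) / q powr (3 * \<alpha> + 3 / 2)"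
  proof -
    have cancel: "g0 / (R * Q * g1) * (g1 / g0 * (P * Q)) = P / R"
      if "g0 \<noteq> 0" "g1 \<noteq> 0" "Q \<noteq> 0" for g0 g1 P Q R :: real
      using that by simp
    show ?thesis
      unfolding rl 1 q_kappa_def by (rule cancel) (use G q in auto)
  qed
  moreover have "q powr (- 3 * \<alpha> - 3 / 2) = inverse (q powr (3 * \<alpha> + 3 / 2))"
  proof -
    have "- 3 * \<alpha> - 3 / 2 = - (3 * \<alpha> + 3 / 2)"
      by simp
    then show ?thesis
      by (simp only: powr_minus)
  qed
  ultimately show ?thesis
    by (simp only: divide_inverse)
qed

lemma weyl_const_ratio:
  "weyl_const * (qpoch_inf (q\<^sup>2) (q\<^sup>2) / qpoch_inf (q powr (2 * \<alpha> + 1)) (q\<^sup>2)) =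
    (1 - q) powr (\<alpha> + 1 / 2) * q powr (\<alpha> + 1 / 2)"
proof -
  have G: "0 < q_Gamma (q\<^sup>2) (\<alpha> + 1 / 2)"
    using \<alpha> by (intro q_Gamma_pos) simp
  have 1: "(1 + q) powr (- \<alpha> + 1 / 2) * (1 + q) powr (\<alpha> - 1 / 2) = 1"
    using q by (simp flip: powr_add)
  have 2: "q * q powr (- (- \<alpha> + 1 / 2)) = q powr (\<alpha> + 1 / 2)"
  proof -
    have e: "\<alpha> + 1 / 2 = 1 + - (- \<alpha> + 1 / 2)"
      by simp
    show ?thesis
      unfolding e powr_add using q by simp
  qed
  have 3: "(1 - q) * (1 - q) powr (\<alpha> - 1 / 2) = (1 - q) powr (\<alpha> + 1 / 2)"
  proof -
    have e: "\<alpha> + 1 / 2 = 1 + (\<alpha> - 1 / 2)"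
      by simp
    show ?thesis
      unfolding e powr_add using q by simp
  qed
  have "weyl_const * (qpoch_inf (q\<^sup>2) (q\<^sup>2) / qpoch_inf (q powr (2 * \<alpha> + 1)) (q\<^sup>2)) =
      (q * q powr (- (- \<alpha> + 1 / 2))) * ((1 - q) * (1 - q) powr (\<alpha> - 1 / 2)) *
      ((1 + q) powr (- \<alpha> + 1 / 2) * (1 + q) powr (\<alpha> - 1 / 2))"
    unfolding weyl_const_def qpoch_inf_ratio one_minus_square_powr[OF q N] one_plus_inverse_powr[OF q N]
    using G by (simp add: mult_ac)
  then show ?thesis
    unfolding 1 2 3 by simp
qed

lemma powr_powi: "(q powr y) powi n = q powr (y * of_int n)"
  using q by (simp add: powr_powr flip: powr_real_of_int')

lemma one_minus_powr: "(1 - q) powr y = q powr (of_int N * y)"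
  unfolding N using q by (simp add: powr_powr flip: powr_real_of_int')

text \<open>
  After cancellation of the Gamma functions only powers of \<open>q\<close> and \<open>1 - q\<close> remain; with \<open>1 - q = q powi N\<close> the
  exponents add up to \<open>0\<close>.
\<close>

lemma constants_cancel:
  "q_kappa q \<alpha> * rl_const * (weyl_const * (qpoch_inf (q\<^sup>2) (q\<^sup>2) / qpoch_inf (q powr (2 * \<alpha> + 1)) (q\<^sup>2))) *
    (q powr (2 * \<alpha> + 1)) powi (- (N - 1)) = 1"
  unfolding kappa_rl_const weyl_const_ratio one_minus_powr powr_powi powr_add[symmetric]
  using q by (simp add: algebra_simps)

text \<open>
  The square of the normalisation of the Fourier transform times the constant of \<open>hahn_exton_inversion\<close>. It equals
  \<open>1\<close> for the cosine transform and explains the factor \<open>q powr (- 4 * \<alpha> - 2)\<close> in the inverse Bessel transform.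
\<close>

lemma fourier_constant:
  "((1 - q) powr (1 + \<beta>) * q powr \<beta>)\<^sup>2 * (q powr (2 * \<beta> + 2)) powi (- (N - 1)) = q powr (4 * \<beta> + 2)"
  unfolding power2_eq_square one_minus_powr powr_powi powr_add[symmetric]
  by (simp add: algebra_simps)

end

section \<open>The inversion formulas\<close>

context
  fixes q \<alpha> :: real and N :: int and f h :: "real \<Rightarrow> complex"
  assumes q: "0 < q" "q < 1" and N: "1 - q = q powi N" and \<alpha>: "\<alpha> > - 1 / 2"
    and h: "even_q_schwartz q h" and f: "f = restrict h (Rq q)"
begin

text \<open>
  The quotient of the parameters \<open>b\<close> belonging to \<open>j\<^sub>\<alpha>\<close> and to the cosine. Its powers are the values of
  \<open>\<lambda> powr (2 * \<alpha> + 1)\<close> on the lattice.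
\<close>

abbreviation "base_ratio \<equiv> q powr (2 * \<alpha> + 1)"
abbreviation "\<omega> \<equiv> (1 - q) powr (1 / 2) * q powr (- 1 / 2)"
abbreviation "cos_transform l \<equiv> q_cos_fourier q f (q powi l)"
abbreviation "series \<equiv> hahn_exton_series (q\<^sup>2)"
text \<open>
  The weights of the common expansion of \<open>R (K\<^sub>1 f)\<close> and \<open>K\<^sub>2 (R f)\<close> in dilates of \<open>j\<^sub>\<alpha>\<close>.
\<close>

abbreviation "bessel_weighted l \<equiv> of_real (base_ratio powi l * q powi l) * cos_transform l"
text \<open>
  The weights of the cosine expansion of \<open>f\<close>, by \<open>fourier_inversion\<close> below.
\<close>

abbreviation "cos_weighted l \<equiv> of_real (q powi l) * cos_transform l"
abbreviation "image_const \<equiv> q_kappa q \<alpha> * rl_const q \<alpha> * \<omega>"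

lemmas p_bounds = q_square[OF q]
lemmas base_ratio_bounds = a_bounds[OF q N \<alpha>]

lemma f_powi: "f (q powi k) = h (q powi k)"
  by (simp add: f)

lemma cos_transform_eq:
  "cos_transform l = of_real \<omega> * series q (\<lambda>k. of_real (q powi k) * f (q powi k)) (l + (N - 1))"
  using q_cos_fourier_eq_series[OF q N, of f l] by (simp only: mult.commute)

lemma cos_transform_summable:
  assumes "0 < x" "x < 1"
  shows "(\<lambda>l. norm (cos_transform l) * x powi l) summable_on UNIV"
  using summable_on_cmult_right[OF hahn_exton_series_weighted_summable[OF q h assms, of "N - 1"], of "\<bar>\<omega>\<bar>"]
  unfolding q_cos_fourier_eq_series[OF q N] norm_mult norm_of_real f_powi by (simp only: mult.assoc)

lemma cos_weighted_summable: "(\<lambda>l. norm (cos_weighted l)) summable_on UNIV"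
proof -
  have "norm (cos_weighted l) = norm (cos_transform l) * q powi l" for l
    using q by (simp add: norm_mult norm_power_int)
  then show ?thesis
    using cos_transform_summable[OF q] by simp
qed

lemma bessel_weighted_summable: "(\<lambda>l. norm (bessel_weighted l)) summable_on UNIV"
proof -
  have "norm (bessel_weighted l) = norm (cos_transform l) * (base_ratio * q) powi l" for l
    using q by (simp add: norm_mult norm_power_int power_int_mult_distrib)
  moreover have "base_ratio * q < 1"
    using base_ratio_bounds q mult_strict_mono[of base_ratio 1 q 1] by simp
  ultimately show ?thesis
    using cos_transform_summable[of "base_ratio * q"] q by simp
qed

lemma fourier_inversion: "of_real \<omega> * series q cos_weighted (k + (N - 1)) = f (q powi k)"
proof -
  have "series q cos_weighted (k + (N - 1)) = series q (\<lambda>l. of_real \<omega> * (of_real (q powi l) *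
      series q (\<lambda>k. of_real (q powi k) * f (q powi k)) (l + (N - 1)))) (k + (N - 1))"
    unfolding cos_transform_eq by (simp only: mult.left_commute)
  also have "\<dots> = of_real \<omega> * (of_real (q powi (- k - (N - 1))) * (of_real (q powi k) * f (q powi k)))"
    unfolding hahn_exton_series_cmult
    using even_q_schwartz_summable[OF q h]
    by (subst hahn_exton_inversion[OF p_bounds q]) (simp_all only: f_powi mult.commute)
  finally have "of_real \<omega> * series q cos_weighted (k + (N - 1)) =
      of_real (\<omega> * \<omega> * (q powi (- k - (N - 1)) * q powi k)) * f (q powi k)"
    by (simp only: of_real_mult mult_ac)
  also have "\<omega> * \<omega> * (q powi (- k - (N - 1)) * q powi k) = \<omega>\<^sup>2 * q powi (- (N - 1))"
    using q by (simp add: power2_eq_square flip: power_int_add)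
  also have "\<dots> = 1"
    using fourier_constant[OF q N \<alpha>, of "- 1 / 2"] q by simp
  finally show ?thesis
    by simp
qed

lemma K1_eq:
  "K1 q \<alpha> f (q powi k) = of_real (q_kappa q \<alpha> * \<omega>) * series q bessel_weighted (k + (N - 1))"
proof -
  have "(\<lambda>l\<in>Rq q. of_real (\<bar>l\<bar> powr (2 * \<alpha> + 1)) * q_cos_fourier q f l) (q powi l) * of_real (q powi l) = bessel_weighted l" for l
    unfolding restrict_apply'[OF Rq_powi] using q by (simp add: powi_powr)
  then show ?thesis
    unfolding K1_def restrict_apply'[OF Rq_powi] q_cos_fourier_inv_def q_cos_fourier_eq_series[OF q N]
    by (simp only: of_real_mult mult.assoc)
qed

text \<open>
  \<open>K\<^sub>1 f\<close> is a superposition of cosines, and the Riemann-Liouville transform replaces each of them by \<open>j\<^sub>\<alpha>\<close>.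
\<close>

lemma RK1_eq:
  "q_riemann_liouville q \<alpha> (K1 q \<alpha> f) (q powi m) = of_real image_const * series (base_ratio * q) bessel_weighted (m + (N - 1))"
proof -
  let ?c = "of_real (q_kappa q \<alpha> * \<omega>) :: complex"
  obtain C where C: "\<And>m. norm (series q bessel_weighted m) \<le> C"
    using hahn_exton_series_bounded[OF p_bounds q(1) bessel_weighted_summable] by blast
  have b: "norm (?c * series q bessel_weighted (k + (N - 1))) \<le> norm ?c * C" for k
    unfolding norm_mult[of ?c] using C by (intro mult_left_mono) auto
  have "q_riemann_liouville q \<alpha> (K1 q \<alpha> f) (q powi m) = of_real (rl_const q \<alpha>) *
    (\<Sum>\<^sub>\<infinity>n. of_real (qbinom_coeff (q\<^sup>2) base_ratio n * q ^ n) * (?c * series q bessel_weighted (m + int n + (N - 1))))"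
    by (rule q_riemann_liouville_eq[OF q N \<alpha>, where f = "\<lambda>k. ?c * series q bessel_weighted (k + (N - 1))", OF K1_eq b])
  also have "\<dots> = of_real (rl_const q \<alpha>) * (\<Sum>\<^sub>\<infinity>n. ?c *
      (of_real (qbinom_coeff (q\<^sup>2) base_ratio n * q ^ n) * series q bessel_weighted ((m + (N - 1)) + int n)))"
    by (simp only: mult_ac add_ac)
  finally show ?thesis
    unfolding infsum_cmult_right' hahn_exton_series_mult[OF p_bounds q bessel_weighted_summable] by (simp add: mult_ac)
qed

lemma Rf_eq:
  "q_riemann_liouville q \<alpha> f (q powi m) = of_real (rl_const q \<alpha> * \<omega>) * series (base_ratio * q) cos_weighted (m + (N - 1))"
proof -
  obtain C where C: "\<And>m. norm (series q cos_weighted m) \<le> C"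
    using hahn_exton_series_bounded[OF p_bounds q(1) cos_weighted_summable] by blast
  have b: "norm (of_real \<omega> * series q cos_weighted (k + (N - 1))) \<le> norm (of_real \<omega> :: complex) * C" for k
    unfolding norm_mult[of "of_real \<omega>"] using C by (intro mult_left_mono) auto
  have "q_riemann_liouville q \<alpha> f (q powi m) = of_real (rl_const q \<alpha>) *
    (\<Sum>\<^sub>\<infinity>n. of_real (qbinom_coeff (q\<^sup>2) base_ratio n * q ^ n) * (of_real \<omega> * series q cos_weighted (m + int n + (N - 1))))"
    by (rule q_riemann_liouville_eq[OF q N \<alpha>, where f = "\<lambda>k. of_real \<omega> * series q cos_weighted (k + (N - 1))",
        OF fourier_inversion[symmetric] b])
  also have "\<dots> = of_real (rl_const q \<alpha>) * (\<Sum>\<^sub>\<infinity>n. of_real \<omega> *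
      (of_real (qbinom_coeff (q\<^sup>2) base_ratio n * q ^ n) * series q cos_weighted ((m + (N - 1)) + int n)))"
    by (simp only: mult_ac add_ac)
  finally show ?thesis
    unfolding infsum_cmult_right' hahn_exton_series_mult[OF p_bounds q cos_weighted_summable] by (simp add: mult_ac)
qed

lemma bessel_base: "q powr (2 * \<alpha> + 2) = base_ratio * q"
  using q powr_add[of q "2 * \<alpha> + 1" 1] by (simp add: add.assoc)

lemma bessel_base_bounds: "0 < base_ratio * q" "base_ratio * q < 1"
  using base_ratio_bounds q mult_strict_mono[of base_ratio 1 q 1] by simp_all

text \<open>
  \<open>R f\<close> is a superposition of functions \<open>j\<^sub>\<alpha>\<close>, hence a Bessel transform, which the inner Bessel transform in \<open>K\<^sub>2\<close>
  inverts; the factor \<open>base_ratio powi (- l)\<close> left over is cancelled by \<open>\<bar>\<lambda>\<bar> powr (2 * \<alpha> + 1)\<close>.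
\<close>

lemma K2Rf_eq:
  "K2 q \<alpha> (q_riemann_liouville q \<alpha> f) (q powi m) = of_real image_const * series (base_ratio * q) bessel_weighted (m + (N - 1))"
proof -
  let ?w = "(1 - q) powr (1 + \<alpha>) * q powr \<alpha>"
  let ?R = "q_riemann_liouville q \<alpha> f"
  have \<alpha>': "\<alpha> > - 1"
    using \<alpha> by simp
  have FR: "q_bessel_fourier q \<alpha> ?R (q powi l) =
      of_real (?w * rl_const q \<alpha> * \<omega> * (base_ratio * q) powi (- (N - 1)) * base_ratio powi (- l)) * cos_transform l" for l
  proof -
    have "q_bessel_fourier q \<alpha> ?R (q powi l) = of_real ?w * series (base_ratio * q)
        (\<lambda>k. of_real (rl_const q \<alpha> * \<omega>) * (of_real ((base_ratio * q) powi k) * series (base_ratio * q) cos_weighted (k + (N - 1)))) (l + (N - 1))"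
      unfolding q_bessel_fourier_eq_series[OF q N \<alpha>'] Rf_eq bessel_base by (simp only: mult_ac)
    also have "\<dots> = of_real ?w * (of_real (rl_const q \<alpha> * \<omega>) * (of_real ((base_ratio * q) powi (- l - (N - 1))) * cos_weighted l))"
      unfolding hahn_exton_series_cmult hahn_exton_inversion[OF p_bounds bessel_base_bounds cos_weighted_summable] ..
    also have "(base_ratio * q) powi (- l - (N - 1)) = (base_ratio * q) powi (- (N - 1)) * base_ratio powi (- l) * inverse (q powi l)"
    proof -
      have "(base_ratio * q) powi (- l - (N - 1)) = (base_ratio * q) powi (- (N - 1)) * (base_ratio * q) powi (- l)"
      proof -
        have e: "- l - (N - 1) = - (N - 1) + - l"
          by simp
        show ?thesis
          unfolding e using bessel_base_bounds(1) by (intro power_int_add) auto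
      qed
      then show ?thesis
        by (simp add: power_int_mult_distrib power_int_minus)
    qed
    also have "of_real ?w * (of_real (rl_const q \<alpha> * \<omega>) *
        (of_real ((base_ratio * q) powi (- (N - 1)) * base_ratio powi (- l) * inverse (q powi l)) * cos_weighted l)) =
        of_real (?w * rl_const q \<alpha> * \<omega> * (base_ratio * q) powi (- (N - 1)) * base_ratio powi (- l)) * cos_transform l"
      using q by simp
    finally show ?thesis .
  qed
  let ?c = "?w * rl_const q \<alpha> * \<omega> * (base_ratio * q) powi (- (N - 1))"
  define Y where "Y = (\<lambda>l\<in>Rq q. of_real (\<bar>l\<bar> powr (2 * \<alpha> + 1)) * q_bessel_fourier q \<alpha> ?R l)"
  have *: "Y (q powi l) *
      of_real ((base_ratio * q) powi l) = of_real ?c * bessel_weighted l" for l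
  proof -
    have "\<bar>q powi l\<bar> powr (2 * \<alpha> + 1) * base_ratio powi (- l) = 1"
      using q by (simp add: powi_powr power_int_minus)
    then have "of_real (\<bar>q powi l\<bar> powr (2 * \<alpha> + 1)) * of_real (base_ratio powi (- l)) = (1 :: complex)"
      by (simp only: flip: of_real_mult) simp
    moreover have "of_real (\<bar>q powi l\<bar> powr (2 * \<alpha> + 1)) * (of_real (?c * base_ratio powi (- l)) * cos_transform l) * of_real ((base_ratio * q) powi l) =
        (of_real (\<bar>q powi l\<bar> powr (2 * \<alpha> + 1)) * of_real (base_ratio powi (- l))) * (of_real ?c * cos_transform l * of_real ((base_ratio * q) powi l))"
      unfolding of_real_mult[of ?c] by (simp only: mult_ac)
    ultimately show ?thesis
      unfolding Y_def restrict_apply'[OF Rq_powi] FR power_int_mult_distrib by (simp only: mult_ac mult_1_left)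
  qed
  have "K2 q \<alpha> ?R (q powi m) = of_real (q_kappa q \<alpha>) * (of_real (q powr (- 4 * \<alpha> - 2)) *
      (of_real ?w * (of_real ?c * series (base_ratio * q) bessel_weighted (m + (N - 1)))))"
    unfolding K2_def Y_def[symmetric] q_bessel_fourier_inv_def restrict_apply'[OF Rq_powi]
      q_bessel_fourier_eq_series[OF q N \<alpha>'] bessel_base * hahn_exton_series_cmult ..
  also have "\<dots> = of_real (q_kappa q \<alpha> * rl_const q \<alpha> * \<omega> *
      (q powr (- 4 * \<alpha> - 2) * (?w\<^sup>2 * (base_ratio * q) powi (- (N - 1))))) * series (base_ratio * q) bessel_weighted (m + (N - 1))"
    unfolding power2_eq_square of_real_mult by (simp only: mult_ac)
  also have "q powr (- 4 * \<alpha> - 2) * (?w\<^sup>2 * (base_ratio * q) powi (- (N - 1))) = 1"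
    using fourier_constant[OF q N \<alpha>, of \<alpha>] q unfolding bessel_base by (simp flip: powr_add)
  finally show ?thesis
    by simp
qed

lemma weights_cancel: "of_real (base_ratio powi (- l)) * bessel_weighted l = cos_weighted l"
  using q by (simp add: power_int_minus)

text \<open>
  The Weyl transform replaces each \<open>j\<^sub>\<alpha>\<close> by a cosine and removes the powers of \<open>base_ratio\<close>, which leaves the cosine
  expansion of \<open>f\<close>.
\<close>

lemma q_weyl_recovers_powi:
  assumes F: "\<And>m. F (q powi m) = of_real image_const * series (base_ratio * q) bessel_weighted (m + (N - 1))"
    and x: "\<bar>x\<bar> = q powi m" "x \<in> Rq q"
  shows "q_weyl q \<alpha> F x = f (q powi m)"
proof -
  let ?W = "weyl_const q \<alpha> * (qpoch_inf (q\<^sup>2) (q\<^sup>2) / qpoch_inf base_ratio (q\<^sup>2))"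
  \<comment> \<open>Any exponent of \<open>q\<close> strictly between \<open>0\<close> and \<open>1\<close> would do: \<open>r < base_ratio\<close> serves the sum over the kernel, and
    the weights stay summable because \<open>base_ratio * q / r < 1\<close>.\<close>
  let ?r = "base_ratio * q powr (1 / 2)"
  have r: "0 < ?r" "?r \<le> 1" "?r < base_ratio"
    using base_ratio_bounds q powr_lt_one[OF q, of "1 / 2"] mult_le_one[of base_ratio "q powr (1 / 2)"] by simp_all
  have sm: "(\<lambda>l. norm (bessel_weighted l) * ?r powi (- l)) summable_on UNIV"
  proof -
    have "norm (bessel_weighted l) * ?r powi (- l) = norm (cos_transform l) * (q powr (1 / 2)) powi l" for l
    proof -
      have "base_ratio powi l * q powi l * ?r powi (- l) = (q / q powr (1 / 2)) powi l"
        using q by (simp add: power_int_mult_distrib power_int_minus power_int_divide_distrib field_simps)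
      also have "q / q powr (1 / 2) = q powr (1 / 2)"
        using q by (simp add: powr_half_sqrt real_div_sqrt)
      finally have E: "base_ratio powi l * q powi l * ?r powi (- l) = (q powr (1 / 2)) powi l" .
      have "norm (bessel_weighted l) = norm (cos_transform l) * (base_ratio powi l * q powi l)"
        unfolding norm_mult norm_of_real using q by simp
      then have "norm (bessel_weighted l) * ?r powi (- l) = norm (cos_transform l) * (base_ratio powi l * q powi l * ?r powi (- l))"
        by (simp only: mult.assoc)
      then show ?thesis
        unfolding E .
    qed
    then show ?thesis
      using cos_transform_summable[of "q powr (1 / 2)"] q powr_lt_one[OF q, of "1 / 2"] by simp
  qed
  have "q_weyl q \<alpha> F x = of_real ?W * (\<Sum>\<^sub>\<infinity>n. of_real (qbinom_coeff (q\<^sup>2) base_ratio n * base_ratio powi (m - int n)) *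
      (of_real image_const * series (base_ratio * q) bessel_weighted (m - int n + (N - 1))))"
    by (rule q_weyl_eq[OF q N \<alpha>, where f = "\<lambda>m. of_real image_const * series (base_ratio * q) bessel_weighted (m + (N - 1))", OF F x])
  also have "\<dots> = of_real ?W * (\<Sum>\<^sub>\<infinity>n. of_real (image_const * base_ratio powi m) *
      (of_real (qbinom_coeff (q\<^sup>2) base_ratio n * (1 / base_ratio) ^ n) * series (base_ratio * q) bessel_weighted ((m + (N - 1)) - int n)))"
  proof -
    have "base_ratio powi (m - int n) = base_ratio powi m * (1 / base_ratio) ^ n" for n
      using q by (simp add: power_int_diff power_inverse divide_inverse)
    moreover have "m - int n + (N - 1) = (m + (N - 1)) - int n" for n
      by simp
    ultimately show ?thesis
      by (simp only: of_real_mult mult_ac)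
  qed
  also have "\<dots> = of_real (?W * image_const * (base_ratio powi m * base_ratio powi (- (m + (N - 1))))) * series q cos_weighted (m + (N - 1))"
    unfolding infsum_cmult_right' hahn_exton_series_divide[OF p_bounds base_ratio_bounds(1) q(1) r sm] weights_cancel
    by (simp only: of_real_mult mult_ac)
  also have "base_ratio powi m * base_ratio powi (- (m + (N - 1))) = base_ratio powi (- (N - 1))"
    using q by (simp flip: power_int_add)
  also have "?W * image_const * base_ratio powi (- (N - 1)) = \<omega> * (q_kappa q \<alpha> * rl_const q \<alpha> * ?W * base_ratio powi (- (N - 1)))"
    by (simp only: mult_ac)
  also have "\<dots> = \<omega>"
    unfolding constants_cancel[OF q N \<alpha>] by simp
  finally show ?thesis
    unfolding fourier_inversion .
qed

text \<open>
  Both sides equal \<open>(q; p)\<^sub>\<infinity> / (p; p)\<^sub>\<infinity>\<close> times the sum of the weights of the cosine expansion, up to the same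
  normalisation: the Weyl integral by direct evaluation, and \<open>f 0\<close> as the limit of the cosine expansion along the
  lattice, by continuity of the even extension at the origin.
\<close>

lemma q_weyl_recovers_0:
  assumes F: "\<And>m. F (q powi m) = of_real image_const * series (base_ratio * q) bessel_weighted (m + (N - 1))"
  shows "q_weyl q \<alpha> F 0 = f 0"
proof -
  let ?u = "N - 1"
  let ?S = "\<Sum>\<^sub>\<infinity>l. cos_weighted l"
  have sm: "(\<lambda>l. norm (of_real (base_ratio powi (- l)) * bessel_weighted l)) summable_on UNIV"
    unfolding weights_cancel by (rule cos_weighted_summable)
  have pos: "0 < qpoch_inf (q\<^sup>2) (q\<^sup>2)" "0 < qpoch_inf base_ratio (q\<^sup>2)"
    using qpoch_inf_pos[OF p_bounds] p_bounds base_ratio_bounds by simp_all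
  have "q_weyl q \<alpha> F 0 = of_real (weyl_const q \<alpha>) * (\<Sum>\<^sub>\<infinity>k. of_real (base_ratio powi k) * (of_real image_const * series (base_ratio * q) bessel_weighted (k + ?u)))"
    by (rule q_weyl_0[OF q N \<alpha>, where f = "\<lambda>m. of_real image_const * series (base_ratio * q) bessel_weighted (m + (N - 1))", OF F])
  also have "\<dots> = of_real (weyl_const q \<alpha>) * (\<Sum>\<^sub>\<infinity>k. of_real image_const * (of_real (base_ratio powi k) * series (base_ratio * q) bessel_weighted (k + ?u)))"
    by (simp only: mult_ac)
  also have "\<dots> = of_real (weyl_const q \<alpha> * image_const * (base_ratio powi (- ?u) * (qpoch_inf q (q\<^sup>2) / qpoch_inf base_ratio (q\<^sup>2)))) * ?S"
    unfolding infsum_cmult_right' infsum_hahn_exton_series_power[OF p_bounds base_ratio_bounds q(1) sm] weights_cancel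
    by (simp only: of_real_mult mult_ac)
  also have "weyl_const q \<alpha> * image_const * (base_ratio powi (- ?u) * (qpoch_inf q (q\<^sup>2) / qpoch_inf base_ratio (q\<^sup>2))) =
      \<omega> * (qpoch_inf q (q\<^sup>2) / qpoch_inf (q\<^sup>2) (q\<^sup>2)) *
      (q_kappa q \<alpha> * rl_const q \<alpha> * (weyl_const q \<alpha> * (qpoch_inf (q\<^sup>2) (q\<^sup>2) / qpoch_inf base_ratio (q\<^sup>2))) * base_ratio powi (- ?u))"
    using pos by (simp add: mult_ac)
  also have "\<dots> = \<omega> * (qpoch_inf q (q\<^sup>2) / qpoch_inf (q\<^sup>2) (q\<^sup>2))"
    unfolding constants_cancel[OF q N \<alpha>] by simp
  finally have W: "q_weyl q \<alpha> F 0 = of_real (\<omega> * (qpoch_inf q (q\<^sup>2) / qpoch_inf (q\<^sup>2) (q\<^sup>2))) * ?S" .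
  have "(\<lambda>l. norm (cos_weighted l) * (q\<^sup>2) powi l) summable_on UNIV"
  proof -
    have "norm (cos_weighted l) * (q\<^sup>2) powi l = norm (cos_transform l) * (q * q\<^sup>2) powi l" for l
      using q by (simp add: norm_mult norm_power_int power_int_mult_distrib)
    moreover have "q * q\<^sup>2 < 1"
      using q p_bounds mult_strict_mono[of q 1 "q\<^sup>2" 1] by simp
    ultimately show ?thesis
      using cos_transform_summable[of "q * q\<^sup>2"] q by simp
  qed
  from hahn_exton_series_limit[OF p_bounds q(1) cos_weighted_summable this]
  have "(\<lambda>n. of_real \<omega> * series q cos_weighted (int n)) \<longlonglongrightarrow>
      of_real \<omega> * (of_real (qpoch_inf q (q\<^sup>2) / qpoch_inf (q\<^sup>2) (q\<^sup>2)) * ?S)"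
    by (rule tendsto_mult_left)
  moreover have "eventually (\<lambda>n. of_real \<omega> * series q cos_weighted (int n) = h (q powi (int n - ?u))) sequentially"
    using fourier_inversion[of "int _ - ?u"] by (simp add: f_powi)
  ultimately have 1: "(\<lambda>n. h (q powi (int n - ?u))) \<longlonglongrightarrow>
      of_real \<omega> * (of_real (qpoch_inf q (q\<^sup>2) / qpoch_inf (q\<^sup>2) (q\<^sup>2)) * ?S)"
    by (rule Lim_transform_eventually)
  \<comment> \<open>The shift by \<open>N - 1\<close> is absorbed in the index, since \<open>h (q ^ n)\<close> tends to \<open>h 0\<close>.\<close>
  have "(\<lambda>n. h (q powi (int (n + nat ?u) - ?u))) \<longlonglongrightarrow>
      of_real \<omega> * (of_real (qpoch_inf q (q\<^sup>2) / qpoch_inf (q\<^sup>2) (q\<^sup>2)) * ?S)"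
    by (rule LIMSEQ_ignore_initial_segment[OF 1])
  moreover have "(\<lambda>n. h (q powi (int (n + nat ?u) - ?u))) = (\<lambda>n. h (q ^ (n + nat (- ?u))))"
  proof
    fix n
    have "int (n + nat ?u) - ?u = int (n + nat (- ?u))"
      by simp
    then show "h (q powi (int (n + nat ?u) - ?u)) = h (q ^ (n + nat (- ?u)))"
      by (simp only: power_int_of_nat)
  qed
  moreover have "(\<lambda>n. h (q ^ (n + nat (- ?u)))) \<longlonglongrightarrow> h 0"
    by (rule LIMSEQ_ignore_initial_segment[OF even_q_schwartz_tendsto_0[OF q h]])
  ultimately have "h 0 = of_real \<omega> * (of_real (qpoch_inf q (q\<^sup>2) / qpoch_inf (q\<^sup>2) (q\<^sup>2)) * ?S)"
    using LIMSEQ_unique by fastforce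
  then show ?thesis
    unfolding W by (simp add: f Rq_def)
qed

lemma q_weyl_recovers:
  assumes F: "\<And>m. F (q powi m) = of_real image_const * series (base_ratio * q) bessel_weighted (m + (N - 1))"
  shows "q_weyl q \<alpha> F = f"
proof
  fix x
  consider (zero) "x = 0" | (powi) m where "x \<in> Rq q" "\<bar>x\<bar> = q powi m" | (out) "x \<notin> Rq q"
    using q by (fastforce simp: Rq_def)
  then show "q_weyl q \<alpha> F x = f x"
  proof cases
    case zero
    then show ?thesis
      using q_weyl_recovers_0[OF F] by simp
  next
    case (powi m)
    then have "x = q powi m \<or> x = - (q powi m)"
      by linarith
    then have "h x = h (q powi m)"
      using h by (auto simp: even_q_schwartz_def)
    then show ?thesis
      unfolding q_weyl_recovers_powi[OF F powi(2,1)] f_powi using powi by (simp add: f)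
  next
    case out
    then show ?thesis
      by (simp add: q_weyl_def f)
  qed
qed

end

lemma one_minus_q_powi:
  fixes q :: real
  assumes "0 < q" "q < 1" "ln (1 - q) / ln q \<in> \<int>"
  obtains N :: int where "1 - q = q powi N"
proof -
  obtain N :: int where N: "ln (1 - q) / ln q = of_int N"
    using assms(3) by (auto elim: Ints_cases)
  then have L: "ln (1 - q) = of_int N * ln q"
    using assms by (simp add: field_simps)
  have "1 - q = exp (ln (1 - q))"
    using assms by simp
  also have "\<dots> = q powr of_int N"
    unfolding L using assms by (simp add: powr_def)
  finally have "1 - q = q powr of_int N" .
  then have "1 - q = q powi N"
    using assms by (simp add: powr_real_of_int')
  then show ?thesis
    by (rule that)
qed

theorem theorem12:
  fixes q \<alpha> :: real and f :: "real \<Rightarrow> complex"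
  assumes "0 < q" and "q < 1" and "ln (1 - q) / ln q \<in> \<int>" and "\<alpha> > - 1 / 2"
    and "f \<in> q_schwartz0 q (- 1 / 2)"
  shows "f = (q_weyl q \<alpha> \<circ> q_riemann_liouville q \<alpha> \<circ> K1 q \<alpha>) f
       \<and> f = (q_weyl q \<alpha> \<circ> K2 q \<alpha> \<circ> q_riemann_liouville q \<alpha>) f"
proof -
  obtain N where N: "1 - q = q powi N"
    using one_minus_q_powi assms(1-3) by blast
  obtain h where h: "even_q_schwartz q h" "f = restrict h (Rq q)"
    using assms(5) by (auto simp: q_schwartz0_def q_schwartz_def even_q_schwartz_def)
  note setting = assms(1,2) N assms(4) h
  show ?thesis
    using q_weyl_recovers[OF setting RK1_eq[OF setting]]
      q_weyl_recovers[OF setting K2Rf_eq[OF setting]]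
    by simp
qed

end
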